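(* For each natural number $n\ge 1$ we have $\kappa(\xi_n)=n$.
   Context: $\zeta$ is Riemann's zeta function; $\vartheta\colon\mathbf{R}\to\mathbf{R}$ is the Riemann–Siegel theta function, i.e. the real analytic function with $\vartheta(0)=0$ and $\Gamma(\frac14+\frac{it}{2})=|\Gamma(\frac14+\frac{it}{2})|\,e^{i(\vartheta(t)+\frac t2\log\pi)}$. The function $\kappa\colon\mathbf{R}\to\mathbf{R}$ is the unique real analytic function with $\kappa(0)=-\frac12$ and $e^{2\pi i\kappa(t)}=1+2\vartheta'(t)\frac{\zeta(1/2+it)}{\zeta'(1/2+it)}$ for all real $t$ (the quotient is extended analytically, with value $0$, at points where $\zeta'(\frac12+it)=0$; such points are zeros of $\zeta(\frac12+it)$). The sequence $0<\xi_1<\xi_2<\cdots$ enumerates in increasing order, without multiplicity, the set $\{t>0:\zeta(\frac12+it)=0\}$. No unproved hypothesis is assumed. *)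

theory Defs
  imports "HOL-Complex_Analysis.Complex_Analysis"
begin

text \<open>The meromorphic continuation of the Dirichlet series. The pole at 1 gets the dummy
  value 0, so that the total function is uniquely determined.\<close>

definition zeta :: "complex \<Rightarrow> complex" where
  "zeta = (THE f. f holomorphic_on - {1} \<and> f 1 = 0 \<and>
     (\<forall>s. Re s > 1 \<longrightarrow> (\<lambda>n. 1 / of_nat (Suc n) powr s) sums f s))"

definition real_analytic :: "(real \<Rightarrow> real) \<Rightarrow> bool" where
  "real_analytic f \<longleftrightarrow>
     (\<forall>x. \<exists>r>0. \<exists>a. \<forall>y. \<bar>y - x\<bar> < r \<longrightarrow> (\<lambda>k. a k * (y - x) ^ k) sums f y)"

text \<open>The Riemann--Siegel theta function.\<close>

definition rs_theta :: "real \<Rightarrow> real" where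
  "rs_theta = (THE f. real_analytic f \<and> f 0 = 0 \<and>
     (\<forall>t. Gamma (1/4 + \<i> * of_real t / 2) =
        of_real (norm (Gamma (1/4 + \<i> * of_real t / 2))) *
        exp (\<i> * of_real (f t + t / 2 * ln pi))))"

text \<open>Points with \<open>deriv zeta (1/2 + \<i> * t) = 0\<close> are zeros of zeta, so the quotient has a
  removable singularity with value 0 there. This is the value that division by zero produces.\<close>

definition kappa :: "real \<Rightarrow> real" where
  "kappa = (THE f. real_analytic f \<and> f 0 = - 1/2 \<and>
     (\<forall>t. exp (2 * of_real pi * \<i> * of_real (f t)) =
        1 + 2 * of_real (deriv rs_theta t) *
          (zeta (1/2 + \<i> * of_real t) / deriv zeta (1/2 + \<i> * of_real t))))"

end

theory Submission
  imports Defs "HOL-Probability.Probability" "HOL-Real_Asymp.Real_Asymp"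
begin

text \<open>
  Let \<open>\<Lambda>\<close> be the completed zeta function. It is real on the critical line, and writing
  \<open>w = Z' + i \<vartheta>' Z\<close> with Hardy's function \<open>Z\<close>, one finds \<open>exp (2 \<pi> i \<kappa>) = w / cnj w\<close>. Hence \<open>\<kappa>\<close> is an
  integer exactly at the zeros of \<open>\<vartheta>' Z\<close>, and the sign of \<open>sin (2 \<pi> \<kappa>)\<close> is that of \<open>\<vartheta>' Z Z'\<close>.
  Since \<open>Z\<^sup>2\<close> decreases on approaching a zero of \<open>Z\<close> and increases after leaving it, \<open>\<kappa>\<close> crosses
  an integer upwards at each zero at which \<open>\<vartheta>' > 0\<close>. So \<open>\<kappa>\<close> increases by exactly 1 between consecutive zeros.
  The start of the count is numerical: \<open>\<vartheta>'\<close> has a unique positive zero \<open>t0\<close> (about 6.29), \<open>Z\<close> has no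
  zero in \<open>[0, t0]\<close>, and \<open>Z'(t0) < 0\<close>, which makes \<open>\<kappa>\<close> pass upwards through 0 at \<open>t0\<close>. The
  bounds come from the representation of \<open>\<Lambda>\<close> as an integral against the theta function, which
  also provides the continuation and the functional equation.
\<close>

section \<open>Theta inversion\<close>

text \<open>The value of \<open>kappa\<close> is an integer not only at the zeros of zeta but also
  where the derivative of theta vanishes, and the normalisation at 0 lies before that point. The
  sign of Z' there decides the additive constant of the whole count: with the opposite sign,
  \<open>kappa\<close> would cross -1 downwards at \<open>t0\<close> and equal -1 instead of 1 at
  the first zero. The same strict sign excludes a common zero of theta' and Z', so that zeta'
  vanishes on the line only where zeta does and the quotient has no pole. Simplicity of the zeros is
  unknown. The sign of Z Z' near a zero is therefore read off from Z^2 by the mean value theorem,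
  not from Z' at the zero. Between zeros nothing is claimed about monotonicity of
  \<open>kappa\<close>, only that it meets no integer. The numerical margins are thin: the bound
  that keeps Z negative up to \<open>t0\<close> has less than one percent to spare, which is why pi
  and exp pi are bounded to several digits and the integral kernel is treated by tailored
  polynomials.\<close>

lemma cosine_coefficients_unique:
  fixes h :: "real \<Rightarrow> real"
  assumes cont: "continuous_on {0..1/2} h"
    and orth: "\<And>k::nat. integral {0..1/2} (\<lambda>y. h y * cos (2 * pi * real k * y)) = 0"
    and y: "y \<in> {0..1/2}"
  shows "h y = 0"
proof -
  let ?I = "{0..1/2::real}"
  define c where "c = (\<lambda>y::real. cos (2 * pi * y))"
  have int: "(\<lambda>y. h y * f y) integrable_on ?I" if "continuous_on ?I f" for f
    by (intro integrable_continuous_interval continuous_intros cont that)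
  \<comment> \<open>Integer frequencies let the product-to-sum step pass from \<open>k\<close> to
    \<open>k - 1\<close> and \<open>k + 1\<close> with no exception at \<open>k = 0\<close>.\<close>
  have pow: "integral ?I (\<lambda>y. h y * (cos (2 * pi * of_int k * y) * c y ^ m)) = 0" for k :: int and m
  proof (induction m arbitrary: k)
    case 0
    have "cos (2 * pi * of_int k * y) = cos (2 * pi * real (nat \<bar>k\<bar>) * y)" for y
    proof (cases "k \<ge> 0")
      case False
      have "cos (2 * pi * of_int k * y) = cos (- (2 * pi * of_int k * y))" by simp
      also have "\<dots> = cos (2 * pi * real (nat \<bar>k\<bar>) * y)" using False by (simp add: algebra_simps)
      finally show ?thesis .
    qed simp
    then show ?case using orth[of "nat \<bar>k\<bar>"] by simp
  next
    case (Suc m)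
    have eq: "h y * (cos (2 * pi * of_int k * y) * c y ^ Suc m) =
       (1/2) * (h y * (cos (2 * pi * of_int (k - 1) * y) * c y ^ m)) +
       (1/2) * (h y * (cos (2 * pi * of_int (k + 1) * y) * c y ^ m))" for y
    proof -
      have "cos (2 * pi * of_int k * y) * c y =
          (cos (2 * pi * of_int (k - 1) * y) + cos (2 * pi * of_int (k + 1) * y)) / 2"
        unfolding c_def cos_times_cos by (simp add: algebra_simps)
      then have "h y * (cos (2 * pi * of_int k * y) * c y ^ Suc m) = h y * c y ^ m *
          ((cos (2 * pi * of_int (k - 1) * y) + cos (2 * pi * of_int (k + 1) * y)) / 2)"
        by (metis (no_types, opaque_lifting) mult.assoc mult.commute power_Suc)
      then show ?thesis by (simp add: algebra_simps)
    qed
    have ci: "(\<lambda>y. (1/2) * (h y * (cos (2 * pi * of_int j * y) * c y ^ m))) integrable_on ?I" for j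
      unfolding c_def by (intro integrable_continuous_interval continuous_intros cont)
    show ?case
      unfolding eq integral_add[OF ci ci] integral_mult_right
      using Suc.IH[of "k - 1"] Suc.IH[of "k + 1"] by simp
  qed
  \<comment> \<open>On half a period \<open>c\<close> is injective, so \<open>h\<close> is a
    continuous function of \<open>c\<close>. Approximation by ordinary polynomials on
    \<open>[-1, 1]\<close> then takes the place of approximation by trigonometric ones.\<close>
  define \<Phi> where "\<Phi> = (\<lambda>w. h (arccos w / (2 * pi)))"
  have \<Phi>c: "\<Phi> (c y) = h y" if "y \<in> ?I" for y
  proof -
    have "2 * pi * y \<le> 2 * pi * (1/2)" using that by (intro mult_left_mono) auto
    then show ?thesis using that unfolding \<Phi>_def c_def by (subst arccos_cos) auto
  qed
  have cont\<Phi>: "continuous_on {-1..1} \<Phi>"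
    unfolding \<Phi>_def
  proof (rule continuous_on_compose2[OF cont])
    show "continuous_on {-1..1} (\<lambda>w. arccos w / (2 * pi))"
      by (intro continuous_intros) auto
    show "(\<lambda>w. arccos w / (2 * pi)) ` {-1..1} \<subseteq> ?I"
      using arccos_lbound arccos_ubound by (fastforce simp: field_simps)
  qed
  have cI: "c y \<in> {-1..1}" for y by (simp add: c_def)
  have polyz: "integral ?I (\<lambda>y. h y * p (c y)) = 0" if p: "real_polynomial_function p" for p
  proof -
    obtain a n where pe: "p = (\<lambda>x. \<Sum>i\<le>n. a i * x ^ i)"
      using p real_polynomial_function_iff_sum by auto
    have "integral ?I (\<lambda>y. h y * p (c y)) = integral ?I (\<lambda>y. \<Sum>i\<le>n. a i * (h y * (c y ^ i)))"
      unfolding pe by (simp add: sum_distrib_left mult_ac)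
    also have "\<dots> = (\<Sum>i\<le>n. integral ?I (\<lambda>y. a i * (h y * (c y ^ i))))"
      unfolding c_def
      by (intro integral_sum) (auto intro!: integrable_continuous_interval continuous_intros cont)
    also have "\<dots> = 0"
      using pow[of 0] by (intro sum.neutral ballI) simp
    finally show ?thesis .
  qed
  have hh: "integral ?I (\<lambda>y. h y * h y) = 0"
  proof -
    define A where "A = integral ?I (\<lambda>y. \<bar>h y\<bar>)"
    have A0: "A \<ge> 0" unfolding A_def
      by (intro integral_nonneg integrable_continuous_interval continuous_intros cont) auto
    have ge: "integral ?I (\<lambda>y. h y * h y) \<ge> 0"
      by (intro integral_nonneg int cont) auto
    \<comment> \<open>Since \<open>h * p (c y)\<close> integrates to 0, the square of
      \<open>h\<close> may be replaced by \<open>h * (h - p (c y))\<close>, whose second factor is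
      uniformly small.\<close>
    have le: "integral ?I (\<lambda>y. h y * h y) \<le> e * A" if e: "e > 0" for e
    proof -
      obtain p where p: "real_polynomial_function p" and pe: "\<And>x. x \<in> {-1..1} \<Longrightarrow> \<bar>\<Phi> x - p x\<bar> < e"
        using Stone_Weierstrass_real_polynomial_function[OF _ cont\<Phi> e] by auto
      have "continuous_on UNIV p"
        using p by (simp add: continuous_on_polymonial_function real_polynomial_function_eq)
      then have pc: "continuous_on ?I (\<lambda>y. p (c y))"
        unfolding c_def by (rule continuous_on_compose2) (intro continuous_intros subset_UNIV)+
      have "integral ?I (\<lambda>y. h y * h y) = integral ?I (\<lambda>y. h y * h y) - integral ?I (\<lambda>y. h y * p (c y))"
        using polyz[OF p] by simp
      also have "\<dots> = integral ?I (\<lambda>y. h y * h y - h y * p (c y))"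
        by (intro integral_diff[symmetric] int cont pc)
      also have "\<dots> \<le> integral ?I (\<lambda>y. e * \<bar>h y\<bar>)"
      proof (rule integral_le)
        show "(\<lambda>y. h y * h y - h y * p (c y)) integrable_on ?I"
          by (intro integrable_diff int cont pc)
        show "(\<lambda>y. e * \<bar>h y\<bar>) integrable_on ?I"
          by (intro integrable_continuous_interval continuous_intros cont)
        fix y assume y: "y \<in> ?I"
        have "h y * h y - h y * p (c y) = h y * (h y - p (c y))" by (simp add: algebra_simps)
        also have "\<dots> \<le> \<bar>h y\<bar> * \<bar>h y - p (c y)\<bar>" by (metis abs_ge_self abs_mult)
        also have "\<dots> \<le> \<bar>h y\<bar> * e"
          using pe[OF cI, of y] \<Phi>c[OF y] by (intro mult_left_mono) auto
        finally show "h y * h y - h y * p (c y) \<le> e * \<bar>h y\<bar>" by (simp add: mult.commute)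
      qed
      also have "\<dots> = e * A" by (simp add: A_def)
      finally show ?thesis .
    qed
    have "integral ?I (\<lambda>y. h y * h y) \<le> 0"
    proof (rule field_le_epsilon)
      fix e :: real assume e: "e > 0"
      have "e / (A + 1) * A \<le> e" using A0 e by (simp add: field_simps)
      then show "integral ?I (\<lambda>y. h y * h y) \<le> 0 + e" using le[of "e / (A + 1)"] e A0 by simp
    qed
    with ge show ?thesis by simp
  qed
  have "\<forall>y\<in>?I. h y * h y = 0"
    using hh by (subst integral_eq_0_iff[symmetric]) (auto intro!: continuous_intros cont)
  then show ?thesis using y by simp
qed

text \<open>This is the characteristic function of the standard normal distribution after the
  substitution \<open>v = r * y\<close> with \<open>r^2 = 2 * pi * x\<close>.\<close>

lemma gaussian_fourier_transform:
  fixes x k :: real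
  assumes x: "x > 0"
  shows "has_bochner_integral lborel (\<lambda>y. exp (- (pi * x * y\<^sup>2)) * cos (2 * pi * k * y))
     (exp (- (pi * k\<^sup>2 / x)) / sqrt x)"
proof -
  define r where "r = sqrt (2 * pi * x)"
  have r: "r > 0" "r\<^sup>2 = 2 * pi * x" using x by (auto simp: r_def)
  define t where "t = 2 * pi * k / r"
  have t2: "t\<^sup>2 / 2 = pi * k\<^sup>2 / x"
    unfolding t_def power_divide r(2) using x by (simp add: field_simps power2_eq_square)
  have cint: "(\<integral>v. std_normal_density v *\<^sub>R iexp (t * v) \<partial>lborel) = of_real (exp (- (t\<^sup>2) / 2))"
    using char_std_normal_distribution unfolding char_def fun_eq_iff
    by (subst (asm) integral_density) auto
  have ci: "integrable lborel (\<lambda>v. std_normal_density v *\<^sub>R iexp (t * v))"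
    using integrable_std_normal_moment[of 0]
    by (rule Bochner_Integration.integrable_bound) (auto simp: abs_mult normal_density_nonneg)
  have "(\<integral>v. std_normal_density v * cos (t * v) \<partial>lborel) = Re (\<integral>v. std_normal_density v *\<^sub>R iexp (t * v) \<partial>lborel)"
    using ci by (subst integral_Re[symmetric]) (auto simp: Re_exp)
  then have I: "(\<integral>v. std_normal_density v * cos (t * v) \<partial>lborel) = exp (- (t\<^sup>2) / 2)"
    unfolding cint by simp
  have "integrable lborel (\<lambda>v. Re (std_normal_density v *\<^sub>R iexp (t * v)))"
    using ci by (rule integrable_Re)
  then have ci': "integrable lborel (\<lambda>v. std_normal_density v * cos (t * v))"
    by (simp add: Re_exp)
  have "has_bochner_integral lborel (\<lambda>v. std_normal_density v * cos (t * v)) (exp (- (pi * k\<^sup>2 / x)))"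
    using ci' I t2 by (simp add: has_bochner_integral_iff)
  from lborel_has_bochner_integral_real_affine_iff[of r _ _ 0, THEN iffD1, OF _ this]
  have "has_bochner_integral lborel (\<lambda>y. std_normal_density (r * y) * cos (t * (r * y))) (exp (- (pi * k\<^sup>2 / x)) / r)"
    using r by (simp add: divide_inverse mult.commute)
  then have "has_bochner_integral lborel (\<lambda>y. sqrt (2 * pi) * (std_normal_density (r * y) * cos (t * (r * y)))) (sqrt (2 * pi) * (exp (- (pi * k\<^sup>2 / x)) / r))"
    by (intro has_bochner_integral_mult_right) auto
  also have "sqrt (2 * pi) * (exp (- (pi * k\<^sup>2 / x)) / r) = exp (- (pi * k\<^sup>2 / x)) / sqrt x"
    using x by (simp add: r_def real_sqrt_mult)
  also have "(\<lambda>y. sqrt (2 * pi) * (std_normal_density (r * y) * cos (t * (r * y)))) =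
     (\<lambda>y. exp (- (pi * x * y\<^sup>2)) * cos (2 * pi * k * y))"
    using r by (auto simp: fun_eq_iff std_normal_density_def power_mult_distrib t_def field_simps)
  finally show ?thesis .
qed

text \<open>Evenness halves the integral over the line. The limit along integers \<open>N\<close> is
  the form in which \<open>omega_inversion\<close> assembles the half line from unit
  intervals.\<close>

lemma gaussian_half_line_cosine:
  fixes x k :: real
  assumes x: "x > 0"
  shows "(\<lambda>N. integral {0..real N} (\<lambda>y. exp (- (pi * x * y\<^sup>2)) * cos (2 * pi * k * y)))
     \<longlonglongrightarrow> exp (- (pi * k\<^sup>2 / x)) / sqrt x / 2"
proof -
  define g where "g = (\<lambda>y. exp (- (pi * x * y\<^sup>2)) * cos (2 * pi * k * y))"
  have gi: "integrable lborel g" and gI: "(\<integral>y. g y \<partial>lborel) = exp (- (pi * k\<^sup>2 / x)) / sqrt x"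
    using gaussian_fourier_transform[OF x, of k] by (auto simp: g_def has_bochner_integral_iff)
  have si: "set_integrable lborel A g" if "A \<in> sets borel" for A
    using integrable_mult_indicator[of A lborel g] gi that unfolding set_integrable_def by simp
  have refl: "(LINT y:{..0}|lborel. g y) = (LINT y:{0..}|lborel. g y)"
    unfolding set_lebesgue_integral_def
    by (subst lborel_integral_real_affine[of "-1" _ 0]) (auto simp: g_def indicator_def intro!: Bochner_Integration.integral_cong)
  have z: "(LINT y:{..0}|lborel. g y) = (LINT y:{..<0}|lborel. g y)"
    unfolding set_lebesgue_integral_def
    by (intro integral_cong_AE) (auto simp: g_def indicator_def intro!: AE_I[where N="{0}"])
  have "(\<integral>y. g y \<partial>lborel) = (LINT y:{..<0} \<union> {0..}|lborel. g y)"
    unfolding set_lebesgue_integral_def by (intro Bochner_Integration.integral_cong) (auto simp: indicator_def)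
  also have "\<dots> = (LINT y:{..<0}|lborel. g y) + (LINT y:{0..}|lborel. g y)"
    by (intro set_integral_Un si) auto
  finally have "(LINT y:{0..}|lborel. g y) = exp (- (pi * k\<^sup>2 / x)) / sqrt x / 2"
    using refl z gI by simp
  moreover have "((\<lambda>b. LINT y:{0..b}|lborel. g y) \<longlongrightarrow> (LINT y:{0..}|lborel. g y)) at_top"
    by (rule tendsto_set_lebesgue_integral_at_top) (auto intro!: si)
  then have "(\<lambda>N. LINT y:{0..real N}|lborel. g y) \<longlonglongrightarrow> (LINT y:{0..}|lborel. g y)"
    by (rule filterlim_compose[OF _ filterlim_real_sequentially])
  moreover have "(LINT y:{0..b}|lborel. g y) = integral {0..b} g" for b
    by (intro set_borel_integral_eq_integral si) auto
  ultimately show ?thesis unfolding g_def by simp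
qed

lemma continuous_series_integral:
  fixes f :: "nat \<Rightarrow> real \<Rightarrow> real"
  assumes cont: "\<And>n. continuous_on {a..b} (f n)"
    and bnd: "\<And>n y. y \<in> {a..b} \<Longrightarrow> \<bar>f n y\<bar> \<le> M n" and M: "summable M"
  shows "continuous_on {a..b} (\<lambda>y. \<Sum>n. f n y)"
    and "(\<lambda>n. integral {a..b} (f n)) sums integral {a..b} (\<lambda>y. \<Sum>n. f n y)"
proof -
  have u: "uniform_limit {a..b} (\<lambda>n y. \<Sum>i<n. f i y) (\<lambda>y. \<Sum>i. f i y) sequentially"
    by (intro Weierstrass_m_test) (use bnd M in auto)
  have c: "continuous_on {a..b} (\<lambda>y. \<Sum>i<n. f i y)" for n
    by (intro continuous_intros cont)
  show "continuous_on {a..b} (\<lambda>y. \<Sum>n. f n y)"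
    by (rule uniform_limit_theorem[OF _ u]) (use c in auto)
  obtain I J where IJ: "\<And>n. ((\<lambda>y. \<Sum>i<n. f i y) has_integral I n) {a..b}"
    "((\<lambda>y. \<Sum>n. f n y) has_integral J) {a..b}" "I \<longlonglongrightarrow> J"
    using uniform_limit_integral[OF u c] by auto
  have "(\<Sum>i<n. integral {a..b} (f i)) = I n" for n
    using IJ(1)[of n] by (subst integral_sum[symmetric]) (auto intro!: integrable_continuous_interval cont simp: integral_unique)
  then show "(\<lambda>n. integral {a..b} (f n)) sums integral {a..b} (\<lambda>y. \<Sum>n. f n y)"
    using IJ(2,3) by (simp add: sums_def integral_unique)
qed

text \<open>Jacobi's theta series over all integers equals \<open>1 + 2 * omega x\<close>; this is
  its half without the constant term.\<close>

definition omega :: "real \<Rightarrow> real" where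
  "omega x = (\<Sum>n. exp (- (pi * x * (real n + 1)\<^sup>2)))"

lemma exp_square_le_power:
  fixes x y :: real
  assumes "x > 0" "y \<ge> real n"
  shows "exp (- (pi * x * y\<^sup>2)) \<le> exp (- (pi * x)) ^ n"
proof -
  have "real n \<le> (real n)\<^sup>2" by (cases n) (auto simp: power2_eq_square algebra_simps)
  also have "\<dots> \<le> y\<^sup>2" using assms by (intro power_mono) auto
  finally have "pi * x * real n \<le> pi * x * y\<^sup>2" using assms by (intro mult_left_mono) auto
  then show ?thesis by (simp add: exp_of_nat_mult[symmetric] mult_ac)
qed

lemma summable_exp_power:
  fixes x :: real
  assumes "x > 0"
  shows "summable (\<lambda>n. exp (- (pi * x)) ^ n)"
  using assms by (intro summable_geometric) auto

lemma summable_omega: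
  assumes "x > 0"
  shows "summable (\<lambda>n. exp (- (pi * x * (real n + 1)\<^sup>2)))"
  by (rule summable_comparison_test'[OF summable_exp_power[OF assms]])
     (use exp_square_le_power[OF assms] in auto)

text \<open>Poisson summation on half a period: \<open>F\<close> is the sum of the Gaussian over all
  integer translates of \<open>y\<close>, folded by evenness, and \<open>G\<close> is a cosine
  series. All cosine coefficients of \<open>F\<close> and \<open>G / sqrt x\<close> agree, so the
  functions do, and \<open>y = 0\<close> gives the transformation law of
  \<open>1 + 2 * omega\<close>.\<close>

theorem omega_inversion:
  assumes x: "x > 0"
  shows "omega (1 / x) = sqrt x * omega x + sqrt x / 2 - 1 / 2"
proof -
  let ?I = "{0..1/2::real}"
  define e where "e = (\<lambda>y. exp (- (pi * x * y\<^sup>2)))"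
  define f where "f = (\<lambda>(n::nat) y. e (real n + y) + e (real n + 1 - y))"
  \<comment> \<open>The weight 1 at \<open>n = 0\<close> against 2 elsewhere offsets that the
    squared cosine has integral 1/2 at frequency 0 and 1/4 otherwise. Each coefficient of
    \<open>G\<close> then is half a Gaussian value.\<close>
  define g where "g = (\<lambda>(n::nat) y. (if n = 0 then 1 else 2) * exp (- (pi * (1/x) * (real n)\<^sup>2)) * cos (2 * pi * real n * y))"
  define F where "F = (\<lambda>y. \<Sum>n. f n y)"
  define G where "G = (\<lambda>y. \<Sum>n. g n y)"
  define Mf where "Mf = (\<lambda>n. 2 * exp (- (pi * x)) ^ n)"
  define Mg where "Mg = (\<lambda>n. 2 * exp (- (pi * (1/x))) ^ n)"
  have Ms: "summable Mf" "summable Mg"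
    unfolding Mf_def Mg_def using x by (auto intro!: summable_mult summable_exp_power simp del: times_divide_eq_right)
  have fb: "\<bar>f n y * c\<bar> \<le> Mf n" if "y \<in> ?I" "\<bar>c\<bar> \<le> 1" for n y c
  proof -
    have "\<bar>f n y * c\<bar> \<le> \<bar>f n y\<bar> * 1" unfolding abs_mult using that by (intro mult_left_mono) auto
    also have "\<dots> = e (real n + y) + e (real n + 1 - y)" by (simp add: f_def e_def)
    also have "\<dots> \<le> exp (- (pi * x)) ^ n + exp (- (pi * x)) ^ n"
      unfolding e_def using that x by (intro add_mono exp_square_le_power) auto
    finally show ?thesis by (simp add: Mf_def)
  qed
  have gb: "\<bar>g n y * c\<bar> \<le> Mg n" if "\<bar>c\<bar> \<le> 1" for n y c
  proof -
    have "\<bar>g n y * c\<bar> = (if n = 0 then 1 else 2) * (exp (- (pi * (1/x) * (real n)\<^sup>2)) * (\<bar>cos (2 * pi * real n * y)\<bar> * \<bar>c\<bar>))"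
      by (simp add: g_def abs_mult)
    also have "\<dots> \<le> 2 * (exp (- (pi * (1/x))) ^ n * (1 * 1))"
      using that x exp_square_le_power[of "1/x" n "real n"] by (intro mult_mono) auto
    finally show ?thesis by (simp add: Mg_def)
  qed
  have fc: "continuous_on A (f n)" and gc: "continuous_on A (g n)" for A n
    by (auto simp: f_def g_def e_def intro!: continuous_intros)
  have Fc: "continuous_on ?I F" unfolding F_def
    by (rule continuous_series_integral(1)[OF fc _ Ms(1)]) (use fb[where c = 1] in auto)
  have Gc: "continuous_on ?I G" unfolding G_def
    by (rule continuous_series_integral(1)[OF gc _ Ms(2)]) (use gb[where c = 1] in auto)
  have fs: "summable (\<lambda>n. f n y)" if "y \<in> ?I" for y
    by (rule summable_comparison_test'[OF Ms(1), of 0]) (use fb[of y 1] that in auto)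
  have gs: "summable (\<lambda>n. g n y)" for y
    by (rule summable_comparison_test'[OF Ms(2), of 0]) (use gb[of 1 _ y] in auto)
  have Fk: "integral ?I (\<lambda>y. F y * cos (2 * pi * real k * y)) = exp (- (pi * (real k)\<^sup>2 / x)) / sqrt x / 2" for k
  proof -
    let ?c = "\<lambda>y. cos (2 * pi * real k * y)"
    let ?h = "\<lambda>y. e y * ?c y"
    have hc: "continuous_on A ?h" for A by (auto simp: e_def intro!: continuous_intros)
    have hi: "?h integrable_on {a..b}" for a b by (intro integrable_continuous_interval hc)
    have per: "?c (real n + y) = ?c y" for n y
    proof -
      have "2 * pi * real k * (real n + y) = 2 * real (k * n) * pi + 2 * pi * real k * y"
        by (simp add: algebra_simps)
      then have "?c (real n + y) = cos (2 * real (k * n) * pi + 2 * pi * real k * y)"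
        by (simp only:)
      also have "\<dots> = ?c y" by (simp only: cos_add cos_2npi sin_2npi mult_1 mult_zero_left diff_zero)
      finally show ?thesis .
    qed
    have per': "?c (real n + 1 - y) = ?c y" for n y
    proof -
      have "?c (real n + 1 - y) = ?c (real (Suc n) + (- y))" by (simp add: algebra_simps)
      also have "\<dots> = ?c (- y)" by (rule per)
      finally show ?thesis by simp
    qed
    \<comment> \<open>Unfolding: the first summand of \<open>f n\<close> covers
      \<open>[n, n + 1/2]\<close>, the second, reflected, covers \<open>[n + 1/2, n + 1]\<close>, so
      that the pieces tile the half line.\<close>
    have piece: "integral ?I (\<lambda>y. f n y * ?c y) = integral {real n..real (Suc n)} ?h" for n
    proof -
      have 1: "integral ?I (\<lambda>y. ?h (y + real n)) = integral {real n..real n + 1/2} ?h"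
        using integral_shift[of 0 "real n" "1/2" ?h] hc by (simp add: o_def add.commute)
      have "integral {-1/2..0} (\<lambda>y. ?h (y + (real n + 1))) = integral {real n + 1/2..real n + 1} ?h"
        using integral_shift[of "-1/2" "real n + 1" 0 ?h] hc by (simp add: o_def add.commute)
      moreover have "integral {-1/2..0} (\<lambda>y. ?h (y + (real n + 1))) = integral ?I (\<lambda>y. ?h (- y + (real n + 1)))"
        using Henstock_Kurzweil_Integration.integral_reflect_real[where f = "\<lambda>y. ?h (- y + (real n + 1))" and a = 0 and b = "1/2"] by simp
      ultimately have 2: "integral ?I (\<lambda>y. ?h (- y + (real n + 1))) = integral {real n + 1/2..real n + 1} ?h" by simp
      have "f n y * ?c y = ?h (y + real n) + ?h (- y + (real n + 1))" for y
      proof -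
        have "?c (y + real n) = ?c y" using per[of n y] by (simp add: add.commute)
        moreover have "?c (- y + (real n + 1)) = ?c y" using per'[of n y] by (simp add: algebra_simps)
        ultimately show ?thesis by (simp add: f_def algebra_simps)
      qed
      then have "integral ?I (\<lambda>y. f n y * ?c y) = integral ?I (\<lambda>y. ?h (y + real n)) + integral ?I (\<lambda>y. ?h (- y + (real n + 1)))"
        by (subst integral_add[symmetric])
           (auto simp: e_def intro!: integrable_continuous_interval continuous_intros)
      also have "\<dots> = integral {real n..real (Suc n)} ?h"
        unfolding 1 2 using Henstock_Kurzweil_Integration.integral_combine[OF _ _ hi, of "real n" "real n + 1/2" "real n + 1"] by (simp add: add.commute)
      finally show ?thesis .
    qed
    have sumN: "(\<Sum>n<N. integral {real n..real (Suc n)} ?h) = integral {0..real N} ?h" for N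
    proof (induction N)
      case (Suc N)
      then show ?case
        using Henstock_Kurzweil_Integration.integral_combine[OF _ _ hi, of 0 "real N" "real (Suc N)"] by simp
    qed simp
    have "(\<lambda>n. integral ?I (\<lambda>y. f n y * ?c y)) sums integral ?I (\<lambda>y. \<Sum>n. f n y * ?c y)"
      by (rule continuous_series_integral(2)[OF _ _ Ms(1)])
         (auto intro!: continuous_intros fc fb simp: abs_cos_le_one)
    moreover have "integral ?I (\<lambda>y. \<Sum>n. f n y * ?c y) = integral ?I (\<lambda>y. F y * ?c y)"
      using fs by (intro integral_cong) (simp add: F_def suminf_mult2)
    ultimately have "(\<lambda>n. integral {real n..real (Suc n)} ?h) sums integral ?I (\<lambda>y. F y * ?c y)"
      unfolding piece by simp
    then have "(\<lambda>N. integral {0..real N} ?h) \<longlonglongrightarrow> integral ?I (\<lambda>y. F y * ?c y)"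
      unfolding sums_def sumN .
    with gaussian_half_line_cosine[OF x, of k] show ?thesis
      unfolding e_def using LIMSEQ_unique by blast
  qed
  have cosI: "((\<lambda>y. cos (2 * pi * of_int j * y)) has_integral (if j = 0 then 1/2 else 0)) ?I" for j :: int
  proof (cases "j = 0")
    case True
    then show ?thesis using has_integral_const_real[of "1::real" 0 "1/2"] by simp
  next
    case False
    have "((\<lambda>y. cos (2 * pi * of_int j * y)) has_integral
       (sin (2 * pi * of_int j * (1/2)) / (2 * pi * of_int j) - sin (2 * pi * of_int j * 0) / (2 * pi * of_int j))) ?I"
      using False by (intro fundamental_theorem_of_calculus)
        (auto intro!: derivative_eq_intros simp flip: has_real_derivative_iff_has_vector_derivative)
    moreover have "sin (2 * pi * of_int j * (1/2)) = 0" 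
      using sin_integer_2pi sin_zero_iff_int2 by (simp add: mult.commute)
    ultimately show ?thesis using False by simp
  qed
  have Gk: "integral ?I (\<lambda>y. G y * cos (2 * pi * real k * y)) = exp (- (pi * (real k)\<^sup>2 / x)) / 2" for k
  proof -
    let ?c = "\<lambda>y. cos (2 * pi * real k * y)"
    have piece: "integral ?I (\<lambda>y. g n y * ?c y) = (if n = k then exp (- (pi * (real k)\<^sup>2 / x)) / 2 else 0)" for n
    proof -
      define a where "a = (if n = 0 then 1 else 2) * exp (- (pi * (1/x) * (real n)\<^sup>2))"
      have "g n y * ?c y = (a/2) * cos (2 * pi * of_int (int n - int k) * y) + (a/2) * cos (2 * pi * of_int (int n + int k) * y)" for y
      proof -
        have "g n y * ?c y = a * (cos (2 * pi * real n * y) * ?c y)" by (simp add: g_def a_def)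
        also have "cos (2 * pi * real n * y) * ?c y = (cos (2 * pi * of_int (int n - int k) * y) + cos (2 * pi * of_int (int n + int k) * y)) / 2"
          unfolding cos_times_cos by (simp add: algebra_simps)
        finally show ?thesis by (simp add: algebra_simps)
      qed
      then have "((\<lambda>y. g n y * ?c y) has_integral ((a/2) * (if int n - int k = 0 then 1/2 else 0) + (a/2) * (if int n + int k = 0 then 1/2 else 0))) ?I"
        using has_integral_add[OF has_integral_mult_right[OF cosI] has_integral_mult_right[OF cosI]] by presburger
      then have "integral ?I (\<lambda>y. g n y * ?c y) = (a/2) * (if int n - int k = 0 then 1/2 else 0) + (a/2) * (if int n + int k = 0 then 1/2 else 0)"
        by (rule integral_unique)
      then show ?thesis by (auto simp: a_def)
    qed
    have "(\<lambda>n. integral ?I (\<lambda>y. g n y * ?c y)) sums integral ?I (\<lambda>y. \<Sum>n. g n y * ?c y)"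
      by (rule continuous_series_integral(2)[OF _ _ Ms(2)])
         (auto intro!: continuous_intros gc gb simp: abs_cos_le_one)
    moreover have "integral ?I (\<lambda>y. \<Sum>n. g n y * ?c y) = integral ?I (\<lambda>y. G y * ?c y)"
      using gs by (intro integral_cong) (simp add: G_def suminf_mult2)
    ultimately have "(\<lambda>n. if n = k then exp (- (pi * (real k)\<^sup>2 / x)) / 2 else 0) sums integral ?I (\<lambda>y. G y * ?c y)"
      unfolding piece by simp
    then show ?thesis
      using sums_unique2[OF sums_single[of k "\<lambda>_. exp (- (pi * (real k)\<^sup>2 / x)) / 2"]] by simp
  qed
  have "F 0 - G 0 / sqrt x = 0"
  proof (rule cosine_coefficients_unique[where h = "\<lambda>y. F y - G y / sqrt x"])
    show "continuous_on ?I (\<lambda>y. F y - G y / sqrt x)"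
      using x by (intro continuous_intros Fc Gc) auto
    fix k :: nat
    let ?c = "\<lambda>y. cos (2 * pi * real k * y)"
    have "integral ?I (\<lambda>y. (F y - G y / sqrt x) * ?c y) = integral ?I (\<lambda>y. F y * ?c y - (1 / sqrt x) * (G y * ?c y))"
      by (simp add: algebra_simps)
    also have "\<dots> = integral ?I (\<lambda>y. F y * ?c y) - (1 / sqrt x) * integral ?I (\<lambda>y. G y * ?c y)"
      using x by (subst integral_diff) (auto intro!: integrable_continuous_interval continuous_intros Fc Gc)
    also have "\<dots> = 0" unfolding Fk Gk by simp
    finally show "integral ?I (\<lambda>y. (F y - G y / sqrt x) * ?c y) = 0" .
  qed auto
  moreover have "F 0 = 1 + 2 * omega x"
  proof -
    let ?w = "\<lambda>n. exp (- (pi * x * (real n + 1)\<^sup>2))"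
    have 1: "?w sums omega x" unfolding omega_def using summable_omega[OF x] by (rule summable_sums)
    have "(\<lambda>n. exp (- (pi * x * (real n)\<^sup>2))) sums (omega x + 1)"
      using sums_Suc[of "\<lambda>n. exp (- (pi * x * (real n)\<^sup>2))" "omega x"] 1 by (simp add: add.commute)
    from sums_add[OF this 1] have "(\<lambda>n. f n 0) sums (1 + 2 * omega x)"
      by (simp add: f_def e_def algebra_simps)
    then show ?thesis unfolding F_def by (simp add: sums_iff)
  qed
  moreover have "G 0 = 1 + 2 * omega (1/x)"
  proof -
    let ?w = "\<lambda>n. exp (- (pi * (1/x) * (real n + 1)\<^sup>2))"
    have "?w sums omega (1/x)" unfolding omega_def using summable_omega[of "1/x"] x by (intro summable_sums) auto
    then have "(\<lambda>n. g (Suc n) 0) sums (2 * omega (1/x))"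
      using sums_mult[of ?w "omega (1/x)" 2] by (simp add: g_def add.commute)
    from sums_Suc[OF this] show ?thesis unfolding G_def by (simp add: sums_iff g_def)
  qed
  ultimately have "(1 + 2 * omega x) = (1 + 2 * omega (1/x)) / sqrt x" by simp
  then have "sqrt x * (1 + 2 * omega x) = 1 + 2 * omega (1/x)" using x by (simp add: field_simps)
  then show ?thesis by (simp add: algebra_simps)
qed

section \<open>The Mellin transform of theta\<close>

lemma omega_nonneg: "x > 0 \<Longrightarrow> omega x \<ge> 0"
  unfolding omega_def by (intro suminf_nonneg summable_omega) auto

lemma exp_minus_pi_le_half: "x \<ge> 1 \<Longrightarrow> exp (- (pi * x)) \<le> 1 / 2"
proof -
  assume "x \<ge> 1"
  then have "1 * 1 \<le> pi * x" using pi_gt3 by (intro mult_mono) auto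
  then have "2 \<le> exp (pi * x)" using exp_ge_add_one_self[of "pi * x"] by linarith
  then show ?thesis by (simp add: exp_minus field_simps)
qed

lemma omega_le:
  assumes x: "x \<ge> 1"
  shows "omega x \<le> 2 * exp (- (pi * x))"
proof -
  let ?q = "exp (- (pi * x))"
  have q: "0 < ?q" "?q \<le> 1/2" using exp_minus_pi_le_half[OF x] by auto
  have "omega x \<le> (\<Sum>n. ?q * ?q ^ n)"
    unfolding omega_def
  proof (intro suminf_le summable_omega summable_mult summable_exp_power)
    fix n show "exp (- (pi * x * (real n + 1)\<^sup>2)) \<le> ?q * ?q ^ n"
      using exp_square_le_power[of x "Suc n" "real n + 1"] x by simp
  qed (use x in auto)
  also have "\<dots> = ?q * (1 / (1 - ?q))"
    using q by (subst suminf_mult[OF summable_geometric]) (simp_all add: suminf_geometric del: exp_less_one_iff)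
  also have "\<dots> \<le> ?q * 2"
  proof (intro mult_left_mono)
    have "1 / (1 - r) \<le> 2" if "r \<le> 1 / 2" for r :: real using that by (simp add: field_simps)
    then show "1 / (1 - ?q) \<le> 2" using q(2) .
  qed simp
  finally show ?thesis by simp
qed

lemma measurable_omega [measurable]: "(\<lambda>u. omega (exp u)) \<in> borel_measurable borel"
  unfolding omega_def by measurable

text \<open>From \<open>pi * exp u \<ge> u^2\<close>, completing the square absorbs
  \<open>exp (c * u)\<close> for every real \<open>c\<close> and still leaves a factor
  \<open>exp (- u)\<close>. This is what makes the half-line transform entire.\<close>

lemma omega_exp_bound:
  assumes u: "u \<ge> 0"
  shows "omega (exp u) * exp (c * u) \<le> 2 * exp ((c + 1)\<^sup>2 / 4) * exp (- u)"
proof -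
  have "2 * exp u \<ge> u\<^sup>2" using exp_lower_Taylor_quadratic[OF u] u by simp
  moreover have "pi * exp u \<ge> 2 * exp u" using pi_gt3 by simp
  ultimately have "pi * exp u \<ge> u\<^sup>2" by linarith
  moreover have "0 \<le> (u - (c + 1) / 2)\<^sup>2" by simp
  ultimately have *: "- (pi * exp u) + c * u \<le> (c + 1)\<^sup>2 / 4 + - u"
    by (simp add: power2_eq_square field_simps)
  have "omega (exp u) * exp (c * u) \<le> 2 * exp (- (pi * exp u)) * exp (c * u)"
    using u by (intro mult_right_mono omega_le) auto
  also have "\<dots> = 2 * exp (- (pi * exp u) + c * u)" by (simp only: exp_add mult.assoc)
  also have "\<dots> \<le> 2 * exp ((c + 1)\<^sup>2 / 4 + - u)" using * by simp
  also have "\<dots> = 2 * exp ((c + 1)\<^sup>2 / 4) * exp (- u)" by (simp only: exp_add mult.assoc)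
  finally show ?thesis .
qed

lemma set_integrable_exp_minus:
  fixes a :: real
  assumes "a > 0"
  shows "set_integrable lborel {0..} (\<lambda>u. exp (- (a * u)))"
proof -
  have "set_integrable lborel {0<..} (\<lambda>u. exp (- (a * u)))"
    using integrable_I0i_exp_mscale[OF assms] by (simp add: mult.commute)
  then show ?thesis unfolding set_integrable_def
    by (rule integrable_cong_AE_imp) (auto intro!: AE_I[where N = "{0}"] simp: indicator_def)
qed

lemma integrable_omega_exp:
  "set_integrable lborel {0..} (\<lambda>u. omega (exp u) * exp (c * u))"
proof (rule set_integrable_bound)
  show "set_integrable lborel {0..} (\<lambda>u. 2 * exp ((c + 1)\<^sup>2 / 4) * exp (- (1 * u)))"
    using set_integrable_exp_minus[of 1] by (intro set_integrable_mult_right) simp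
  show "AE x in lborel. x \<in> {0..} \<longrightarrow> norm (omega (exp x) * exp (c * x)) \<le> norm (2 * exp ((c + 1)\<^sup>2 / 4) * exp (- (1 * x)))"
    using omega_exp_bound omega_nonneg by (auto simp: abs_mult)
qed (simp add: set_borel_measurable_def)

text \<open>With \<open>x = exp u\<close> this is the integral of
  \<open>omega x * x powr (z - 1)\<close> over \<open>x \<ge> 1\<close>. In the logarithmic variable
  the inversion of \<open>x\<close> becomes the reflection of \<open>u\<close>.\<close>

definition half_mellin :: "complex \<Rightarrow> complex" where
  "half_mellin z = (CLINT u:{0..}|lborel. of_real (omega (exp u)) * exp (z * of_real u))"

definition half_mellin' :: "complex \<Rightarrow> complex" where
  "half_mellin' z = (CLINT u:{0..}|lborel. of_real (omega (exp u) * u) * exp (z * of_real u))"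

lemma integrable_half_mellin:
  "set_integrable lborel {0..} (\<lambda>u. of_real (omega (exp u)) * exp (z * of_real u) :: complex)"
  by (rule set_integrable_bound[OF integrable_omega_exp[of "Re z"]])
     (auto simp: set_borel_measurable_def norm_mult abs_mult)

lemma le_exp_self: "(u::real) \<le> exp u"
  using exp_ge_add_one_self[of u] by linarith

lemma integrable_half_mellin':
  "set_integrable lborel {0..} (\<lambda>u. of_real (omega (exp u) * u) * exp (z * of_real u) :: complex)"
proof (rule set_integrable_bound[OF integrable_omega_exp[of "Re z + 1"]])
  have "norm (of_real (omega (exp u) * u) * exp (z * of_real u) :: complex) \<le> norm (omega (exp u) * exp ((Re z + 1) * u))"
    if "u \<ge> 0" for u
  proof -
    have "norm (of_real (omega (exp u) * u) * exp (z * of_real u) :: complex) = omega (exp u) * (u * exp (Re z * u))"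
      using that omega_nonneg[of "exp u"] by (simp add: norm_mult abs_mult)
    also have "\<dots> \<le> omega (exp u) * (exp u * exp (Re z * u))"
      using omega_nonneg[of "exp u"] le_exp_self by (intro mult_left_mono mult_right_mono) auto
    also have "\<dots> = norm (omega (exp u) * exp ((Re z + 1) * u))"
      using omega_nonneg[of "exp u"] by (simp add: abs_mult exp_add ring_distribs mult.commute)
    finally show ?thesis .
  qed
  then show "AE x in lborel. x \<in> {0..} \<longrightarrow> norm (of_real (omega (exp x) * x) * exp (z * of_real x) :: complex) \<le> norm (omega (exp x) * exp ((Re z + 1) * x))"
    by auto
qed (simp add: set_borel_measurable_def)

lemma norm_exp_minus_linear:
  fixes w :: complex
  shows "norm (exp w - 1 - w) \<le> exp (norm w) * (norm w)\<^sup>2"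
  using Taylor_exp_field[of w 1] by (simp add: power2_eq_square algebra_simps)

text \<open>Differentiation under the integral sign: the second-order remainder of
  \<open>exp (h * u)\<close> integrates to at most a constant times \<open>(norm h)^2\<close>, so
  the difference quotient is off by O(\<open>norm h\<close>).\<close>

lemma half_mellin_has_derivative:
  "(half_mellin has_field_derivative half_mellin' z) (at z)"
proof -
  \<comment> \<open>Of the 2 added to \<open>Re z\<close>, one pays for
    \<open>exp (norm h * u)\<close> with \<open>norm h \<le> 1\<close>, the other for
    \<open>u^2 \<le> 2 * exp u\<close>.\<close>
  define K where "K = (LINT u:{0..}|lborel. 2 * (omega (exp u) * exp ((Re z + 2) * u)))"
  have bound: "norm (half_mellin (z + h) - half_mellin z - h * half_mellin' z) \<le> (norm h)\<^sup>2 * K"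
    if h: "norm h \<le> 1" for h
  proof -
    let ?f = "\<lambda>u. of_real (omega (exp u)) * exp ((z + h) * of_real u) - of_real (omega (exp u)) * exp (z * of_real u)
               - h * (of_real (omega (exp u) * u) * exp (z * of_real u)) :: complex"
    have hi: "set_integrable lborel {0..} (\<lambda>u. h * (of_real (omega (exp u) * u) * exp (z * of_real u)) :: complex)"
      by (intro set_integrable_mult_right integrable_half_mellin')
    have fi: "set_integrable lborel {0..} ?f"
      by (intro set_integral_diff integrable_half_mellin hi)
    have eq: "half_mellin (z + h) - half_mellin z - h * half_mellin' z = (CLINT u:{0..}|lborel. ?f u)"
      unfolding half_mellin_def half_mellin'_def
        set_integral_diff(2)[OF set_integral_diff(1)[OF integrable_half_mellin integrable_half_mellin] hi]
        set_integral_diff(2)[OF integrable_half_mellin integrable_half_mellin] set_integral_mult_right ..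
    have nb: "norm (?f u) \<le> (norm h)\<^sup>2 * (2 * (omega (exp u) * exp ((Re z + 2) * u)))" if u: "u \<ge> 0" for u
    proof -
      have "?f u = of_real (omega (exp u)) * (exp (z * of_real u) * (exp (h * of_real u) - 1 - h * of_real u))"
        by (simp add: ring_distribs exp_add algebra_simps)
      then have "norm (?f u) = omega (exp u) * (exp (Re z * u) * norm (exp (h * of_real u) - 1 - h * of_real u))"
        using omega_nonneg[of "exp u"] by (simp add: norm_mult)
      also have "\<dots> \<le> omega (exp u) * (exp (Re z * u) * (exp (norm h * u) * (norm h * u)\<^sup>2))"
        using omega_nonneg[of "exp u"] norm_exp_minus_linear[of "h * of_real u"] u
        by (intro mult_left_mono) (auto simp: norm_mult)
      also have "\<dots> \<le> omega (exp u) * (exp (Re z * u) * (exp (1 * u) * ((norm h)\<^sup>2 * (2 * exp u))))"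
      proof (intro mult_left_mono mult_mono)
        show "exp (norm h * u) \<le> exp (1 * u)" using mult_right_mono[OF h u] by simp
        show "(norm h * u)\<^sup>2 \<le> (norm h)\<^sup>2 * (2 * exp u)"
          unfolding power_mult_distrib using exp_lower_Taylor_quadratic[OF u] u by (intro mult_left_mono) auto
      qed (use omega_nonneg[of "exp u"] in auto)
      also have "\<dots> = (norm h)\<^sup>2 * (2 * (omega (exp u) * exp ((Re z + 2) * u)))"
      proof -
        have "exp ((Re z + 2) * u) = exp (Re z * u) * (exp u * exp u)"
          by (simp add: ring_distribs flip: exp_add)
        then show ?thesis by simp
      qed
      finally show ?thesis .
    qed
    have "norm (CLINT u:{0..}|lborel. ?f u) \<le> (LINT u:{0..}|lborel. norm (?f u))"
      using set_integral_norm_bound[OF fi] .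
    also have "\<dots> \<le> (LINT u:{0..}|lborel. (norm h)\<^sup>2 * (2 * (omega (exp u) * exp ((Re z + 2) * u))))"
    proof (rule set_integral_mono)
      show "set_integrable lborel {0..} (\<lambda>u. norm (?f u))" using fi by (rule set_integrable_norm)
      show "set_integrable lborel {0..} (\<lambda>u. (norm h)\<^sup>2 * (2 * (omega (exp u) * exp ((Re z + 2) * u))))"
        by (intro set_integrable_mult_right integrable_omega_exp)
    qed (use nb in auto)
    also have "\<dots> = (norm h)\<^sup>2 * K" unfolding K_def by (rule set_integral_mult_right)
    finally show ?thesis unfolding eq .
  qed
  have "(\<lambda>h. (half_mellin (z + h) - half_mellin z) / h) \<midarrow>0\<rightarrow> half_mellin' z"
  proof (rule Lim_null_comparison[THEN LIM_zero_cancel])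
    have "norm ((half_mellin (z + h) - half_mellin z) / h - half_mellin' z) \<le> norm h * K"
      if "h \<noteq> 0" "norm h \<le> 1" for h
    proof -
      have "(half_mellin (z + h) - half_mellin z) / h - half_mellin' z = (half_mellin (z + h) - half_mellin z - h * half_mellin' z) / h"
        using that by (simp add: field_simps)
      then have "norm ((half_mellin (z + h) - half_mellin z) / h - half_mellin' z) \<le> (norm h)\<^sup>2 * K / norm h"
        using bound[OF that(2)] by (simp add: norm_divide divide_right_mono)
      then show ?thesis using that by (simp add: power2_eq_square)
    qed
    then show "\<forall>\<^sub>F h in at 0. norm ((half_mellin (z + h) - half_mellin z) / h - half_mellin' z) \<le> norm h * K"
      unfolding eventually_at by (intro exI[of _ 1]) auto
    show "(\<lambda>h. norm h * K) \<midarrow>0\<rightarrow> 0"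
      by (intro tendsto_mult_left_zero tendsto_norm_zero) (rule tendsto_ident_at)
  qed
  then show ?thesis by (simp add: DERIV_def)
qed

lemma holomorphic_half_mellin [holomorphic_intros]:
  "f holomorphic_on A \<Longrightarrow> (\<lambda>z. half_mellin (f z)) holomorphic_on A"
proof -
  have "half_mellin holomorphic_on UNIV"
    using half_mellin_has_derivative by (auto simp: holomorphic_on_open)
  then show "f holomorphic_on A \<Longrightarrow> (\<lambda>z. half_mellin (f z)) holomorphic_on A"
    using holomorphic_on_compose_gen[of f A half_mellin UNIV] by (simp add: o_def)
qed

section \<open>Continuation of zeta\<close>

text \<open>Euler's integral under \<open>t = exp u\<close>; the Jacobian turns the exponent
  \<open>z - 1\<close> into \<open>z\<close>.\<close>

lemma Gamma_integral_exp_substitution: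
  assumes z: "Re z > 0"
  shows "has_bochner_integral lborel (\<lambda>u. exp (z * of_real u) * of_real (exp (- exp u))) (Gamma z)"
proof -
  let ?f = "\<lambda>t. of_real t powr (z - 1) / of_real (exp t) :: complex"
  let ?h = "\<lambda>u. exp (z * of_real u) * of_real (exp (- exp u)) :: complex"
  have rng: "range (exp :: real \<Rightarrow> real) = {0<..}" by (auto simp: image_iff) (metis exp_ln)
  have "?f absolutely_integrable_on range exp \<and> integral (range exp) ?f = Gamma z"
    unfolding rng using absolutely_integrable_Gamma_integral'[OF z] Gamma_integral_complex'[OF z] by (auto simp: integral_unique)
  then have "(\<lambda>u. \<bar>exp u\<bar> *\<^sub>R ?f (exp u)) absolutely_integrable_on UNIV \<and> integral UNIV (\<lambda>u. \<bar>exp u\<bar> *\<^sub>R ?f (exp u)) = Gamma z"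
    by (subst has_absolute_integral_change_of_variables_real[of UNIV exp exp]) (auto intro!: derivative_eq_intros inj_onI)
  moreover have "\<bar>exp u\<bar> *\<^sub>R ?f (exp u) = ?h u" for u :: real
  proof -
    have "complex_of_real (exp u) powr (z - 1) = exp ((z - 1) * of_real u)"
      by (simp add: powr_def Ln_of_real)
    then have "\<bar>exp u\<bar> *\<^sub>R ?f (exp u) = exp (of_real u) * exp ((z - 1) * of_real u) * of_real (exp (- exp u))"
      by (simp add: scaleR_conv_of_real exp_minus field_simps exp_of_real)
    then show ?thesis by (simp add: algebra_simps flip: exp_add)
  qed
  ultimately have i: "set_integrable lebesgue UNIV ?h" and I: "integral UNIV ?h = Gamma z" by simp_all
  have meas: "?h \<in> borel_measurable lborel" by measurable
  have "integrable lebesgue ?h" using i by (simp add: set_integrable_def)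
  then have "integrable lborel ?h" using integrable_completion[OF meas] by simp
  moreover have "integral\<^sup>L lborel ?h = Gamma z"
    using set_lebesgue_integral_eq_integral(2)[OF i] I integral_completion[OF meas]
    by (simp add: set_lebesgue_integral_def)
  ultimately show ?thesis by (simp add: has_bochner_integral_iff)
qed

lemma Gamma_integral_exp_scaled:
  assumes z: "Re z > 0" and a: "a > 0"
  shows "has_bochner_integral lborel (\<lambda>u. of_real (exp (- (a * exp u))) * exp (z * of_real u)) (Gamma z * exp (- (z * of_real (ln a))))"
proof -
  have "has_bochner_integral lborel (\<lambda>u. exp (z * of_real (ln a + 1 * u)) * of_real (exp (- exp (ln a + 1 * u)))) (Gamma z /\<^sub>R \<bar>1\<bar>)"
    using Gamma_integral_exp_substitution[OF z] by (subst lborel_has_bochner_integral_real_affine_iff[symmetric]) auto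
  then have "has_bochner_integral lborel (\<lambda>u. exp (- (z * of_real (ln a))) * (exp (z * of_real (ln a + 1 * u)) * of_real (exp (- exp (ln a + 1 * u)))))
      (exp (- (z * of_real (ln a))) * Gamma z)"
    by (intro has_bochner_integral_mult_right) auto
  moreover have "exp (- (z * of_real (ln a))) * (exp (z * of_real (ln a + 1 * u)) * of_real (exp (- exp (ln a + 1 * u)))) =
     of_real (exp (- (a * exp u))) * exp (z * of_real u)" for u
    using a by (simp add: exp_add ring_distribs exp_minus)
  ultimately show ?thesis by (simp add: mult.commute)
qed

text \<open>The theta series is integrated term by term. The integrated norms of the terms decay
  like \<open>n powr (- 2 * Re z)\<close>, which is summable precisely in this half plane.\<close>

lemma omega_mellin:
  assumes z: "Re z > 1 / 2"
  shows "integrable lborel (\<lambda>u. of_real (omega (exp u)) * exp (z * of_real u) :: complex)" (is ?int)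
    and "(\<lambda>n. Gamma z * exp (- (z * of_real (ln (pi * (real n + 1)\<^sup>2))))) sums (CLINT u|lborel. of_real (omega (exp u)) * exp (z * of_real u))" (is ?sums)
proof -
  let ?a = "\<lambda>n::nat. pi * (real n + 1)\<^sup>2"
  let ?h = "\<lambda>z n u. of_real (exp (- (?a n * exp u))) * exp (z * of_real u) :: complex"
  define c where "c = norm (Gamma (of_real (Re z)) :: complex)"
  have a: "?a n > 0" for n by simp
  have z0: "Re z > 0" using z by simp
  note G = Gamma_integral_exp_scaled[OF _ a]
  have int: "integrable lborel (?h z n)" for n using G[OF z0] by (simp add: has_bochner_integral_iff)
  have nrm: "(\<integral>u. norm (?h z n u) \<partial>lborel) \<le> c * ?a n powr (- Re z)" for n
  proof -
    have "has_bochner_integral lborel (\<lambda>u. Re (?h (of_real (Re z)) n u)) (Re (Gamma (of_real (Re z)) * exp (- (of_real (Re z) * of_real (ln (?a n))))))"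
      by (rule has_bochner_integral_Re[OF G]) (use z0 in simp)
    moreover have "Re (?h (of_real (Re z)) n u) = norm (?h z n u)" for u
      by (simp add: norm_mult Re_exp)
    ultimately have "(\<integral>u. norm (?h z n u) \<partial>lborel) = Re (Gamma (of_real (Re z)) * exp (- (of_real (Re z) * of_real (ln (?a n)))))"
      by (simp add: has_bochner_integral_iff)
    also have "\<dots> \<le> norm (Gamma (of_real (Re z)) * exp (- (of_real (Re z) * of_real (ln (?a n)))) :: complex)"
      by (rule complex_Re_le_cmod)
    also have "\<dots> = c * ?a n powr (- Re z)"
      using a[of n] by (simp add: norm_mult c_def powr_def)
    finally show ?thesis .
  qed
  have sa: "summable (\<lambda>n. c * ?a n powr (- Re z))"
  proof -
    have "summable (\<lambda>n. real n powr (- (2 * Re z)))" using z by (subst summable_real_powr_iff) simp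
    then have "summable (\<lambda>n. real (Suc n) powr (- (2 * Re z)))" by (subst summable_Suc_iff)
    then have s: "summable (\<lambda>n. (c * pi powr (- Re z)) * real (Suc n) powr (- (2 * Re z)))" by (rule summable_mult)
    have eq: "(c * pi powr (- Re z)) * real (Suc n) powr (- (2 * Re z)) = c * ?a n powr (- Re z)" for n
      by (simp add: powr_mult powr_powr add.commute flip: powr_numeral)
    show ?thesis using s unfolding eq .
  qed
  have sn: "summable (\<lambda>n. \<integral>u. norm (?h z n u) \<partial>lborel)"
    by (rule summable_comparison_test'[OF sa, of 0]) (use nrm in auto)
  have ae: "summable (\<lambda>n. norm (?h z n u))" for u
  proof -
    have "summable (\<lambda>n. exp (- (pi * exp u * (real n + 1)\<^sup>2)) * exp (Re z * u))"
      by (intro summable_mult2 summable_omega) auto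
    then show ?thesis by (simp add: norm_mult mult_ac)
  qed
  have S: "(\<Sum>n. ?h z n u) = of_real (omega (exp u)) * exp (z * of_real u)" for u
  proof -
    have "(\<lambda>n. exp (- (pi * exp u * (real n + 1)\<^sup>2))) sums omega (exp u)"
      unfolding omega_def by (intro summable_sums summable_omega) auto
    then have "(\<lambda>n. complex_of_real (exp (- (pi * exp u * (real n + 1)\<^sup>2))) * exp (z * of_real u)) sums (of_real (omega (exp u)) * exp (z * of_real u))"
      by (intro sums_mult2) (simp only: sums_of_real_iff)
    then show ?thesis by (simp add: sums_iff mult_ac)
  qed
  show ?int using integrable_suminf[OF int _ sn] ae unfolding S by simp
  have "(\<lambda>n. integral\<^sup>L lborel (?h z n)) sums (CLINT u|lborel. of_real (omega (exp u)) * exp (z * of_real u))"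
    using sums_integral[OF int _ sn] ae unfolding S by simp
  moreover have "integral\<^sup>L lborel (?h z n) = Gamma z * exp (- (z * of_real (ln (?a n))))" for n
    using G[OF z0] by (simp add: has_bochner_integral_iff)
  ultimately show ?sums by simp
qed

lemma exp_minus_half_line:
  fixes w :: complex
  assumes w: "Re w > 0"
  shows "set_integrable lborel {0..} (\<lambda>u. exp (- (w * of_real u)))"
    and "(CLINT u:{0..}|lborel. exp (- (w * of_real u))) = 1 / w"
proof -
  show i: "set_integrable lborel {0..} (\<lambda>u. exp (- (w * of_real u)))"
    by (rule set_integrable_bound[OF set_integrable_exp_minus[OF w]]) (auto simp: set_borel_measurable_def)
  have w0: "w \<noteq> 0" using w by auto
  have "((\<lambda>b. CLINT u:{0..b}|lborel. exp (- (w * of_real u))) \<longlongrightarrow> (CLINT u:{0..}|lborel. exp (- (w * of_real u)))) at_top"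
    by (rule tendsto_set_lebesgue_integral_at_top) (auto intro!: i)
  moreover have "eventually (\<lambda>b. (CLINT u:{0..b}|lborel. exp (- (w * of_real u))) = (1 - exp (- (w * of_real b))) / w) at_top"
    using eventually_ge_at_top[of 0]
  proof eventually_elim
    case (elim b)
    have "(CLINT u:{0..b}|lborel. exp (- (w * of_real u))) = integral {0..b} (\<lambda>u. exp (- (w * of_real u)))"
      by (intro set_borel_integral_eq_integral set_integrable_subset[OF i]) auto
    also have "((\<lambda>u. exp (- (w * of_real u))) has_integral ((- exp (- (w * of_real b)) / w) - (- exp (- (w * of_real 0)) / w))) {0..b}"
      using elim w0 by (intro fundamental_theorem_of_calculus)
        (auto intro!: derivative_eq_intros has_vector_derivative_real_field)
    then have "integral {0..b} (\<lambda>u. exp (- (w * of_real u))) = (1 - exp (- (w * of_real b))) / w"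
      by (simp add: integral_unique diff_divide_distrib)
    finally show ?case .
  qed
  ultimately have "((\<lambda>b. (1 - exp (- (w * of_real b))) / w) \<longlongrightarrow> (CLINT u:{0..}|lborel. exp (- (w * of_real u)))) at_top"
    by (rule Lim_transform_eventually)
  moreover have "((\<lambda>b. (1 - exp (- (w * of_real b))) / w) \<longlongrightarrow> (1 - 0) / w) at_top"
  proof (intro tendsto_intros w0)
    have "((\<lambda>b. exp (- (Re w * b))) \<longlongrightarrow> 0) at_top"
      using w by real_asymp
    then show "((\<lambda>b. exp (- (w * of_real b))) \<longlongrightarrow> 0) at_top"
      by (subst tendsto_norm_zero_iff[symmetric]) simp
  qed
  ultimately show "(CLINT u:{0..}|lborel. exp (- (w * of_real u))) = 1 / w"
    using tendsto_unique[OF trivial_limit_at_top_linorder] by fastforce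
qed

lemma omega_exp_minus:
  "omega (exp (- u)) = exp (u / 2) * omega (exp u) + exp (u / 2) / 2 - 1 / 2"
proof -
  have "sqrt (exp u) = exp (u / 2)"
    by (rule real_sqrt_unique) (auto simp flip: exp_double)
  then show ?thesis using omega_inversion[of "exp u"] by (simp add: exp_minus inverse_eq_divide)
qed

text \<open>Riemann's splitting at \<open>x = 1\<close>: the inversion maps the negative half line
  to the positive one, and its two elementary terms, \<open>exp (u / 2) / 2\<close> and
  \<open>- 1 / 2\<close>, integrate to the poles at \<open>z = 1/2\<close> and
  \<open>z = 0\<close>.\<close>

lemma omega_mellin_half_mellin:
  assumes z: "Re z > 1 / 2"
  shows "(CLINT u|lborel. of_real (omega (exp u)) * exp (z * of_real u)) =
     half_mellin z + half_mellin (1/2 - z) + 1 / (2 * z - 1) - 1 / (2 * z)"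
proof -
  let ?g = "\<lambda>u. of_real (omega (exp u)) * exp (z * of_real u) :: complex"
  have i: "integrable lborel ?g" by (rule omega_mellin(1)[OF z])
  have si: "set_integrable lborel A ?g" if "A \<in> sets borel" for A
    unfolding set_integrable_def using that by (intro integrable_mult_indicator i) auto
  have z0: "Re z > 0" "Re (z - 1/2) > 0" using z by auto
  have neq: "z \<noteq> 0" "2 * z - 1 \<noteq> 0" using z by (auto simp: complex_eq_iff)
  have "(CLINT u|lborel. ?g u) = (CLINT u:{..<0} \<union> {0..}|lborel. ?g u)"
    unfolding set_lebesgue_integral_def by (intro Bochner_Integration.integral_cong) (auto simp: indicator_def)
  also have "\<dots> = (CLINT u:{..<0}|lborel. ?g u) + (CLINT u:{0..}|lborel. ?g u)"
    by (intro set_integral_Un si) auto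
  also have "(CLINT u:{..<0}|lborel. ?g u) = (CLINT u:{..0}|lborel. ?g u)"
    unfolding set_lebesgue_integral_def
    by (intro integral_cong_AE) (auto simp: indicator_def intro!: AE_I[where N="{0}"])
  also have "(CLINT u:{..0}|lborel. ?g u) = (CLINT u:{0..}|lborel. ?g (- u))"
    unfolding set_lebesgue_integral_def
    by (subst lborel_integral_real_affine[of "-1" _ 0]) (auto simp: indicator_def intro!: Bochner_Integration.integral_cong)
  also have "\<dots> = (CLINT u:{0..}|lborel. of_real (omega (exp u)) * exp ((1/2 - z) * of_real u)
      + ((1/2) * exp (- ((z - 1/2) * of_real u)) - (1/2) * exp (- (z * of_real u))))"
  proof (intro set_lebesgue_integral_cong allI impI)
    fix u :: real
    have O: "complex_of_real (omega (exp (- u))) = exp (of_real (u/2)) * of_real (omega (exp u)) + exp (of_real (u / 2)) / 2 - 1 / 2"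
      unfolding omega_exp_minus by (simp flip: exp_of_real)
    have "?g (- u) = complex_of_real (omega (exp (- u))) * exp (- (z * of_real u))" by simp
    also have "\<dots> = (exp (of_real (u/2)) * exp (- (z * of_real u))) * of_real (omega (exp u)) + (exp (of_real (u / 2)) * exp (- (z * of_real u))) / 2 - exp (- (z * of_real u)) / 2"
      unfolding O by (simp add: algebra_simps)
    also have "exp (of_real (u/2)) * exp (- (z * of_real u)) = exp ((1/2 - z) * of_real u)"
      by (simp add: algebra_simps flip: exp_add)
    finally show "?g (- u) = of_real (omega (exp u)) * exp ((1/2 - z) * of_real u)
      + ((1/2) * exp (- ((z - 1/2) * of_real u)) - (1/2) * exp (- (z * of_real u)))"
      by (simp add: algebra_simps)
  qed simp
  also have "\<dots> = half_mellin (1/2 - z) + ((1/2) * (1 / (z - 1/2)) - (1/2) * (1 / z))"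
    using exp_minus_half_line[OF z0(1)] exp_minus_half_line[OF z0(2)] integrable_half_mellin[of "1/2 - z"]
    by (subst set_integral_add(2)) (auto simp: half_mellin_def set_integral_diff set_integrable_mult_right mult.commute)
  also have "(1/2) * (1 / (z - 1/2)) - (1/2) * (1 / z) = 1 / (2 * z - 1) - 1 / (2 * z)"
    using neq by (simp add: field_simps)
  finally show ?thesis by (simp add: half_mellin_def algebra_simps)
qed

text \<open>For \<open>Re s > 1\<close> this is pi^(-s/2) Gamma(s/2) zeta(s). The formula makes
  sense off 0 and 1 and displays the symmetry under \<open>1 - s\<close>, so the functional equation
  is built in.\<close>

definition completed_zeta :: "complex \<Rightarrow> complex" where
  "completed_zeta s = half_mellin (s / 2) + half_mellin ((1 - s) / 2) + 1 / (s - 1) - 1 / s"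

lemma completed_zeta_sums:
  assumes s: "Re s > 1"
  shows "(\<lambda>n. Gamma (s / 2) * exp (- (s / 2 * of_real (ln pi))) * (1 / of_nat (Suc n) powr s)) sums completed_zeta s"
proof -
  have z: "Re (s / 2) > 1 / 2" using s by simp
  have "exp (- (s / 2 * of_real (ln (pi * (real n + 1)\<^sup>2)))) = exp (- (s / 2 * of_real (ln pi))) * (1 / of_nat (Suc n) powr s)" for n
  proof -
    have "ln (pi * (real n + 1)\<^sup>2) = ln pi + 2 * ln (real (Suc n))"
      by (simp add: ln_mult ln_realpow add.commute)
    then have "- (s / 2 * of_real (ln (pi * (real n + 1)\<^sup>2))) = - (s / 2 * of_real (ln pi)) + - (s * of_real (ln (real (Suc n))))"
      by (simp add: algebra_simps)
    moreover have "of_nat (Suc n) powr s = exp (s * of_real (ln (real (Suc n))))"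
    proof -
      have "complex_of_nat (Suc n) \<noteq> 0" by (rule of_nat_neq_0)
      moreover have "Ln (of_nat (Suc n)) = of_real (ln (real (Suc n)))"
        using Ln_of_real[of "real (Suc n)"] by (simp del: of_nat_Suc)
      ultimately show ?thesis by (simp add: powr_def del: of_nat_Suc)
    qed
    ultimately show ?thesis by (simp only: exp_add exp_minus) (simp add: field_simps)
  qed
  then have "(\<lambda>n. Gamma (s / 2) * (exp (- (s / 2 * of_real (ln pi))) * (1 / of_nat (Suc n) powr s))) sums
     (half_mellin (s/2) + half_mellin (1/2 - s/2) + 1 / (2 * (s/2) - 1) - 1 / (2 * (s/2)))"
    using omega_mellin(2)[OF z] omega_mellin_half_mellin[OF z] by simp
  then show ?thesis by (simp add: completed_zeta_def diff_divide_distrib mult.assoc)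
qed

text \<open>The pole of \<open>completed_zeta\<close> at 0 is cancelled by the zero of
  \<open>rGamma (s / 2)\<close>; writing \<open>rGamma (s / 2) / s\<close> as
  \<open>rGamma (s / 2 + 1) / 2\<close> makes the right side visibly holomorphic off 1. It agrees
  with the Dirichlet series for \<open>Re s > 1\<close>, and the punctured plane is
  connected.\<close>

theorem zeta_eq:
  assumes "s \<noteq> 1"
  shows "zeta s = exp (s / 2 * of_real (ln pi)) *
     ((half_mellin (s / 2) + half_mellin ((1 - s) / 2) + 1 / (s - 1)) * rGamma (s / 2) - rGamma (s / 2 + 1) / 2)"
proof -
  define f where "f = (\<lambda>s. exp (s / 2 * of_real (ln pi)) *
     ((half_mellin (s / 2) + half_mellin ((1 - s) / 2) + 1 / (s - 1)) * rGamma (s / 2) - rGamma (s / 2 + 1) / 2))"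
  define P where "P = (\<lambda>f. f holomorphic_on - {1} \<and> f 1 = 0 \<and>
     (\<forall>s. Re s > 1 \<longrightarrow> (\<lambda>n. 1 / of_nat (Suc n) powr s) sums f s))"
  have fhol: "f holomorphic_on - {1}"
    unfolding f_def by (intro holomorphic_intros) auto
  have fsums: "(\<lambda>n. 1 / of_nat (Suc n) powr s) sums f s" if s: "Re s > 1" for s
  proof -
    have s2: "Re (s/2) > 0" and s0: "s \<noteq> 0" using s by auto
    then have "s / 2 \<notin> \<int>\<^sub>\<le>\<^sub>0" by (auto elim!: nonpos_Ints_cases)
    then have G: "Gamma (s/2) * rGamma (s/2) = 1"
      by (simp add: rGamma_inverse_Gamma Gamma_eq_zero_iff)
    have "rGamma (s / 2 + 1) / 2 = rGamma (s/2) / s"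
      using rGamma_plus1[of "s/2"] s0 by (simp add: field_simps)
    then have fs: "f s = exp (s / 2 * of_real (ln pi)) * rGamma (s/2) * completed_zeta s"
      using s0 by (simp add: f_def completed_zeta_def field_simps)
    have "(\<lambda>n. exp (s / 2 * of_real (ln pi)) * rGamma (s/2) * (Gamma (s / 2) * exp (- (s / 2 * of_real (ln pi))) * (1 / of_nat (Suc n) powr s))) sums f s"
      unfolding fs by (intro sums_mult completed_zeta_sums s)
    moreover have eq: "exp (s / 2 * of_real (ln pi)) * rGamma (s/2) * (Gamma (s / 2) * exp (- (s / 2 * of_real (ln pi))) * c) = c" for c
    proof -
      have "exp (s / 2 * of_real (ln pi)) * rGamma (s/2) * (Gamma (s / 2) * exp (- (s / 2 * of_real (ln pi))) * c)
         = (exp (s / 2 * of_real (ln pi)) * exp (- (s / 2 * of_real (ln pi)))) * (Gamma (s/2) * rGamma (s/2)) * c"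
        by (simp only: mult_ac)
      then show ?thesis unfolding G by (simp flip: exp_add)
    qed
    ultimately show ?thesis by (simp only: eq)
  qed
  \<comment> \<open>The definition prescribes 0 at the pole, whereas the formula takes whatever
    value division by zero produces there.\<close>
  have P1: "P (f(1 := 0))"
    unfolding P_def
  proof (intro conjI allI impI)
    show "f(1 := 0) holomorphic_on - {1}" using fhol by (rule holomorphic_transform) auto
  qed (use fsums in auto)
  have P2: "g = f(1 := 0)" if g: "P g" for g
  proof
    fix z
    show "g z = (f(1 := 0)) z"
    proof (cases "z = 1")
      case False
      have "g z = f z"
      proof (rule analytic_continuation_open[of "{s. Re s > 1}" "- {1}" g f])
        show "{s. Re s > 1} \<noteq> {}" by (auto intro!: exI[of _ "2::complex"])
        show "connected (- {1::complex})" by (rule connected_punctured_universe) simp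
        show "g x = f x" if "x \<in> {s. Re s > 1}" for x
          using g fsums[of x] that sums_unique2 unfolding P_def by blast
      qed (use g fhol False in \<open>auto simp: P_def open_halfspace_Re_gt\<close>)
      then show ?thesis using False by simp
    qed (use g in \<open>simp add: P_def\<close>)
  qed
  have "zeta = (THE f. P f)" unfolding zeta_def P_def ..
  also have "\<dots> = f(1 := 0)" using P1 P2 by (rule the_equality)
  finally have "zeta s = f s" using assms by (metis fun_upd_other)
  then show ?thesis unfolding f_def .
qed

corollary holomorphic_zeta: "zeta holomorphic_on - {1}"
proof -
  have "(\<lambda>s. exp (s / 2 * of_real (ln pi)) *
     ((half_mellin (s / 2) + half_mellin ((1 - s) / 2) + 1 / (s - 1)) * rGamma (s / 2) - rGamma (s / 2 + 1) / 2)) holomorphic_on - {1}"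
    by (intro holomorphic_intros) auto
  then show ?thesis by (rule holomorphic_transform) (simp add: zeta_eq)
qed

corollary zeta_eq_completed_zeta:
  assumes "s \<noteq> 0" "s \<noteq> 1"
  shows "zeta s = exp (s / 2 * of_real (ln pi)) * rGamma (s / 2) * completed_zeta s"
proof -
  have r: "rGamma (s / 2 + 1) / 2 = rGamma (s/2) / s"
    using rGamma_plus1[of "s/2"] assms by (simp add: field_simps)
  show ?thesis unfolding zeta_eq[OF assms(2)] r completed_zeta_def by (simp add: algebra_simps)
qed

section \<open>The digamma function on the line Re z = 1/4\<close>

lemma half_ln_ratio_ge:
  fixes x A :: real
  assumes "0 \<le> x" "x < A"
  shows "x / A \<le> (ln (A + x) - ln (A - x)) / 2"
proof -
  define f where "f = (\<lambda>v::real. (ln (A + v) - ln (A - v)) / 2 - v / A)"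
  have "f 0 \<le> f x"
  proof (rule DERIV_nonneg_imp_nondecreasing[OF assms(1)])
    fix v assume v: "0 \<le> v" "v \<le> x"
    have "(f has_real_derivative ((1 / (A + v) + 1 / (A - v)) / 2 - 1 / A)) (at v)"
      unfolding f_def using assms v by (auto intro!: derivative_eq_intros)
    moreover have "(1 / (A + v) + 1 / (A - v)) / 2 - 1 / A = v\<^sup>2 / (A * (A + v) * (A - v))"
    proof -
      have "A + v \<noteq> 0" "A - v \<noteq> 0" "A \<noteq> 0" using assms v by auto
      then show ?thesis by (simp add: divide_simps power2_eq_square; algebra)
    qed
    moreover have "v\<^sup>2 / (A * (A + v) * (A - v)) \<ge> 0"
      using assms v by (intro divide_nonneg_nonneg mult_nonneg_nonneg) auto
    ultimately show "\<exists>y. (f has_real_derivative y) (at v) \<and> 0 \<le> y" by auto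
  qed
  then show ?thesis by (simp add: f_def)
qed

text \<open>With \<open>u = x / A\<close> the left side is artanh u, and artanh u is at most u / (1
  - 3/8 u^2) for u up to 2/5; the constant 3/8 exceeds the Taylor coefficient 1/3 enough to cover
  the higher terms. Then \<open>u^2 \<le> 1 / A\<close> turns the correction into a constant shift
  of \<open>A\<close>.\<close>

lemma half_ln_ratio_le:
  fixes x A :: real
  assumes x: "0 \<le> x" and A: "x\<^sup>2 \<le> A" "25 / 4 \<le> A"
  shows "(ln (A + x) - ln (A - x)) / 2 \<le> x / (A - 3 / 8)"
proof -
  define u where "u = x / A"
  have "x\<^sup>2 \<le> A * A * (4 / 25)" using A mult_left_mono[OF A(2), of A] by linarith
  then have u2: "u\<^sup>2 \<le> (2 / 5)\<^sup>2" unfolding u_def power_divide using A by (simp add: field_simps power2_eq_square)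
  then have u: "0 \<le> u" "u \<le> 2 / 5" using x A power2_le_imp_le[OF u2] by (auto simp: u_def)
  define f where "f = (\<lambda>v::real. v / (1 - 3 / 8 * v\<^sup>2) - (ln (1 + v) - ln (1 - v)) / 2)"
  have "f 0 \<le> f u"
  proof (rule DERIV_nonneg_imp_nondecreasing[OF u(1)])
    fix v assume v: "0 \<le> v" "v \<le> u"
    then have v2: "v\<^sup>2 \<le> 4 / 25" using power_mono[of v "2/5" 2] u by (simp add: power_divide)
    have v1: "v < 1" using v u by simp
    have pos: "1 - 3 / 8 * v\<^sup>2 > 0" "1 - v\<^sup>2 > 0" using v2 by simp_all
    have "(f has_real_derivative ((1 * (1 - 3 / 8 * v\<^sup>2) - v * (- (3 / 8 * (2 * v)))) / (1 - 3 / 8 * v\<^sup>2)\<^sup>2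
        - (1 / (1 + v) + 1 / (1 - v)) / 2)) (at v)"
      unfolding f_def using v v1 pos by (auto intro!: derivative_eq_intros simp: power2_eq_square)
    moreover have "(1 / (1 + v) + 1 / (1 - v)) / 2 = 1 / (1 - v\<^sup>2)"
    proof -
      have "1 + v \<noteq> 0" "1 - v \<noteq> 0" "1 - v\<^sup>2 \<noteq> 0" using v v1 pos by auto
      then show ?thesis by (simp add: divide_simps; algebra)
    qed
    moreover have "(1 * (1 - 3 / 8 * v\<^sup>2) - v * (- (3 / 8 * (2 * v)))) / (1 - 3 / 8 * v\<^sup>2)\<^sup>2 \<ge> 1 / (1 - v\<^sup>2)"
    proof -
      have "0 \<le> v\<^sup>2 * (1 / 8 - 33 / 64 * v\<^sup>2)" using v2 by (intro mult_nonneg_nonneg) auto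
      also have "\<dots> = (1 * (1 - 3 / 8 * v\<^sup>2) - v * (- (3 / 8 * (2 * v)))) * (1 - v\<^sup>2) - (1 - 3 / 8 * v\<^sup>2)\<^sup>2"
        by (simp add: algebra_simps power2_eq_square)
      finally show ?thesis using pos by (subst frac_le_eq) (auto simp: divide_nonpos_pos)
    qed
    ultimately show "\<exists>y. (f has_real_derivative y) (at v) \<and> 0 \<le> y" by auto
  qed
  then have "(ln (1 + u) - ln (1 - u)) / 2 \<le> u / (1 - 3 / 8 * u\<^sup>2)" by (simp add: f_def)
  also have "\<dots> \<le> u / (1 - 3 / 8 * (1 / A))"
  proof (intro divide_left_mono mult_pos_pos)
    have "u\<^sup>2 \<le> 1 / A" unfolding u_def power_divide using A by (simp add: field_simps power2_eq_square)
    then show "1 - 3 / 8 * (1 / A) \<le> 1 - 3 / 8 * u\<^sup>2" by simp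
    show "0 < 1 - 3 / 8 * (1 / A)" using A by (simp add: field_simps)
    show "0 < 1 - 3 / 8 * u\<^sup>2" using u2 by (simp add: power_divide)
  qed (use u in auto)
  also have "\<dots> = x / (A - 3 / 8)" unfolding u_def using A by (simp add: field_simps)
  also have "ln (1 + u) - ln (1 - u) = ln (A + x) - ln (A - x)"
  proof -
    have "A + x = A * (1 + u)" "A - x = A * (1 - u)" using A by (simp_all add: u_def field_simps)
    then show ?thesis using A u by (simp add: ln_mult)
  qed
  finally show ?thesis .
qed

text \<open>By the addition formula the right side is the tangent of the left side. Comparing
  derivatives in \<open>a\<close> avoids any discussion of branches.\<close>

lemma arctan_diff_le:
  fixes a b :: real
  assumes ab: "b \<le> a" "0 < 1 + a * b"
  shows "arctan a - arctan b \<le> (a - b) / (1 + a * b)"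
proof -
  define f where "f = (\<lambda>v. (v - b) / (1 + v * b) - (arctan v - arctan b))"
  have "f b \<le> f a"
  proof (rule DERIV_nonneg_imp_nondecreasing[OF ab(1)])
    fix v assume v: "b \<le> v" "v \<le> a"
    have p: "0 < 1 + v * b"
    proof (cases "b \<ge> 0")
      case True
      then have "v * b \<ge> 0" using v by simp
      then show ?thesis by simp
    next
      case False
      then have "v * b \<ge> a * b" using v by (intro mult_right_mono_neg) auto
      then show ?thesis using ab by simp
    qed
    have v2: "0 < 1 + v\<^sup>2" by (intro add_pos_nonneg) auto
    have "(f has_real_derivative ((1 + v * b) - (v - b) * b) / (1 + v * b)\<^sup>2 - 1 / (1 + v\<^sup>2)) (at v)"
      unfolding f_def using p v2 by (auto intro!: derivative_eq_intros simp: power2_eq_square inverse_eq_divide)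
    moreover have "1 / (1 + v\<^sup>2) \<le> ((1 + v * b) - (v - b) * b) / (1 + v * b)\<^sup>2"
    proof -
      have "0 \<le> (v - b)\<^sup>2" by simp
      also have "\<dots> = ((1 + v * b) - (v - b) * b) * (1 + v\<^sup>2) - (1 + v * b)\<^sup>2"
        by (simp add: algebra_simps power2_eq_square)
      finally show ?thesis using p v2 by (subst frac_le_eq) (auto simp: divide_nonpos_pos)
    qed
    ultimately show "\<exists>y. (f has_real_derivative y) (at v) \<and> 0 \<le> y" by auto
  qed
  then show ?thesis by (simp add: f_def)
qed

lemma arctan_taylor_bounds:
  fixes x :: real
  assumes "x \<ge> 0"
  shows "x - x ^ 3 / 3 \<le> arctan x" "arctan x \<le> x - x ^ 3 / 3 + x ^ 5 / 5"
    and "x - x ^ 3 / 3 + x ^ 5 / 5 - x ^ 7 / 7 \<le> arctan x"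
proof -
  have p: "0 < 1 + v\<^sup>2" for v :: real by (intro add_pos_nonneg) auto
  have d1: "((\<lambda>v. arctan v - (v - v ^ 3 / 3)) has_real_derivative v ^ 4 / (1 + v\<^sup>2)) (at v)" for v :: real
    using p[of v] by (auto intro!: derivative_eq_intros simp: field_simps power_numeral_reduce)
  have "(\<lambda>v. arctan v - (v - v ^ 3 / 3)) 0 \<le> (\<lambda>v. arctan v - (v - v ^ 3 / 3)) x"
    by (rule DERIV_nonneg_imp_nondecreasing[OF assms]) (use d1 p in \<open>meson divide_nonneg_pos zero_le_even_power even_numeral\<close>)
  then show "x - x ^ 3 / 3 \<le> arctan x" by simp
  have d2: "((\<lambda>v. (v - v ^ 3 / 3 + v ^ 5 / 5) - arctan v) has_real_derivative v ^ 6 / (1 + v\<^sup>2)) (at v)" for v :: real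
    using p[of v] by (auto intro!: derivative_eq_intros simp: field_simps power_numeral_reduce)
  have "(\<lambda>v. (v - v ^ 3 / 3 + v ^ 5 / 5) - arctan v) 0 \<le> (\<lambda>v. (v - v ^ 3 / 3 + v ^ 5 / 5) - arctan v) x"
    by (rule DERIV_nonneg_imp_nondecreasing[OF assms]) (use d2 p in \<open>meson divide_nonneg_pos zero_le_even_power even_numeral\<close>)
  then show "arctan x \<le> x - x ^ 3 / 3 + x ^ 5 / 5" by simp
  have d3: "((\<lambda>v. arctan v - (v - v ^ 3 / 3 + v ^ 5 / 5 - v ^ 7 / 7)) has_real_derivative v ^ 8 / (1 + v\<^sup>2)) (at v)" for v :: real
    using p[of v] by (auto intro!: derivative_eq_intros simp: field_simps power_numeral_reduce)
  have "(\<lambda>v. arctan v - (v - v ^ 3 / 3 + v ^ 5 / 5 - v ^ 7 / 7)) 0 \<le> (\<lambda>v. arctan v - (v - v ^ 3 / 3 + v ^ 5 / 5 - v ^ 7 / 7)) x"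
    by (rule DERIV_nonneg_imp_nondecreasing[OF assms]) (use d3 p in \<open>meson divide_nonneg_pos zero_le_even_power even_numeral\<close>)
  then show "x - x ^ 3 / 3 + x ^ 5 / 5 - x ^ 7 / 7 \<le> arctan x" by simp
qed

text \<open>Machin's formula with Taylor sums cut off on the appropriate side. The coefficient
  comparison in \<open>kernel_integral_le\<close> needs this precision: an upper bound of 3.142
  would be too weak there.\<close>

lemma pi_bounds: "31415 / 10000 < pi" "pi < 31417 / 10000"
proof -
  have m: "pi = 4 * (4 * arctan (1 / 5) - arctan (1 / 239))" using machin by simp
  show "31415 / 10000 < pi"
    unfolding m using arctan_taylor_bounds(3)[of "1/5"] arctan_taylor_bounds(2)[of "1/239"]
    by (simp add: field_simps)
  show "pi < 31417 / 10000"
    unfolding m using arctan_taylor_bounds(2)[of "1/5"] arctan_taylor_bounds(1)[of "1/239"]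
    by (simp add: field_simps)
qed

section \<open>The digamma series at 1/4 + i y\<close>

lemma inverse_quarter_plus:
  fixes y :: real
  shows "Re (inverse (Complex (1/4) y + of_nat n)) = (real n + 1/4) / ((real n + 1/4)\<^sup>2 + y\<^sup>2)"
    and "Im (inverse (Complex (1/4) y + of_nat n)) = - (y / ((real n + 1/4)\<^sup>2 + y\<^sup>2))"
  by (simp_all add: Re_divide Im_divide add.commute)

lemma Digamma_quarter_LIMSEQ:
  fixes y :: real
  shows "(\<lambda>m. ln (real m) - (\<Sum>n<m. (real n + 1/4) / ((real n + 1/4)\<^sup>2 + y\<^sup>2))) \<longlonglongrightarrow> Re (Digamma (Complex (1/4) y))"
    and "(\<lambda>m. \<Sum>n<m. y / ((real n + 1/4)\<^sup>2 + y\<^sup>2)) \<longlonglongrightarrow> Im (Digamma (Complex (1/4) y))"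
proof -
  have "Complex (1/4) y \<noteq> 0" by (simp add: complex_eq_iff)
  note L = Digamma_LIMSEQ[OF this]
  show "(\<lambda>m. ln (real m) - (\<Sum>n<m. (real n + 1/4) / ((real n + 1/4)\<^sup>2 + y\<^sup>2))) \<longlonglongrightarrow> Re (Digamma (Complex (1/4) y))"
    using tendsto_Re[OF L] by (simp only: minus_complex.sel Re_complex_of_real Re_sum inverse_quarter_plus)
  show "(\<lambda>m. \<Sum>n<m. y / ((real n + 1/4)\<^sup>2 + y\<^sup>2)) \<longlonglongrightarrow> Im (Digamma (Complex (1/4) y))"
    using tendsto_Im[OF L] by (simp only: minus_complex.sel Im_complex_of_real Im_sum inverse_quarter_plus sum_negf) simp
qed

text \<open>Every term of the subtracted series decreases in \<open>y\<close>. The term with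
  \<open>n = 0\<close> contributes a fixed gap \<open>d\<close>, so strictness survives the
  limit.\<close>

lemma Re_Digamma_quarter_strict_mono:
  assumes "0 \<le> y" "y < y'"
  shows "Re (Digamma (Complex (1/4) y)) < Re (Digamma (Complex (1/4) y'))"
proof -
  let ?g = "\<lambda>y n. (real n + 1/4) / ((real n + 1/4)\<^sup>2 + y\<^sup>2)"
  define d where "d = ?g y 0 - ?g y' 0"
  have y2: "y\<^sup>2 < y'\<^sup>2" using assms by (intro power_strict_mono) auto
  have d: "d > 0" unfolding d_def using y2
    by (simp add: divide_strict_left_mono add_pos_nonneg mult_pos_pos)
  have mono: "?g y' n \<le> ?g y n" for n
    using y2 by (intro divide_left_mono mult_pos_pos add_pos_nonneg) auto
  have "ln (real m) - (\<Sum>n<m. ?g y n) + d \<le> ln (real m) - (\<Sum>n<m. ?g y' n)" if m: "m \<ge> 1" for m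
  proof -
    obtain k where k: "m = Suc k" using m by (cases m) auto
    have "(\<Sum>n<k. ?g y' (Suc n)) \<le> (\<Sum>n<k. ?g y (Suc n))" by (intro sum_mono mono)
    then show ?thesis unfolding k sum.lessThan_Suc_shift d_def by simp
  qed
  then have "Re (Digamma (Complex (1/4) y)) + d \<le> Re (Digamma (Complex (1/4) y'))"
    by (intro LIMSEQ_le[OF tendsto_add[OF Digamma_quarter_LIMSEQ(1) tendsto_const] Digamma_quarter_LIMSEQ(1)]) auto
  with d show ?thesis by simp
qed

text \<open>Both bounds compare the digamma series termwise with the telescoping sum of
  \<open>ln ((n + 3/4)\<^sup>2 + c) / 2 - ln ((n - 1/4)\<^sup>2 + c) / 2\<close>, with the shift \<open>c\<close> adapted to the direction.\<close>

lemma ln_telescope_LIMSEQ: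
  fixes c :: real
  shows "(\<lambda>m. ln (real m) - (\<Sum>n<m. (ln ((real n + 3/4)\<^sup>2 + c) - ln ((real n - 1/4)\<^sup>2 + c)) / 2))
     \<longlonglongrightarrow> ln (1/16 + c) / 2"
proof -
  have tel: "(\<Sum>n<m. (ln ((real n + 3/4)\<^sup>2 + c) - ln ((real n - 1/4)\<^sup>2 + c)) / 2) =
     (ln ((real m - 1/4)\<^sup>2 + c) - ln (1/16 + c)) / 2" for m
  proof (induction m)
    case 0
    show ?case by (simp add: power2_eq_square)
  next
    case (Suc m)
    have "real (Suc m) - 1/4 = real m + 3/4" by simp
    then show ?case unfolding sum.lessThan_Suc Suc.IH by (simp add: field_simps)
  qed
  have "(\<lambda>m. ln (real m) - ln ((real m - 1/4)\<^sup>2 + c) / 2) \<longlonglongrightarrow> 0"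
    by real_asymp
  then have "(\<lambda>m. ln (real m) - ln ((real m - 1/4)\<^sup>2 + c) / 2 + ln (1/16 + c) / 2) \<longlonglongrightarrow> 0 + ln (1/16 + c) / 2"
    by (intro tendsto_add tendsto_const)
  then show ?thesis unfolding tel by (simp add: diff_divide_distrib algebra_simps)
qed

lemma Re_Digamma_quarter_ge:
  assumes y: "y \<ge> 1"
  shows "Re (Digamma (Complex (1/4) y)) \<ge> ln (y\<^sup>2 - 3/16) / 2"
proof -
  have y2: "1 \<le> y\<^sup>2" using y by simp
  \<comment> \<open>With \<open>A = (n + 1/4)^2 + y^2\<close> and \<open>x = n + 1/4\<close>, both
    \<open>A + x\<close> and \<open>A - x\<close> are squares of \<open>n + 3/4\<close> and
    \<open>n - 1/4\<close> plus the same constant \<open>y^2 - 1/4\<close>, hence the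
    telescoping.\<close>
  have "ln (1/16 + (y\<^sup>2 - 1/4)) / 2 \<le> Re (Digamma (Complex (1/4) y))"
  proof (rule LIMSEQ_le[OF ln_telescope_LIMSEQ Digamma_quarter_LIMSEQ(1)], intro exI[of _ 0] allI impI diff_left_mono sum_mono)
    fix n :: nat
    let ?x = "real n + 1/4" and ?A = "(real n + 1/4)\<^sup>2 + y\<^sup>2"
    have "?x < ?A"
    proof -
      have "0 \<le> (?x - 1/2)\<^sup>2" by simp
      then have "?x \<le> ?x\<^sup>2 + 1/4" by (simp add: power2_eq_square algebra_simps)
      then show ?thesis using y2 by simp
    qed
    then have "?x / ?A \<le> (ln (?A + ?x) - ln (?A - ?x)) / 2"
      by (intro half_ln_ratio_ge) auto
    also have "?A + ?x = (real n + 3/4)\<^sup>2 + (y\<^sup>2 - 1/4)" by (simp add: power2_eq_square algebra_simps)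
    also have "?A - ?x = (real n - 1/4)\<^sup>2 + (y\<^sup>2 - 1/4)" by (simp add: power2_eq_square algebra_simps)
    finally show "?x / ?A \<le> (ln ((real n + 3/4)\<^sup>2 + (y\<^sup>2 - 1/4)) - ln ((real n - 1/4)\<^sup>2 + (y\<^sup>2 - 1/4))) / 2" .
  qed
  then show ?thesis by (simp add: algebra_simps)
qed

lemma Re_Digamma_quarter_le:
  assumes y: "y \<ge> 5/2"
  shows "Re (Digamma (Complex (1/4) y)) \<le> ln (y\<^sup>2 + 3/16) / 2"
proof -
  have y2: "25/4 \<le> y\<^sup>2" using power_mono[OF y, of 2] by (simp add: power2_eq_square)
  \<comment> \<open>Here \<open>A\<close> is enlarged by the 3/8 of \<open>half_ln_ratio_le\<close>,
    so the constant becomes \<open>y^2 - 1/4 + 3/8 = y^2 + 1/8\<close>.\<close>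
  have "Re (Digamma (Complex (1/4) y)) \<le> ln (1/16 + (y\<^sup>2 + 1/8)) / 2"
  proof (rule LIMSEQ_le[OF Digamma_quarter_LIMSEQ(1) ln_telescope_LIMSEQ], intro exI[of _ 0] allI impI diff_left_mono sum_mono)
    fix n :: nat
    let ?x = "real n + 1/4" and ?A = "(real n + 1/4)\<^sup>2 + y\<^sup>2 + 3/8"
    have "0 \<le> ?x\<^sup>2" by simp
    then have "25 / 4 \<le> ?A" "?x\<^sup>2 \<le> ?A" using y2 by linarith+
    then have "(ln (?A + ?x) - ln (?A - ?x)) / 2 \<le> ?x / (?A - 3/8)"
      by (intro half_ln_ratio_le) auto
    also have "?A + ?x = (real n + 3/4)\<^sup>2 + (y\<^sup>2 + 1/8)" by (simp add: power2_eq_square algebra_simps)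
    also have "?A - ?x = (real n - 1/4)\<^sup>2 + (y\<^sup>2 + 1/8)" by (simp add: power2_eq_square algebra_simps)
    finally show "(ln ((real n + 3/4)\<^sup>2 + (y\<^sup>2 + 1/8)) - ln ((real n - 1/4)\<^sup>2 + (y\<^sup>2 + 1/8))) / 2 \<le> ?x / ((real n + 1/4)\<^sup>2 + y\<^sup>2)"
      by simp
  qed
  then show ?thesis by (simp add: algebra_simps)
qed

text \<open>The same telescoping with arctangents. The choice \<open>r^2 = y^2 + 1/4\<close> makes
  the denominator of \<open>arctan_diff_le\<close>, multiplied by \<open>r^2\<close>, equal to that
  of the series term; the limit and the starting value supply \<open>pi / 2\<close> and
  \<open>arctan (1 / (4 * r))\<close>.\<close>

lemma Im_Digamma_quarter_ge:
  assumes y: "y > 0"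
  defines "r \<equiv> sqrt (y\<^sup>2 + 1/4)"
  shows "Im (Digamma (Complex (1/4) y)) \<ge> y / r * (pi / 2 + arctan (1 / (4 * r)))"
proof -
  have r: "r > 0" "r\<^sup>2 = y\<^sup>2 + 1/4" using y by (auto simp: r_def add_pos_nonneg)
  let ?d = "\<lambda>n. arctan ((real n + 3/4) / r) - arctan ((real n - 1/4) / r)"
  have tel: "(\<Sum>n<m. ?d n) = arctan ((real m - 1/4) / r) + arctan (1 / (4 * r))" for m
  proof (induction m)
    case 0
    have "- (1 / 4) / r = - (1 / (4 * r))" by simp
    then show ?case by (simp add: arctan_minus)
  next
    case (Suc m)
    have "real (Suc m) - 1/4 = real m + 3/4" by simp
    then show ?case unfolding sum.lessThan_Suc Suc.IH by (simp add: add.commute)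
  qed
  have term_le: "y / r * ?d n \<le> y / ((real n + 1/4)\<^sup>2 + y\<^sup>2)" for n
  proof -
    let ?a = "(real n + 3/4) / r" and ?b = "(real n - 1/4) / r"
    have e: "1 + ?a * ?b = ((real n + 1/4)\<^sup>2 + y\<^sup>2) / r\<^sup>2"
    proof -
      have "1 + ?a * ?b = (r\<^sup>2 + (real n + 3/4) * (real n - 1/4)) / r\<^sup>2"
        using r(1) by (simp add: field_simps power2_eq_square)
      also have "r\<^sup>2 + (real n + 3/4) * (real n - 1/4) = (real n + 1/4)\<^sup>2 + y\<^sup>2"
        unfolding r(2) by (simp add: power2_eq_square algebra_simps)
      finally show ?thesis .
    qed
    have pos: "(real n + 1/4)\<^sup>2 + y\<^sup>2 > 0" by (intro add_pos_nonneg) auto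
    have "1 + ?a * ?b > 0" unfolding e using r(1) pos by (intro divide_pos_pos) auto
    moreover have "?b \<le> ?a" using r by (intro divide_right_mono) auto
    ultimately have "?d n \<le> (?a - ?b) / (1 + ?a * ?b)" by (intro arctan_diff_le)
    also have "\<dots> = r / ((real n + 1/4)\<^sup>2 + y\<^sup>2)"
      unfolding e using r(1) pos by (simp add: field_simps power2_eq_square)
    finally have "y / r * ?d n \<le> y / r * (r / ((real n + 1/4)\<^sup>2 + y\<^sup>2))"
      using y r by (intro mult_left_mono) auto
    also have "\<dots> = y / ((real n + 1/4)\<^sup>2 + y\<^sup>2)" using r by simp
    finally show ?thesis .
  qed
  have "(\<lambda>m. y / r * (arctan ((real m - 1/4) / r) + arctan (1 / (4 * r)))) \<longlonglongrightarrow> y / r * (pi / 2 + arctan (1 / (4 * r)))"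
  proof (intro tendsto_intros)
    have "filterlim (\<lambda>m. (real m - 1/4) / r) at_top sequentially"
      using r(1) by real_asymp
    then show "(\<lambda>m. arctan ((real m - 1/4) / r)) \<longlonglongrightarrow> pi / 2"
      by (rule filterlim_compose[OF tendsto_arctan_at_top])
  qed
  then show ?thesis
    using Digamma_quarter_LIMSEQ(2)[of y]
  proof (rule LIMSEQ_le, intro exI[of _ 0] allI impI)
    fix m :: nat
    show "y / r * (arctan ((real m - 1/4) / r) + arctan (1 / (4 * r))) \<le> (\<Sum>n<m. y / ((real n + 1/4)\<^sup>2 + y\<^sup>2))"
      unfolding tel[symmetric] sum_distrib_left by (intro sum_mono term_le)
  qed
qed

text \<open>The range contains half of the zero of \<open>theta'\<close>; half of the bound, 0.81,
  is the estimate for \<open>gamma_decay\<close> in \<open>hardy'_neg\<close>.\<close>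

lemma Im_Digamma_quarter_ge_numeric:
  assumes y: "y \<ge> 311/100" "y \<le> 318/100"
  shows "Im (Digamma (Complex (1/4) y)) \<ge> 162/100"
proof -
  define r where "r = sqrt (y\<^sup>2 + 1/4)"
  have y2: "96721/10000 \<le> y\<^sup>2" "y\<^sup>2 \<le> 101124/10000"
    using power_mono[OF y(1), of 2] power_mono[OF y(2), of 2] y by (simp_all add: power_divide)
  have "y\<^sup>2 + 1/4 > 0" by (intro add_nonneg_pos) auto
  then have r: "r > 0" by (simp add: r_def)
  have r2: "r\<^sup>2 = y\<^sup>2 + 1/4" by (simp add: r_def)
  have rle: "r \<le> 322/100" unfolding r_def using y2 by (intro real_le_lsqrt) (auto simp: power_divide)
  have yr: "y / r \<ge> 987/1000"
  proof -
    have "(987/1000 * r)\<^sup>2 = (987/1000)\<^sup>2 * (y\<^sup>2 + 1/4)" by (simp only: power_mult_distrib r2)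
    also have "\<dots> \<le> 9742/10000 * (y\<^sup>2 + 1/4)"
      by (intro mult_right_mono add_nonneg_nonneg) (simp_all add: power_divide)
    also have "\<dots> \<le> y\<^sup>2" using y2(1) by (simp add: field_simps)
    finally have "(987/1000 * r)\<^sup>2 \<le> y\<^sup>2" .
    then have "987/1000 * r \<le> y" by (rule power2_le_imp_le) (use y in simp)
    then show ?thesis using r by (simp add: field_simps)
  qed
  \<comment> \<open>\<open>25/322\<close> is \<open>1 / (4 * r)\<close> at the upper bound
    \<open>r = 3.22\<close>.\<close>
  have "25/322 - (25/322)^3/3 \<le> arctan (25/322 :: real)"
    by (rule arctan_taylor_bounds) simp
  also have "\<dots> \<le> arctan (1 / (4 * r))"
  proof -
    have "25 / 322 \<le> 1 / (4 * r)" using r rle by (simp add: pos_le_divide_eq)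
    then show ?thesis by (simp only: arctan_le_iff)
  qed
  finally have "25/322 - (25/322)^3/3 \<le> arctan (1 / (4 * r))" .
  moreover have "(16482/10000 :: real) - 31415/20000 \<le> 25/322 - (25/322)^3/3"
    by (simp add: power3_eq_cube)
  ultimately have "pi / 2 + arctan (1 / (4 * r)) \<ge> 16482/10000"
    using pi_bounds by linarith
  then have "987/1000 * (16482/10000) \<le> y / r * (pi / 2 + arctan (1 / (4 * r)))"
    using yr y r by (intro mult_mono) auto
  also have "\<dots> \<le> Im (Digamma (Complex (1/4) y))"
    unfolding r_def using y by (intro Im_Digamma_quarter_ge) auto
  finally show ?thesis by simp
qed

text \<open>The real part is \<open>ln y\<close> up to a change of 3/16 in \<open>y^2\<close>, so it
  meets \<open>ln pi\<close> near \<open>y = pi\<close>. The endpoints are just far enough from pi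
  for the two logarithmic bounds to decide the sign.\<close>

lemma Re_Digamma_quarter_crosses_ln_pi:
  obtains y0 where "(311/100) \<le> y0" "y0 \<le> 3172/1000" "Re (Digamma (Complex (1/4) y0)) = ln pi"
    "\<And>y. 0 \<le> y \<Longrightarrow> y < y0 \<Longrightarrow> Re (Digamma (Complex (1/4) y)) < ln pi"
    "\<And>y. y0 < y \<Longrightarrow> ln pi < Re (Digamma (Complex (1/4) y))"
proof -
  let ?f = "\<lambda>y. Re (Digamma (Complex (1/4) y))"
  have lnpi: "ln pi = ln (pi\<^sup>2) / 2" by (simp add: ln_realpow)
  have pi2: "(31415/10000)\<^sup>2 \<le> pi\<^sup>2" "pi\<^sup>2 \<le> (31417/10000)\<^sup>2"
    using pi_bounds by (auto intro!: power_mono)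
  have lo: "?f (311/100) \<le> ln pi"
  proof -
    have "?f (311/100) \<le> ln ((311/100)\<^sup>2 + 3/16) / 2" by (rule Re_Digamma_quarter_le) simp
    also have "\<dots> \<le> ln pi" unfolding lnpi using pi2 by (intro divide_right_mono ln_mono) (auto simp: power2_eq_square)
    finally show ?thesis .
  qed
  have hi: "ln pi \<le> ?f (3172/1000)"
  proof -
    have "ln pi \<le> ln ((3172/1000)\<^sup>2 - 3/16) / 2" unfolding lnpi using pi2 by (intro divide_right_mono ln_mono) (auto simp: power2_eq_square)
    also have "\<dots> \<le> ?f (3172/1000)" by (rule Re_Digamma_quarter_ge) simp
    finally show ?thesis .
  qed
  have cont: "continuous_on {311/100..3172/1000} ?f"
  proof (intro continuous_intros)
    show "continuous_on {311/100..3172/1000} (\<lambda>y. Digamma (Complex (1/4) y))"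
      by (intro continuous_on_compose2[OF continuous_on_Polygamma[of "{z. Re z > 0}" 0]])
         (auto simp: continuous_on_Complex elim!: nonpos_Ints_cases intro!: continuous_intros)
  qed
  obtain y0 where y0: "311/100 \<le> y0" "y0 \<le> 3172/1000" "?f y0 = ln pi"
    using IVT'[OF lo hi _ cont] by auto
  show ?thesis
    using y0 Re_Digamma_quarter_strict_mono[of _ y0] Re_Digamma_quarter_strict_mono[of y0] by (intro that[of y0]) auto
qed

section \<open>Numerical bounds for the theta integrals\<close>

lemma exp_ge_taylor_sum:
  fixes x :: real
  assumes "x \<ge> 0"
  shows "(\<Sum>k<n. x ^ k / fact k) \<le> exp x"
proof -
  have s: "(\<lambda>k. x ^ k / fact k) sums exp x"
    using exp_converges[of x] by (simp add: divide_inverse mult.commute)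
  have "(\<Sum>k<n. x ^ k / fact k) \<le> (\<Sum>k. x ^ k / fact k)"
    using assms s by (intro sum_le_suminf) (auto simp: sums_iff)
  then show ?thesis using s by (simp add: sums_iff)
qed

lemma exp_pi_ge: "exp pi \<ge> 231 / 10"
proof -
  have "231 / 10 \<le> (\<Sum>k<13. (31415/10000) ^ k / fact k :: real)"
    by (simp add: eval_nat_numeral lessThan_Suc fact_reduce)
  also have "\<dots> \<le> exp (31415/10000)" by (rule exp_ge_taylor_sum) simp
  also have "\<dots> \<le> exp pi" using pi_bounds by simp
  finally show ?thesis .
qed

lemma exp_minus_ge_cubic:
  fixes u :: real
  assumes u: "u \<ge> 0"
  shows "1 - u + u\<^sup>2 / 2 - u ^ 3 / 6 \<le> exp (- u)"
proof -
  have nn: "f u \<ge> 0" if "f 0 = 0" "\<And>v. v \<ge> 0 \<Longrightarrow> (f has_real_derivative f' v) (at v)" "\<And>v. v \<ge> 0 \<Longrightarrow> f' v \<ge> 0" "u \<ge> 0"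
    for f f' :: "real \<Rightarrow> real" and u
    using DERIV_nonneg_imp_nondecreasing[of 0 u f] that by fastforce
  have 1: "1 - exp (- u) \<ge> 0" if "u \<ge> 0" for u :: real using that by simp
  have 2: "exp (- u) - (1 - u) \<ge> 0" if "u \<ge> 0" for u :: real
    by (rule nn[where f = "\<lambda>u. exp (- u) - (1 - u)" and f' = "\<lambda>u. 1 - exp (- u)"])
       (auto intro!: derivative_eq_intros simp: that)
  have 3: "(1 - u + u\<^sup>2 / 2) - exp (- u) \<ge> 0" if "u \<ge> 0" for u :: real
    by (rule nn[where f = "\<lambda>u. (1 - u + u\<^sup>2 / 2) - exp (- u)" and f' = "\<lambda>u. exp (- u) - (1 - u)"])
       (use 2 that in \<open>auto intro!: derivative_eq_intros\<close>)
  have "exp (- u) - (1 - u + u\<^sup>2 / 2 - u ^ 3 / 6) \<ge> 0"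
    by (rule nn[where f = "\<lambda>u. exp (- u) - (1 - u + u\<^sup>2 / 2 - u ^ 3 / 6)" and f' = "\<lambda>u. (1 - u + u\<^sup>2 / 2) - exp (- u)"])
       (use 3 u in \<open>auto intro!: derivative_eq_intros simp: power2_eq_square\<close>)
  then show ?thesis by simp
qed

lemma sin_cos_taylor_bounds:
  fixes w :: real
  assumes w: "w \<ge> 0"
  shows "w - w ^ 3 / 6 \<le> sin w" "cos w \<le> 1 - w\<^sup>2 / 2 + w ^ 4 / 24"
proof -
  have nn: "f u \<ge> 0" if "f 0 = 0" "\<And>v. v \<ge> 0 \<Longrightarrow> (f has_real_derivative f' v) (at v)" "\<And>v. v \<ge> 0 \<Longrightarrow> f' v \<ge> 0" "u \<ge> 0"
    for f f' :: "real \<Rightarrow> real" and u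
    using DERIV_nonneg_imp_nondecreasing[of 0 u f] that by fastforce
  have 2: "cos v - (1 - v\<^sup>2 / 2) \<ge> 0" if "v \<ge> 0" for v :: real
    by (rule nn[where f = "\<lambda>v. cos v - (1 - v\<^sup>2 / 2)" and f' = "\<lambda>v. v - sin v"])
       (use that sin_x_le_x in \<open>auto intro!: derivative_eq_intros\<close>)
  have 3: "sin v - (v - v ^ 3 / 6) \<ge> 0" if "v \<ge> 0" for v :: real
    by (rule nn[where f = "\<lambda>v. sin v - (v - v ^ 3 / 6)" and f' = "\<lambda>v. cos v - (1 - v\<^sup>2 / 2)"])
       (use that 2 in \<open>auto intro!: derivative_eq_intros simp: power2_eq_square\<close>)
  have 4: "(1 - v\<^sup>2 / 2 + v ^ 4 / 24) - cos v \<ge> 0" if "v \<ge> 0" for v :: real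
    by (rule nn[where f = "\<lambda>v. (1 - v\<^sup>2 / 2 + v ^ 4 / 24) - cos v" and f' = "\<lambda>v. sin v - (v - v ^ 3 / 6)"])
       (use that 3 in \<open>auto intro!: derivative_eq_intros simp: power2_eq_square\<close>)
  show "w - w ^ 3 / 6 \<le> sin w" "cos w \<le> 1 - w\<^sup>2 / 2 + w ^ 4 / 24" using 3[OF w] 4[OF w] by simp_all
qed

text \<open>On \<open>[0, b]\<close> the integral is at most \<open>H 0 - H b\<close>, so eventual
  nonnegativity of \<open>H\<close> replaces knowledge of its limit.\<close>

lemma set_integral_le_antiderivative:
  fixes g H H' :: "real \<Rightarrow> real"
  assumes int: "set_integrable lborel {0..} g"
    and der: "\<And>u. u \<ge> 0 \<Longrightarrow> (H has_real_derivative H' u) (at u)"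
    and le: "\<And>u. u \<ge> 0 \<Longrightarrow> g u \<le> - H' u"
    and nonneg: "eventually (\<lambda>u. H u \<ge> 0) at_top"
  shows "(LINT u:{0..}|lborel. g u) \<le> H 0"
proof -
  have lim: "((\<lambda>b. LINT u:{0..b}|lborel. g u) \<longlongrightarrow> (LINT u:{0..}|lborel. g u)) at_top"
    by (rule tendsto_set_lebesgue_integral_at_top) (auto intro!: int)
  have "eventually (\<lambda>b. (LINT u:{0..b}|lborel. g u) \<le> H 0) at_top"
    using nonneg eventually_ge_at_top[of 0]
  proof eventually_elim
    case (elim b)
    have si: "set_integrable lborel {0..b} g" by (rule set_integrable_subset[OF int]) auto
    have "((\<lambda>u. - H' u) has_integral (- H b - - H 0)) {0..b}"
    proof (rule fundamental_theorem_of_calculus)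
      fix u assume "u \<in> {0..b}"
      then have "(H has_real_derivative H' u) (at u within {0..b})"
        by - (rule has_field_derivative_at_within[OF der], simp)
      then have "((\<lambda>u. - H u) has_real_derivative - H' u) (at u within {0..b})" by (rule DERIV_minus)
      then show "((\<lambda>u. - H u) has_vector_derivative - H' u) (at u within {0..b})"
        by (simp add: has_real_derivative_iff_has_vector_derivative)
    qed (use elim in simp)
    from has_integral_le[OF integrable_integral[OF set_borel_integral_eq_integral(1)[OF si]] this]
    have "integral {0..b} g \<le> - H b - - H 0" using le by simp
    then show ?case using elim set_borel_integral_eq_integral(2)[OF si] by simp
  qed
  then show ?thesis by (intro tendsto_upperbound[OF lim]) auto
qed

text \<open>With \<open>q = exp (- (pi * x))\<close>, the terms after the first sum to at most
  \<open>2 * q^4\<close>, because the squares from 4 onwards dominate 4, 5, 6 and so on. The bound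
  \<open>q \<le> 10/231\<close> turns this into the relative error 1/3000.\<close>

lemma omega_leading_term:
  assumes x: "x \<ge> 1"
  shows "exp (- (pi * x)) \<le> omega x" "omega x \<le> (1 + 1 / 3000) * exp (- (pi * x))"
proof -
  define q where "q = exp (- (pi * x))"
  have q0: "q > 0" by (simp add: q_def)
  have "pi * 1 \<le> pi * x" using x by (intro mult_left_mono) auto
  then have "exp (- (pi * x)) \<le> exp (- pi)" by simp
  also have "\<dots> \<le> 10 / 231" using exp_pi_ge by (simp add: exp_minus field_simps)
  finally have q: "q \<le> 10 / 231" by (simp add: q_def)
  let ?w = "\<lambda>n. exp (- (pi * x * (real n + 1)\<^sup>2))"
  have s: "summable ?w" using x by (intro summable_omega) auto
  have split: "omega x = q + (\<Sum>n. ?w (Suc n))"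
    unfolding omega_def q_def using suminf_split_initial_segment[OF s, of 1] by simp
  have s': "summable (\<lambda>n. ?w (Suc n))" using s by (subst summable_Suc_iff)
  show "exp (- (pi * x)) \<le> omega x"
    unfolding split q_def[symmetric] using suminf_nonneg[OF s'] by simp
  have "(\<Sum>n. ?w (Suc n)) \<le> (\<Sum>n. q ^ 4 * q ^ n)"
  proof (intro suminf_le s' summable_mult summable_geometric)
    fix n
    have "real n + 4 \<le> (real (Suc n) + 1)\<^sup>2" by (simp add: power2_eq_square algebra_simps)
    then have "pi * x * (real n + 4) \<le> pi * x * (real (Suc n) + 1)\<^sup>2" using x by (intro mult_left_mono) auto
    then have "?w (Suc n) \<le> exp (- (pi * x * real (4 + n)))" by (simp add: add.commute)
    also have "\<dots> = q ^ (4 + n)" unfolding q_def by (simp only: exp_of_nat_mult[symmetric]) (simp add: mult.commute)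
    finally show "?w (Suc n) \<le> q ^ 4 * q ^ n" by (simp add: power_add)
  qed (use q q0 in auto)
  also have "\<dots> = q ^ 4 * (1 / (1 - q))"
    using q q0 by (subst suminf_mult[OF summable_geometric]) (simp_all add: suminf_geometric)
  also have "\<dots> \<le> q ^ 4 * 2" using q q0 by (intro mult_left_mono) (auto simp: field_simps)
  also have "\<dots> = 2 * q ^ 3 * q" by (simp add: power_numeral_reduce)
  also have "\<dots> \<le> 1 / 3000 * q"
  proof (intro mult_right_mono)
    have "q ^ 3 \<le> (10 / 231) ^ 3" using q q0 by (intro power_mono) auto
    then show "2 * q ^ 3 \<le> 1 / 3000" by (simp add: power_divide)
  qed (use q0 in auto)
  finally show "omega x \<le> (1 + 1 / 3000) * exp (- (pi * x))"
    unfolding split q_def[symmetric] by (simp add: algebra_simps)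
qed

text \<open>The antiderivative \<open>- exp (- pi * exp u - 3/4 * u) * s u\<close> dominates the integral as soon as the
  differential inequality \<open>le\<close> holds; the value at 0 is the bound.\<close>

lemma omega_integral_le:
  fixes \<phi> s s' :: "real \<Rightarrow> real"
  assumes int: "set_integrable lborel {0..} (\<lambda>u. omega (exp u) * exp (u / 4) * \<phi> u)"
    and der: "\<And>u. u \<ge> 0 \<Longrightarrow> (s has_real_derivative s' u) (at u)"
    and le: "\<And>u. u \<ge> 0 \<Longrightarrow> exp u * (\<phi> u + \<bar>\<phi> u\<bar> / 3000) \<le> pi * exp u * s u + 3 / 4 * s u - s' u"
    and nonneg: "eventually (\<lambda>u. s u \<ge> 0) at_top"
  shows "(LINT u:{0..}|lborel. omega (exp u) * exp (u / 4) * \<phi> u) \<le> exp (- pi) * s 0"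
proof -
  \<comment> \<open>The exponent -3/4 arises because
    \<open>exp (u / 4) * exp (- (pi * exp u)) = e u * exp u\<close>: the factor \<open>exp u\<close>
    matches the one that differentiating \<open>exp (- (pi * exp u))\<close> produces.\<close>
  define e where "e = (\<lambda>u. exp (- (pi * exp u) - 3 / 4 * u))"
  have "(LINT u:{0..}|lborel. omega (exp u) * exp (u / 4) * \<phi> u) \<le> e 0 * s 0"
  proof (rule set_integral_le_antiderivative[OF int, where H = "\<lambda>u. e u * s u" and H' = "\<lambda>u. e u * (s' u - pi * exp u * s u - 3 / 4 * s u)"])
    fix u :: real assume u: "u \<ge> 0"
    show "((\<lambda>u. e u * s u) has_real_derivative e u * (s' u - pi * exp u * s u - 3 / 4 * s u)) (at u)"
      unfolding e_def by (auto intro!: derivative_eq_intros der[OF u] simp: algebra_simps)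
    \<comment> \<open>Where \<phi> is positive the upper bound for \<open>omega\<close> applies,
      where it is negative the lower one; the term with the absolute value covers both.\<close>
    have "omega (exp u) * \<phi> u \<le> exp (- (pi * exp u)) * (\<phi> u + \<bar>\<phi> u\<bar> / 3000)"
    proof (cases "\<phi> u \<ge> 0")
      case True
      then have "omega (exp u) * \<phi> u \<le> (1 + 1 / 3000) * exp (- (pi * exp u)) * \<phi> u"
        using u by (intro mult_right_mono omega_leading_term) auto
      then show ?thesis using True by (simp add: algebra_simps)
    next
      case False
      then have "omega (exp u) * \<phi> u \<le> exp (- (pi * exp u)) * \<phi> u"
        using u by (intro mult_right_mono_neg omega_leading_term) auto
      also have "\<dots> \<le> exp (- (pi * exp u)) * (\<phi> u + \<bar>\<phi> u\<bar> / 3000)" by (intro mult_left_mono) auto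
      finally show ?thesis .
    qed
    then have "exp (u / 4) * (omega (exp u) * \<phi> u) \<le> exp (u / 4) * (exp (- (pi * exp u)) * (\<phi> u + \<bar>\<phi> u\<bar> / 3000))"
      by (intro mult_left_mono) auto
    also have "\<dots> = e u * (exp u * (\<phi> u + \<bar>\<phi> u\<bar> / 3000))"
    proof -
      have "exp (u / 4) * exp (- (pi * exp u)) = e u * exp u"
        unfolding e_def by (simp flip: exp_add)
      then show ?thesis by (metis mult.assoc)
    qed
    also have "\<dots> \<le> e u * (pi * exp u * s u + 3 / 4 * s u - s' u)"
      using le[OF u] by (intro mult_left_mono) (auto simp: e_def)
    finally show "omega (exp u) * exp (u / 4) * \<phi> u \<le> - (e u * (s' u - pi * exp u * s u - 3 / 4 * s u))"
      by (simp add: algebra_simps)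
  next
    show "eventually (\<lambda>u. e u * s u \<ge> 0) at_top"
      using nonneg by eventually_elim (simp add: e_def)
  qed
  then show ?thesis by (simp add: e_def)
qed

section \<open>Bounds for the two integrals on the critical line\<close>

lemma half_mellin_quarter:
  shows "Re (half_mellin (Complex (1/4) y)) = (LINT u:{0..}|lborel. omega (exp u) * exp (u / 4) * cos (y * u))"
    and "Im (half_mellin' (Complex (1/4) y)) = (LINT u:{0..}|lborel. omega (exp u) * exp (u / 4) * (u * sin (y * u)))"
    and "set_integrable lborel {0..} (\<lambda>u. omega (exp u) * exp (u / 4) * cos (y * u))"
    and "set_integrable lborel {0..} (\<lambda>u. omega (exp u) * exp (u / 4) * (u * sin (y * u)))"
proof -
  let ?z = "Complex (1/4) y"
  have 1: "Re (of_real (omega (exp u)) * exp (?z * of_real u)) = omega (exp u) * exp (u / 4) * cos (y * u)" for u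
    by (simp add: Re_exp)
  have 2: "Im (of_real (omega (exp u) * u) * exp (?z * of_real u)) = omega (exp u) * exp (u / 4) * (u * sin (y * u))" for u
    by (simp add: Im_exp)
  note i = integrable_half_mellin[of ?z, unfolded set_integrable_def]
  note i' = integrable_half_mellin'[of ?z, unfolded set_integrable_def]
  show "Re (half_mellin ?z) = (LINT u:{0..}|lborel. omega (exp u) * exp (u / 4) * cos (y * u))"
    unfolding half_mellin_def set_lebesgue_integral_def integral_Re[OF i, symmetric] scaleR_complex.sel 1 by simp
  show "Im (half_mellin' ?z) = (LINT u:{0..}|lborel. omega (exp u) * exp (u / 4) * (u * sin (y * u)))"
    unfolding half_mellin'_def set_lebesgue_integral_def integral_Im[OF i', symmetric] scaleR_complex.sel 2 by simp
  show "set_integrable lborel {0..} (\<lambda>u. omega (exp u) * exp (u / 4) * cos (y * u))"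
    using integrable_Re[OF i] unfolding set_integrable_def scaleR_complex.sel 1 by simp
  show "set_integrable lborel {0..} (\<lambda>u. omega (exp u) * exp (u / 4) * (u * sin (y * u)))"
    using integrable_Im[OF i'] unfolding set_integrable_def scaleR_complex.sel 2 by simp
qed

text \<open>Bounding the cosine by 1 is affordable for every \<open>y\<close>, and a linear
  \<open>s\<close> suffices. The constant has to stay below about 0.285 for
  \<open>xi_line_neg\<close> to reach 6.344.\<close>

lemma Re_half_mellin_quarter_le:
  "Re (half_mellin (Complex (1/4) y)) \<le> exp (- pi) * (283 / 1000)"
proof -
  let ?s = "\<lambda>u::real. 283/1000 + 95/1000 * u"
  have "set_integrable lborel {0..} (\<lambda>u. omega (exp u) * exp (u / 4) * cos (0 * u))"
    by (rule half_mellin_quarter)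
  then have i1: "set_integrable lborel {0..} (\<lambda>u. omega (exp u) * exp (u / 4) * 1)" by simp
  have "Re (half_mellin (Complex (1/4) y)) \<le> (LINT u:{0..}|lborel. omega (exp u) * exp (u / 4) * 1)"
    unfolding half_mellin_quarter
    by (intro set_integral_mono half_mellin_quarter i1 mult_left_mono mult_nonneg_nonneg omega_nonneg) auto
  also have "\<dots> \<le> exp (- pi) * ?s 0"
  proof (rule omega_integral_le[OF i1, where s = ?s and s' = "\<lambda>_. 95/1000"])
    fix u :: real assume u: "u \<ge> 0"
    show "(?s has_real_derivative 95 / 1000) (at u)" by (auto intro!: derivative_eq_intros)
    have h: "- 113/1000 + 298/1000 * u \<le> pi * ?s u - (1 + 1/3000)"
    proof -
      have "0 \<le> (pi * (95/1000) - 298/1000) * u" using pi_bounds u by (intro mult_nonneg_nonneg) auto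
      then show ?thesis using pi_bounds by (simp add: algebra_simps)
    qed
    \<comment> \<open>The factor \<open>exp u\<close> does not lower the minimum: already at
      \<open>u = 0\<close> the product is increasing, because 298 exceeds 113.\<close>
    have "exp u * (- 113/1000 + 298/1000 * u) \<ge> - 113/1000"
    proof -
      define F where "F = (\<lambda>v::real. exp v * (- 113/1000 + 298/1000 * v))"
      have "F 0 \<le> F u"
      proof (rule DERIV_nonneg_imp_nondecreasing[OF u])
        fix v :: real assume v: "0 \<le> v" "v \<le> u"
        have "(F has_real_derivative exp v * (185/1000 + 298/1000 * v)) (at v)"
          unfolding F_def by (auto intro!: derivative_eq_intros simp: algebra_simps)
        moreover have "0 \<le> exp v * (185/1000 + 298/1000 * v)" using v by simp
        ultimately show "\<exists>y. (F has_real_derivative y) (at v) \<and> 0 \<le> y" by blast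
      qed
      then show ?thesis by (simp add: F_def)
    qed
    moreover have "exp u * (- 113/1000 + 298/1000 * u) \<le> exp u * (pi * ?s u - (1 + 1/3000))"
      using h by (intro mult_left_mono) auto
    ultimately have "- 113/1000 \<le> exp u * (pi * ?s u - (1 + 1/3000))" by linarith
    then show "exp u * (1 + \<bar>1\<bar> / 3000) \<le> pi * exp u * ?s u + 3 / 4 * ?s u - 95 / 1000"
      using u by (simp add: algebra_simps)
  next
    show "eventually (\<lambda>u. ?s u \<ge> 0) at_top" using eventually_ge_at_top[of 0] by eventually_elim simp
  qed
  finally show ?thesis by simp
qed

text \<open>Here \<open>r = 3/4 * s - s'\<close> and \<open>h\<close> is a lower bound for \<open>pi * s - \<phi>\<close>, with the quartic \<open>s\<close> of
  \<open>kernel_integral_le\<close>, which was found by linear programming. Both \<open>r\<close> and \<open>h\<close> change sign near 0.477,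
  so that either \<open>exp (- u)\<close> or \<open>exp u\<close> may be replaced by a polynomial. The identity in the first case is a
  Bernstein expansion on \<open>[0, 12/25]\<close>.\<close>

lemma kernel_quartic_inequality:
  fixes u :: real
  assumes u: "u \<ge> 0"
  defines "h \<equiv> - 745/1000 - 1792/1000 * u + 708/100 * u\<^sup>2"
    and "r \<equiv> 77925/100000 + 20325/10000 * u - 9225/10000 * u\<^sup>2 - 1548/100 * u ^ 3 + 29025/10000 * u ^ 4"
  shows "0 \<le> exp u * h + r"
proof (cases "u \<le> 477/1000")
  case True
  have r: "r \<ge> 0"
  proof -
    \<comment> \<open>Expanding at the end of the interval leaves a constant of about 0.009, which
      outweighs the only negative term left (at most 0.002); the rest of the quadratic and cubic
      part is grouped as \<open>v\<close> times a nonnegative bracket.\<close>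
    define v where "v = 477/1000 - u"
    have v: "0 \<le> v" "v \<le> 477/1000" and u_eq: "u = 477/1000 - v" using u True by (auto simp: v_def)
    have "r = 3621111685401/400000000000000 + v * ((477/1000 - v) * (1911/100 - 9942/1000 * (v + 477/1000)) + 9942/1000 * (477/1000)\<^sup>2 - 1911/100 * (477/1000) + 815396298387/100000000000)
       - 392493/200000000 * v\<^sup>2 + 3/100000 * v ^ 3 + 29025/10000 * v ^ 4"
      unfolding r_def u_eq by (simp add: field_simps eval_nat_numeral)
    moreover have "0 \<le> v * ((477/1000 - v) * (1911/100 - 9942/1000 * (v + 477/1000)) + 9942/1000 * (477/1000)\<^sup>2 - 1911/100 * (477/1000) + 815396298387/100000000000)"
    proof (rule mult_nonneg_nonneg)
      have "0 \<le> (477/1000 - v) * (1911/100 - 9942/1000 * (v + 477/1000))" using v by (intro mult_nonneg_nonneg) auto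
      then show "0 \<le> (477/1000 - v) * (1911/100 - 9942/1000 * (v + 477/1000)) + 9942/1000 * (477/1000)\<^sup>2 - 1911/100 * (477/1000) + 815396298387/100000000000"
        by (simp add: power2_eq_square)
    qed (use v in auto)
    moreover have "392493/200000000 * v\<^sup>2 \<le> 392493/200000000 * 1"
      using v by (intro mult_left_mono power_le_one) auto
    ultimately show "r \<ge> 0" using v by simp
  qed
  \<comment> \<open>As \<open>r\<close> is nonnegative, \<open>exp (- u)\<close> may be replaced by
    a lower bound. The coefficient 42/100 comes from \<open>1/2 - u/6\<close>, which is at least
    0.42 for \<open>u \<le> 0.48\<close>.\<close>
  have "0 \<le> h + (1 - u + 42/100 * u\<^sup>2) * r"
  proof -
    define p where "p = 25/12 * u"
    have u_eq: "u = 12/25 * p" and p: "0 \<le> p" "0 \<le> 1 - p" using u True by (auto simp: p_def)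
    have "h + (1 - u + 42/100 * u\<^sup>2) * r = 1/4000 + 1/2500 * p + 12601/15625000 * p ^ 2 + 9059/19531250 * p ^ 3 + 492409/1953125000 * p ^ 4 + 2318118/6103515625 * p ^ 5 + 555237613/610351562500 * p ^ 6
       + (1 - p) ^ 4 * (17/500 * (1 - p)\<^sup>2 - 11/200 * (p * (1 - p)) + 6/25 * p\<^sup>2)
       + 337/500 * (p ^ 3 * (1 - p) ^ 3) + 477/1000 * (p ^ 4 * (1 - p) ^ 2) + 131/1000 * (p ^ 5 * (1 - p)) + 13/1000 * p ^ 6"
      unfolding h_def r_def u_eq by (simp add: field_simps eval_nat_numeral)
    \<comment> \<open>The only negative Bernstein coefficient, -11/200, is absorbed by its two
      neighbours through completing the square; 275/340 is 11/200 divided by twice 17/500.\<close>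
    moreover have "17/500 * (1 - p)\<^sup>2 - 11/200 * (p * (1 - p)) + 6/25 * p\<^sup>2 = 17/500 * ((1 - p) - 275/340 * p)\<^sup>2 + (6/25 - 17/500 * (275/340)\<^sup>2) * p\<^sup>2"
      by (simp add: field_simps power2_eq_square)
    moreover have "0 \<le> 17/500 * ((1 - p) - 275/340 * p)\<^sup>2 + (6/25 - 17/500 * (275/340)\<^sup>2) * p\<^sup>2"
      by (intro add_nonneg_nonneg mult_nonneg_nonneg) (simp_all add: power2_eq_square)
    ultimately show ?thesis using p
      by (auto intro!: add_nonneg_nonneg mult_nonneg_nonneg)
  qed
  also have "\<dots> \<le> h + exp (- u) * r"
  proof (intro add_left_mono mult_right_mono r)
    have "0 \<le> u\<^sup>2 * (8/100 - u / 6)" using u True by (intro mult_nonneg_nonneg) auto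
    then show "1 - u + 42/100 * u\<^sup>2 \<le> exp (- u)"
      using exp_minus_ge_cubic[OF u] by (simp add: algebra_simps power2_eq_square power3_eq_cube)
  qed
  finally have "0 \<le> exp u * (h + exp (- u) * r)" by simp
  also have "\<dots> = exp u * h + r" by (simp add: ring_distribs exp_minus)
  finally show ?thesis .
next
  case False
  define v where "v = u - 477/1000"
  have v: "0 \<le> v" and u_eq: "u = 477/1000 + v" using False by (auto simp: v_def)
  have h0: "h \<ge> 0"
  proof -
    have "h = 1112132/100000000 + v * (- 1792/1000 + 708/100 * (954/1000 + v))"
      unfolding h_def u_eq by (simp add: algebra_simps power2_eq_square)
    then show ?thesis using v by simp
  qed
  \<comment> \<open>Now \<open>h\<close> is nonnegative, so it is \<open>exp u\<close> that is
    bounded below, by \<open>exp 0.477 * (1 + v)\<close>, to reach a polynomial in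
    \<open>v\<close>.\<close>
  have "161/100 \<le> (\<Sum>k<7. (477/1000) ^ k / fact k :: real)"
    by (simp add: eval_nat_numeral lessThan_Suc fact_reduce)
  also have "\<dots> \<le> exp (477/1000)" by (rule exp_ge_taylor_sum) simp
  finally have "161/100 * (1 + v) \<le> exp (477/1000) * exp v"
    using v exp_ge_add_one_self[of v] by (intro mult_mono) auto
  then have e: "161/100 * (1 + v) \<le> exp u" by (simp add: u_eq exp_add)
  \<comment> \<open>This square lies just below the quadratic part of the expansion in
    \<open>v\<close>; the cubic and quartic terms only help.\<close>
  have "0 \<le> (525/1000 * v - 14/100)\<^sup>2" by simp
  also have "\<dots> = 275625/1000000 * v\<^sup>2 - 147/1000 * v + 196/10000"
    by (simp add: field_simps power2_eq_square)
  also have "\<dots> \<le> 55234547/200000000 * v\<^sup>2 - 14672245867/100000000000 * v + 10783241765401/400000000000000"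
    by (intro add_mono diff_mono mult_right_mono) (use v in auto)
  finally have "0 \<le> 10783241765401/400000000000000 - 14672245867/100000000000 * v + 55234547/200000000 * v\<^sup>2" by simp
  then have "0 \<le> 10783241765401/400000000000000 - 14672245867/100000000000 * v + 55234547/200000000 * v\<^sup>2
     + 145677/100000 * v ^ 3 + 1161/400 * v ^ 4" using v by simp
  also have "\<dots> = 161/100 * (1 + v) * h + r"
    unfolding h_def r_def u_eq by (simp add: field_simps eval_nat_numeral)
  also have "\<dots> \<le> exp u * h + r" using e h0 by (intro add_right_mono mult_right_mono) auto
  finally show ?thesis .
qed

text \<open>This combination enters \<open>hardy'\<close> once \<open>gamma_decay\<close> is
  replaced by 0.81. Keeping both terms in one kernel preserves the gain from the sine: the bound of
  \<open>Re_half_mellin_quarter_le\<close> on the first term alone would be too large for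
  \<open>hardy'_neg\<close>.\<close>

lemma kernel_integral_le:
  assumes y: "311/100 \<le> y" "y \<le> 3172/1000"
  shows "162/100 * Re (half_mellin (Complex (1/4) y)) - Im (half_mellin' (Complex (1/4) y)) \<le> exp (- pi) * (279/1000)"
proof -
  define \<phi> where "\<phi> = (\<lambda>u. 162/100 * cos (y * u) - u * sin (y * u))"
  define s where "s = (\<lambda>u::real. 279/1000 - 57/100 * u - 123/100 * u\<^sup>2 + 387/100 * u ^ 4)"
  define s' where "s' = (\<lambda>u::real. - 57/100 - 246/100 * u + 1548/100 * u ^ 3)"
  note hm = half_mellin_quarter[of y]
  have eq: "omega (exp u) * exp (u / 4) * \<phi> u = 162/100 * (omega (exp u) * exp (u / 4) * cos (y * u)) - omega (exp u) * exp (u / 4) * (u * sin (y * u))" for u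
    by (simp add: \<phi>_def algebra_simps)
  have int: "set_integrable lborel {0..} (\<lambda>u. omega (exp u) * exp (u / 4) * \<phi> u)"
    unfolding eq by (intro set_integral_diff set_integrable_mult_right hm)
  have "162/100 * Re (half_mellin (Complex (1/4) y)) - Im (half_mellin' (Complex (1/4) y)) = (LINT u:{0..}|lborel. omega (exp u) * exp (u / 4) * \<phi> u)"
    unfolding eq hm(1,2) set_integral_diff(2)[OF set_integrable_mult_right[OF hm(3)] hm(4)] set_integral_mult_right ..
  also have "\<dots> \<le> exp (- pi) * s 0"
  proof (rule omega_integral_le[OF int, where s = s and s' = s'])
    fix u :: real assume u: "u \<ge> 0"
    show "(s has_real_derivative s' u) (at u)"
      unfolding s_def s'_def by (auto intro!: derivative_eq_intros simp: algebra_simps)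
    define h where "h = - 745/1000 - 1792/1000 * u + 708/100 * u\<^sup>2"
    define r where "r = 77925/100000 + 20325/10000 * u - 9225/10000 * u\<^sup>2 - 1548/100 * u ^ 3 + 29025/10000 * u ^ 4"
    have r: "r = 3 / 4 * s u - s' u" by (simp add: r_def s_def s'_def algebra_simps)
    have yu: "0 \<le> y * u" "311/100 * u \<le> y * u" "y * u \<le> 3172/1000 * u"
      using mult_right_mono[OF y(1) u] mult_right_mono[OF y(2) u] y u by simp_all
    have c: "cos (y * u) \<le> 1 - (311/100 * u)\<^sup>2 / 2 + (3172/1000 * u) ^ 4 / 24"
    proof -
      have "(311/100 * u)\<^sup>2 \<le> (y * u)\<^sup>2" "(y * u) ^ 4 \<le> (3172/1000 * u) ^ 4"
        using yu u by (auto intro!: power_mono)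
      then show ?thesis using sin_cos_taylor_bounds(2)[OF yu(1)] by linarith
    qed
    have sn: "u * sin (y * u) \<ge> u * (311/100 * u - (3172/1000 * u) ^ 3 / 6)"
    proof (rule mult_left_mono[OF _ u])
      have "(y * u) ^ 3 \<le> (3172/1000 * u) ^ 3" using yu by (intro power_mono) auto
      then show "311/100 * u - (3172/1000 * u) ^ 3 / 6 \<le> sin (y * u)"
        using sin_cos_taylor_bounds(1)[OF yu(1)] yu by linarith
    qed
    have ab: "\<bar>\<phi> u\<bar> \<le> 2 + u"
    proof -
      have "\<bar>\<phi> u\<bar> \<le> \<bar>162/100 * cos (y * u)\<bar> + \<bar>u * sin (y * u)\<bar>" unfolding \<phi>_def by (rule abs_triangle_ineq4)
      also have "\<dots> \<le> 162/100 * 1 + u * 1"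
        unfolding abs_mult using u by (intro add_mono mult_mono) auto
      finally show ?thesis by simp
    qed
    have "\<phi> u \<le> 162/100 * (1 - (311/100 * u)\<^sup>2 / 2 + (3172/1000 * u) ^ 4 / 24) - u * (311/100 * u - (3172/1000 * u) ^ 3 / 6)"
      unfolding \<phi>_def by (intro diff_mono mult_left_mono c sn) simp
    moreover have "\<bar>\<phi> u\<bar> / 3000 \<le> (2 + u) / 3000" using ab by (intro divide_right_mono) auto
    ultimately have "\<phi> u + \<bar>\<phi> u\<bar> / 3000 \<le> 162/100 * (1 - (311/100 * u)\<^sup>2 / 2 + (3172/1000 * u) ^ 4 / 24) - u * (311/100 * u - (3172/1000 * u) ^ 3 / 6) + (2 + u) / 3000"
      by (rule add_mono)
    also have "\<dots> \<le> pi * s u - h"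
    proof -
      \<comment> \<open>\<open>h\<close> is rounded so that in the difference of the two sides,
        expanded in powers of \<open>u\<close>, every coefficient is nonnegative and the cubic one
        is absent. The smallest slack, in \<open>a2\<close>, is about 0.0001.\<close>
      let ?u4 = "162/100 * (3172/1000) ^ 4 / 24 + (3172/1000) ^ 3 / 6 :: real"
      define a0 a1 a2 a4 where "a0 = 279/1000 * pi - 162/100 - 2/3000 + 745/1000"
        and "a1 = - (57/100) * pi - 1/3000 + 1792/1000"
        and "a2 = - (123/100) * pi + 162/100 * (311/100)\<^sup>2 / 2 + 311/100 - 708/100"
        and "a4 = 387/100 * pi - ?u4"
      have "a0 \<ge> 0" "a1 \<ge> 0" "a2 \<ge> 0" "a4 \<ge> 0"
        unfolding a0_def a1_def a2_def a4_def using pi_bounds by (simp_all add: power_divide)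
      then have "0 \<le> a0 + a1 * u + a2 * u\<^sup>2 + a4 * u ^ 4" using u by simp
      also have "\<dots> = pi * s u - h - (162/100 * (1 - (311/100 * u)\<^sup>2 / 2 + (3172/1000 * u) ^ 4 / 24) - u * (311/100 * u - (3172/1000 * u) ^ 3 / 6) + (2 + u) / 3000)"
        unfolding s_def h_def a0_def a1_def a2_def a4_def by (simp add: field_simps power_mult_distrib eval_nat_numeral)
      finally show ?thesis by linarith
    qed
    finally have "exp u * (\<phi> u + \<bar>\<phi> u\<bar> / 3000) \<le> exp u * (pi * s u - h)" by (intro mult_left_mono) auto
    moreover have "0 \<le> exp u * h + r" unfolding h_def r_def by (rule kernel_quartic_inequality[OF u])
    ultimately show "exp u * (\<phi> u + \<bar>\<phi> u\<bar> / 3000) \<le> pi * exp u * s u + 3 / 4 * s u - s' u"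
      unfolding r by (simp add: algebra_simps)
  next
    show "eventually (\<lambda>u. s u \<ge> 0) at_top" unfolding s_def by real_asymp
  qed
  finally show ?thesis by (simp add: s_def)
qed

section \<open>Zeta on the critical line\<close>

abbreviation crit :: "real \<Rightarrow> complex" where "crit t \<equiv> 1/2 + \<i> * of_real t"

lemma crit_half: "crit t / 2 = Complex (1/4) (t/2)" "(1 - crit t) / 2 = cnj (Complex (1/4) (t/2))"
  by (simp_all add: complex_eq_iff)

lemma half_mellin_cnj:
  "half_mellin (cnj z) = cnj (half_mellin z)" "half_mellin' (cnj z) = cnj (half_mellin' z)"
proof -
  have 1: "indicat_real {0..} u *\<^sub>R (of_real (omega (exp u)) * exp (cnj z * of_real u)) =
      cnj (indicat_real {0..} u *\<^sub>R (of_real (omega (exp u)) * exp (z * of_real u)))" for u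
    by (simp add: exp_cnj)
  show "half_mellin (cnj z) = cnj (half_mellin z)"
    unfolding half_mellin_def set_lebesgue_integral_def 1 by (rule Bochner_Integration.integral_cnj)
  have 2: "indicat_real {0..} u *\<^sub>R (of_real (omega (exp u) * u) * exp (cnj z * of_real u)) =
      cnj (indicat_real {0..} u *\<^sub>R (of_real (omega (exp u) * u) * exp (z * of_real u)))" for u
    by (simp add: exp_cnj)
  show "half_mellin' (cnj z) = cnj (half_mellin' z)"
    unfolding half_mellin'_def set_lebesgue_integral_def 2 by (rule Bochner_Integration.integral_cnj)
qed

text \<open>The holomorphic branch of log (pi^(-s/2) Gamma(s/2)) on \<open>Re s > 0\<close> that is
  real on the real axis. On the critical line its imaginary part is the Riemann--Siegel theta
  function.\<close>

definition log_gamma_factor :: "complex \<Rightarrow> complex" where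
  "log_gamma_factor s = ln_Gamma (s / 2) - s / 2 * of_real (ln pi)"

definition log_gamma_factor' :: "complex \<Rightarrow> complex" where
  "log_gamma_factor' s = Digamma (s / 2) / 2 - of_real (ln pi) / 2"

lemma half_notin_nonpos_Reals: "Re s > 0 \<Longrightarrow> s / 2 \<notin> \<real>\<^sub>\<le>\<^sub>0"
  by (auto simp: complex_nonpos_Reals_iff)

lemma log_gamma_factor_has_derivative:
  assumes "Re s > 0"
  shows "(log_gamma_factor has_field_derivative log_gamma_factor' s) (at s)"
  unfolding log_gamma_factor_def log_gamma_factor'_def
  using half_notin_nonpos_Reals[OF assms]
  by (auto intro!: derivative_eq_intros)

definition completed_zeta' :: "complex \<Rightarrow> complex" where
  "completed_zeta' s = half_mellin' (s / 2) / 2 - half_mellin' ((1 - s) / 2) / 2 - 1 / (s - 1)\<^sup>2 + 1 / s\<^sup>2"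

lemma completed_zeta_has_derivative:
  assumes "s \<noteq> 0" "s \<noteq> 1"
  shows "(completed_zeta has_field_derivative completed_zeta' s) (at s)"
proof -
  have d: "((\<lambda>s. half_mellin (f s)) has_field_derivative half_mellin' (f s) * f') (at s)"
    if "(f has_field_derivative f') (at s)" for f f'
    using DERIV_chain[OF half_mellin_has_derivative that] by (simp add: o_def)
  have 1: "((\<lambda>s. half_mellin (s / 2)) has_field_derivative half_mellin' (s / 2) * (1 / 2)) (at s)"
    by (rule d) (auto intro!: derivative_eq_intros)
  have 2: "((\<lambda>s. half_mellin ((1 - s) / 2)) has_field_derivative half_mellin' ((1 - s) / 2) * (- 1 / 2)) (at s)"
    by (rule d) (auto intro!: derivative_eq_intros)
  have 3: "((\<lambda>s. 1 / (s - 1) - 1 / s) has_field_derivative - 1 / (s - 1)\<^sup>2 + 1 / s\<^sup>2) (at s)"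
    using assms by (auto intro!: derivative_eq_intros simp: power2_eq_square)
  show ?thesis
    using DERIV_add[OF DERIV_add[OF 1 2] 3] unfolding completed_zeta_def completed_zeta'_def
    by (simp add: algebra_simps)
qed

lemma zeta_eq_exp_log_gamma_factor:
  assumes "Re s > 0" "s \<noteq> 1"
  shows "zeta s = exp (- log_gamma_factor s) * completed_zeta s"
proof -
  have s2: "s / 2 \<notin> \<int>\<^sub>\<le>\<^sub>0" using half_notin_nonpos_Reals[OF assms(1)] nonpos_Ints_subset_nonpos_Reals by blast
  have "rGamma (s / 2) = exp (- ln_Gamma (s / 2))"
    using s2 by (simp add: rGamma_inverse_Gamma Gamma_complex_altdef exp_minus)
  then have "exp (- log_gamma_factor s) = exp (s / 2 * of_real (ln pi)) * rGamma (s / 2)"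
    unfolding log_gamma_factor_def by (simp flip: exp_add add: algebra_simps)
  moreover have "s \<noteq> 0" using assms(1) by auto
  ultimately show ?thesis using zeta_eq_completed_zeta[of s] assms(2) by simp
qed

lemma deriv_zeta_eq:
  assumes "Re s > 0" "s \<noteq> 1"
  shows "deriv zeta s = exp (- log_gamma_factor s) * (completed_zeta' s - log_gamma_factor' s * completed_zeta s)"
proof -
  have s0: "s \<noteq> 0" using assms by auto
  have "((\<lambda>s. exp (- log_gamma_factor s) * completed_zeta s) has_field_derivative
     exp (- log_gamma_factor s) * (completed_zeta' s - log_gamma_factor' s * completed_zeta s)) (at s)"
    by (rule derivative_eq_intros refl log_gamma_factor_has_derivative completed_zeta_has_derivative assms s0)+
       (simp add: algebra_simps)
  moreover have "eventually (\<lambda>s. exp (- log_gamma_factor s) * completed_zeta s = zeta s) (nhds s)"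
  proof -
    have "open ({s. Re s > 0} - {1})" by (intro open_Diff open_halfspace_Re_gt) auto
    then have "eventually (\<lambda>s. s \<in> {s. Re s > 0} - {1}) (nhds s)"
      using assms by (intro eventually_nhds_in_open) auto
    then show ?thesis by eventually_elim (use zeta_eq_exp_log_gamma_factor in auto)
  qed
  ultimately have "(zeta has_field_derivative
     exp (- log_gamma_factor s) * (completed_zeta' s - log_gamma_factor' s * completed_zeta s)) (at s)"
    by (subst (asm) DERIV_cong_ev[OF refl _ refl]) auto
  then show ?thesis by (rule DERIV_imp_deriv)
qed

lemma has_real_derivative_along_crit:
  assumes "(g has_field_derivative d) (at (crit t))"
  shows "((\<lambda>t. Re (g (crit t))) has_real_derivative Re (\<i> * d)) (at t)"
    and "((\<lambda>t. Im (g (crit t))) has_real_derivative Im (\<i> * d)) (at t)"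
proof -
  have "(crit has_vector_derivative \<i>) (at t)"
    by (auto intro!: derivative_eq_intros simp: has_vector_derivative_def scaleR_conv_of_real mult.commute fun_eq_iff)
  then have "((g \<circ> crit) has_vector_derivative (\<i> * d)) (at t)"
    using field_vector_diff_chain_at[of crit \<i> t g d] assms by simp
  then have v: "((\<lambda>t. g (crit t)) has_vector_derivative (\<i> * d)) (at t)" by (simp add: o_def)
  show "((\<lambda>t. Re (g (crit t))) has_real_derivative Re (\<i> * d)) (at t)"
    using bounded_linear.has_vector_derivative[OF bounded_linear_Re v]
    by (simp add: has_real_derivative_iff_has_vector_derivative)
  show "((\<lambda>t. Im (g (crit t))) has_real_derivative Im (\<i> * d)) (at t)"
    using bounded_linear.has_vector_derivative[OF bounded_linear_Im v]
    by (simp add: has_real_derivative_iff_has_vector_derivative)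
qed

text \<open>These are the values of \<open>completed_zeta\<close> on the line, real because the two
  half-line transforms are conjugate there. Riemann's Xi differs by the factor
  \<open>- (1/4 + t^2) / 2\<close>.\<close>

definition xi_line :: "real \<Rightarrow> real" where
  "xi_line t = 2 * Re (half_mellin (Complex (1/4) (t/2))) - 1 / (1/4 + t\<^sup>2)"

definition xi_line' :: "real \<Rightarrow> real" where
  "xi_line' t = 2 * t / (1/4 + t\<^sup>2)\<^sup>2 - Im (half_mellin' (Complex (1/4) (t/2)))"

lemma completed_zeta_crit: "completed_zeta (crit t) = of_real (xi_line t)"
proof -
  have nz: "crit t \<noteq> 0" "crit t - 1 \<noteq> 0" by (simp_all add: complex_eq_iff)
  have D: "of_real (1/4 + t\<^sup>2) = - (crit t * (crit t - 1))"
    by (simp add: complex_eq_iff power2_eq_square)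
  have "1 / (crit t - 1) - 1 / crit t = - (1 / of_real (1/4 + t\<^sup>2))"
    unfolding D using nz by (simp add: field_simps)
  moreover have "half_mellin (crit t / 2) + half_mellin ((1 - crit t) / 2) = of_real (2 * Re (half_mellin (Complex (1/4) (t/2))))"
    unfolding crit_half half_mellin_cnj by (rule complex_add_cnj)
  ultimately show ?thesis
    unfolding completed_zeta_def xi_line_def by (simp del: of_real_add)
qed

lemma completed_zeta'_crit: "completed_zeta' (crit t) = - (\<i> * of_real (xi_line' t))"
proof -
  have nz: "crit t \<noteq> 0" "crit t - 1 \<noteq> 0" by (simp_all add: complex_eq_iff)
  have D: "of_real (1/4 + t\<^sup>2) = - (crit t * (crit t - 1))"
    by (simp add: complex_eq_iff power2_eq_square)
  have "- 1 / b\<^sup>2 + 1 / a\<^sup>2 = (b\<^sup>2 - a\<^sup>2) / (a * b)\<^sup>2" if "a \<noteq> 0" "b \<noteq> 0" for a b :: complex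
    using that by (simp add: field_simps)
  from this[OF nz]
  have "- 1 / (crit t - 1)\<^sup>2 + 1 / (crit t)\<^sup>2 = ((crit t - 1)\<^sup>2 - (crit t)\<^sup>2) / (crit t * (crit t - 1))\<^sup>2" .
  also have "(crit t - 1)\<^sup>2 - (crit t)\<^sup>2 = - (\<i> * of_real (2 * t))"
    by (simp add: complex_eq_iff power2_eq_square)
  also have "(crit t * (crit t - 1))\<^sup>2 = of_real ((1/4 + t\<^sup>2)\<^sup>2)"
    unfolding of_real_power D by simp
  finally have 1: "- 1 / (crit t - 1)\<^sup>2 + 1 / (crit t)\<^sup>2 = - (\<i> * of_real (2 * t / (1/4 + t\<^sup>2)\<^sup>2))"
    by (simp only: of_real_divide) simp
  have 2: "half_mellin' (crit t / 2) / 2 - half_mellin' ((1 - crit t) / 2) / 2 = \<i> * of_real (Im (half_mellin' (Complex (1/4) (t/2))))"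
    unfolding crit_half half_mellin_cnj by (simp add: complex_eq_iff)
  have "completed_zeta' (crit t) = (half_mellin' (crit t / 2) / 2 - half_mellin' ((1 - crit t) / 2) / 2) + (- 1 / (crit t - 1)\<^sup>2 + 1 / (crit t)\<^sup>2)"
    unfolding completed_zeta'_def by simp
  then show ?thesis unfolding 1 2 xi_line'_def by (simp only: of_real_diff) (simp add: algebra_simps)
qed

lemma xi_line_has_derivative: "(xi_line has_real_derivative xi_line' t) (at t)"
proof -
  have "((\<lambda>t. Re (completed_zeta (crit t))) has_real_derivative Re (\<i> * completed_zeta' (crit t))) (at t)"
    by (intro has_real_derivative_along_crit completed_zeta_has_derivative) (simp_all add: complex_eq_iff)
  then show ?thesis unfolding completed_zeta_crit completed_zeta'_crit by simp
qed

definition theta' :: "real \<Rightarrow> real" where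
  "theta' t = Re (Digamma (Complex (1/4) (t/2))) / 2 - ln pi / 2"

text \<open>Minus the logarithmic derivative in \<open>t\<close> of the absolute value of pi^(-s/2)
  Gamma(s/2) along the line.\<close>

definition gamma_decay :: "real \<Rightarrow> real" where
  "gamma_decay t = Im (Digamma (Complex (1/4) (t/2))) / 2"

lemma log_gamma_factor'_crit: "log_gamma_factor' (crit t) = of_real (theta' t) + \<i> * of_real (gamma_decay t)"
  unfolding log_gamma_factor'_def crit_half theta'_def gamma_decay_def by (simp add: complex_eq_iff)

text \<open>Up to the positive factor \<open>exp (Re (log_gamma_factor (crit t)))\<close>, this is the derivative of
  Hardy's function \<open>Z\<close>, of which \<open>xi_line\<close> is the corresponding multiple.\<close>

definition hardy' :: "real \<Rightarrow> real" where
  "hardy' t = xi_line' t + gamma_decay t * xi_line t"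

lemma zeta_crit: "zeta (crit t) = exp (- log_gamma_factor (crit t)) * of_real (xi_line t)"
  using zeta_eq_exp_log_gamma_factor[of "crit t"] completed_zeta_crit by (simp add: complex_eq_iff)

lemma zeta_crit_eq_0_iff: "zeta (crit t) = 0 \<longleftrightarrow> xi_line t = 0"
  by (simp add: zeta_crit)

lemma deriv_zeta_crit:
  "deriv zeta (crit t) = - exp (- log_gamma_factor (crit t)) * (of_real (theta' t * xi_line t) + \<i> * of_real (hardy' t))"
proof -
  have "crit t \<noteq> 1" "Re (crit t) > 0" by (simp_all add: complex_eq_iff)
  then show ?thesis
    using deriv_zeta_eq[of "crit t"]
    unfolding completed_zeta_crit completed_zeta'_crit log_gamma_factor'_crit hardy'_def by (simp add: algebra_simps)
qed

section \<open>The unimodular phase of kappa\<close>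

definition kappa_phase :: "real \<Rightarrow> complex" where
  "kappa_phase t = 1 + 2 * of_real (theta' t) * (zeta (crit t) / deriv zeta (crit t))"

text \<open>Up to a positive factor this \<open>w\<close> is i times the conjugate of the one in the
  overview, hence the shape \<open>- (cnj w / w)\<close>. It vanishes exactly where
  \<open>deriv zeta\<close> does, and there division by zero yields 1.\<close>

lemma kappa_phase_eq:
  fixes t
  defines "w \<equiv> Complex (theta' t * xi_line t) (hardy' t)"
  shows "kappa_phase t = (if w = 0 then 1 else - (cnj w / w))"
proof -
  have w: "of_real (theta' t * xi_line t) + \<i> * of_real (hardy' t) = w"
    by (simp add: w_def complex_eq_iff)
  have q: "zeta (crit t) / deriv zeta (crit t) = - (of_real (xi_line t) / w)"
    unfolding zeta_crit deriv_zeta_crit w by simp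
  show ?thesis
  proof (cases "w = 0")
    case False
    have "kappa_phase t = (w - 2 * of_real (theta' t * xi_line t)) / w"
      unfolding kappa_phase_def q using False by (simp add: field_simps)
    also have "w - 2 * of_real (theta' t * xi_line t) = - cnj w"
      by (simp add: w_def complex_eq_iff)
    finally show ?thesis using False by simp
  qed (simp add: kappa_phase_def q)
qed

lemma norm_kappa_phase: "norm (kappa_phase t) = 1"
  unfolding kappa_phase_eq by (auto simp: norm_divide)

lemma kappa_phase_eq_1_iff: "kappa_phase t = 1 \<longleftrightarrow> theta' t = 0 \<or> xi_line t = 0"
proof -
  define w where "w = Complex (theta' t * xi_line t) (hardy' t)"
  have "kappa_phase t = 1 \<longleftrightarrow> w = 0 \<or> - cnj w = w"
    unfolding kappa_phase_eq w_def[symmetric] by (auto simp: field_simps neg_eq_iff_add_eq_0 eq_neg_iff_add_eq_0)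
  also have "\<dots> \<longleftrightarrow> theta' t * xi_line t = 0" by (auto simp: w_def complex_eq_iff)
  finally show ?thesis by simp
qed

text \<open>Writing the phase as \<open>- (cnj w)^2\<close> over the squared norm of
  \<open>w\<close>, the imaginary part is twice the product of the components of \<open>w\<close>
  over that norm.\<close>

lemma Im_kappa_phase_sign:
  "sgn (Im (kappa_phase t)) = sgn (theta' t * xi_line t * hardy' t)"
proof -
  define a where "a = theta' t * xi_line t"
  define M where "M = hardy' t"
  show ?thesis
  proof (cases "Complex a M = 0")
    case True
    then show ?thesis unfolding kappa_phase_eq a_def[symmetric] M_def[symmetric]
      by (simp add: complex_eq_iff)
  next
    case False
    then have p: "a\<^sup>2 + M\<^sup>2 > 0" by (simp add: complex_eq_iff sum_power2_gt_zero_iff)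
    have "Im (kappa_phase t) = (2 / (a\<^sup>2 + M\<^sup>2)) * (a * M)"
      unfolding kappa_phase_eq a_def[symmetric] M_def[symmetric] using False
      by (simp add: Im_divide power2_eq_square field_simps)
    then have "sgn (Im (kappa_phase t)) = sgn (2 / (a\<^sup>2 + M\<^sup>2)) * sgn (a * M)" by (simp only: sgn_mult)
    also have "sgn (2 / (a\<^sup>2 + M\<^sup>2)) = 1" using p by simp
    finally show ?thesis by (simp add: a_def M_def)
  qed
qed

section \<open>Parity, and signs up to the zero of theta'\<close>

lemma Digamma_quarter_uminus:
  "Re (Digamma (Complex (1/4) (- y))) = Re (Digamma (Complex (1/4) y))"
  "Im (Digamma (Complex (1/4) (- y))) = - Im (Digamma (Complex (1/4) y))"
  using LIMSEQ_unique[OF Digamma_quarter_LIMSEQ(1)[of "- y"]] Digamma_quarter_LIMSEQ(1)[of y]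
    LIMSEQ_unique[OF Digamma_quarter_LIMSEQ(2)[of "- y"]] tendsto_minus[OF Digamma_quarter_LIMSEQ(2)[of y]]
  by (simp_all add: sum_negf)

text \<open>Evenness carries the facts about \<open>t0\<close> over to negative \<open>t\<close>, as
  \<open>kappa\<close> lives on the whole line. Oddness of \<open>hardy'\<close> makes
  \<open>w\<close> real at 0, whence the phase -1 that fits the initial value -1/2.\<close>

lemma parity:
  "theta' (- t) = theta' t" "xi_line (- t) = xi_line t" "hardy' (- t) = - hardy' t"
proof -
  have c: "Complex (1/4) (- (t/2)) = cnj (Complex (1/4) (t/2))" by (simp add: complex_eq_iff)
  show th: "theta' (- t) = theta' t" unfolding theta'_def by (simp add: Digamma_quarter_uminus)
  show x: "xi_line (- t) = xi_line t" unfolding xi_line_def by (simp add: c half_mellin_cnj)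
  have "xi_line' (- t) = - xi_line' t" unfolding xi_line'_def by (simp add: c half_mellin_cnj)
  moreover have "gamma_decay (- t) = - gamma_decay t" unfolding gamma_decay_def by (simp add: Digamma_quarter_uminus)
  ultimately show "hardy' (- t) = - hardy' t" by (simp add: hardy'_def x)
qed

lemma hardy'_0: "hardy' 0 = 0"
  using parity(3)[of 0] by simp

text \<open>The integral part is at most about 0.0245, the subtracted rational part at least
  1/40.497, about 0.0247. The endpoint is twice 3.172, the upper bound for the crossing of
  \<open>ln pi\<close>.\<close>

lemma xi_line_neg:
  assumes "0 \<le> t" "t \<le> 6344/1000"
  shows "xi_line t < 0"
proof -
  have "t\<^sup>2 \<le> (6344/1000)\<^sup>2" using assms by (intro power_mono) auto
  then have D: "0 < 1/4 + t\<^sup>2" "1/4 + t\<^sup>2 \<le> 40497/1000" using zero_le_power2[of t] by (simp_all add: power2_eq_square add_pos_nonneg)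
  have "2 * Re (half_mellin (Complex (1/4) (t/2))) \<le> 2 * (exp (- pi) * (283/1000))"
    by (rule mult_left_mono[OF Re_half_mellin_quarter_le]) simp
  also have "\<dots> \<le> 2 * (10/231 * (283/1000))"
    using exp_pi_ge by (intro mult_left_mono mult_right_mono) (auto simp: exp_minus field_simps)
  also have "\<dots> < 1 / (40497/1000)" by simp
  also have "\<dots> \<le> 1 / (1/4 + t\<^sup>2)" using D by (intro divide_left_mono) auto
  finally show ?thesis by (simp add: xi_line_def)
qed

text \<open>The interval is twice the range of the crossing point, so it contains \<open>t0\<close>.
  Since \<open>xi_line\<close> is negative, a lower bound for \<open>gamma_decay\<close> gives an
  upper bound for \<open>hardy'\<close>, and only an elementary inequality in
  \<open>D = 1/4 + t^2\<close> remains.\<close>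

lemma hardy'_neg:
  assumes "622/100 \<le> t" "t \<le> 6344/1000"
  shows "hardy' t < 0"
proof -
  define D where "D = 1/4 + t\<^sup>2"
  define F where "F = half_mellin (Complex (1/4) (t/2))"
  define F' where "F' = half_mellin' (Complex (1/4) (t/2))"
  have t2: "(622/100)\<^sup>2 \<le> t\<^sup>2" using assms by (intro power_mono) auto
  have D: "D \<ge> 389/10" using t2 by (simp add: D_def power2_eq_square)
  have D2: "D \<le> 40497/1000"
    using power_mono[OF assms(2), of 2] assms by (simp add: D_def power2_eq_square)
  have q: "gamma_decay t \<ge> 81/100"
    unfolding gamma_decay_def using Im_Digamma_quarter_ge_numeric[of "t/2"] assms by simp
  have "162/100 * Re F - Im F' \<le> exp (- pi) * (279/1000)"
    unfolding F_def F'_def using assms by (intro kernel_integral_le) auto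
  also have "\<dots> \<le> 10/231 * (279/1000)"
    using exp_pi_ge by (intro mult_right_mono) (auto simp: exp_minus field_simps)
  finally have K: "162/100 * Re F - Im F' \<le> 12078/1000000" by simp
  have "gamma_decay t * xi_line t \<le> 81/100 * xi_line t"
    using q xi_line_neg[of t] assms by (intro mult_right_mono_neg) auto
  then have "hardy' t \<le> 2 * t / D\<^sup>2 - Im F' + 81/100 * (2 * Re F - 1 / D)"
    unfolding hardy'_def xi_line'_def F_def F'_def D_def xi_line_def by simp
  also have "\<dots> = 2 * t / D\<^sup>2 - 81/100 / D + (162/100 * Re F - Im F')" using D by (simp add: field_simps)
  also have "\<dots> \<le> 2 * t / D\<^sup>2 - 81/100 / D + 12078/1000000" using K by simp
  also have "\<dots> = (2 * t - D * (81/100 - 12078/1000000 * D)) / D\<^sup>2"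
    using D by (simp add: field_simps power2_eq_square)
  also have "\<dots> < 0"
  proof (rule divide_neg_pos)
    \<comment> \<open>0.3208 is just below \<open>0.81 - 0.012078 * D\<close> at the largest
      \<open>D\<close>. Since \<open>0.3208 * 6.22\<close> falls slightly short of 2, the summand
      1/4 of \<open>D\<close> has to make up the difference.\<close>
    have "2 * t < 3208/10000 * D"
    proof -
      have "0 \<le> (t - 622/100) * t" using assms by (intro mult_nonneg_nonneg) auto
      then have "t\<^sup>2 \<ge> 622/100 * t" by (simp add: power2_eq_square algebra_simps)
      then show ?thesis using assms by (simp add: D_def)
    qed
    also have "\<dots> \<le> (81/100 - 12078/1000000 * D) * D" using D D2 by (intro mult_right_mono) auto
    finally show "2 * t - D * (81/100 - 12078/1000000 * D) < 0" by (simp add: mult.commute)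
  qed (use D in simp)
  finally show ?thesis .
qed

lemma theta'_sign_change:
  obtains t0 where "0 < t0" "theta' t0 = 0" "\<And>t. 0 \<le> t \<Longrightarrow> t < t0 \<Longrightarrow> theta' t < 0"
    "\<And>t. t0 < t \<Longrightarrow> theta' t > 0" "\<And>t. 0 \<le> t \<Longrightarrow> t \<le> t0 \<Longrightarrow> xi_line t < 0" "hardy' t0 < 0"
proof -
  obtain y0 where y0: "(311/100) \<le> y0" "y0 \<le> 3172/1000" "Re (Digamma (Complex (1/4) y0)) = ln pi"
    and lo: "\<And>y. 0 \<le> y \<Longrightarrow> y < y0 \<Longrightarrow> Re (Digamma (Complex (1/4) y)) < ln pi"
    and hi: "\<And>y. y0 < y \<Longrightarrow> ln pi < Re (Digamma (Complex (1/4) y))"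
    using Re_Digamma_quarter_crosses_ln_pi by blast
  show ?thesis
  proof (rule that[of "2 * y0"])
    show "theta' t < 0" if "0 \<le> t" "t < 2 * y0" for t using lo[of "t/2"] that by (simp add: theta'_def)
    show "theta' t > 0" if "2 * y0 < t" for t using hi[of "t/2"] that by (simp add: theta'_def)
    show "xi_line t < 0" if "0 \<le> t" "t \<le> 2 * y0" for t using xi_line_neg[of t] that y0 by simp
    show "hardy' (2 * y0) < 0" using hardy'_neg[of "2 * y0"] y0 by simp
  qed (use y0 in \<open>simp_all add: theta'_def\<close>)
qed

text \<open>Both components of \<open>w\<close> vanish. If the first did so through
  \<open>theta'\<close>, then \<open>\<bar>t\<bar>\<close> would be \<open>t0\<close>, where
  \<open>hardy'\<close> is negative; so it vanishes through \<open>xi_line\<close>.\<close>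

lemma deriv_zeta_crit_eq_0_imp:
  assumes "deriv zeta (crit t) = 0"
  shows "zeta (crit t) = 0"
proof -
  obtain t0 where t0: "0 < t0" "theta' t0 = 0" "\<And>t. 0 \<le> t \<Longrightarrow> t < t0 \<Longrightarrow> theta' t < 0"
    "\<And>t. t0 < t \<Longrightarrow> theta' t > 0" "hardy' t0 < 0"
    using theta'_sign_change by metis
  have "complex_of_real (theta' t * xi_line t) + \<i> * of_real (hardy' t) = 0"
    using assms unfolding deriv_zeta_crit by (simp del: of_real_mult)
  then have h: "theta' t * xi_line t = 0" "hardy' t = 0" by (auto simp: complex_eq_iff)
  have "theta' t \<noteq> 0"
  proof
    assume th: "theta' t = 0"
    have "theta' \<bar>t\<bar> = 0" "hardy' \<bar>t\<bar> = 0" using th h parity[of t] by (auto simp: abs_if)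
    moreover have "\<bar>t\<bar> = t0" using t0(3)[of "\<bar>t\<bar>"] t0(4)[of "\<bar>t\<bar>"] \<open>theta' \<bar>t\<bar> = 0\<close> by (cases "\<bar>t\<bar>" t0 rule: linorder_cases) auto
    ultimately show False using t0(5) by simp
  qed
  then show ?thesis using h by (simp add: zeta_crit_eq_0_iff)
qed

section \<open>Existence of the theta and kappa functions\<close>

text \<open>The difference takes values in the multiples of \<open>2 * pi / c\<close>, a discrete
  set. This serves the uniqueness of both functions and the comparison of a global continuous lift
  with local holomorphic logarithms.\<close>

lemma continuous_lift_unique:
  fixes f g :: "real \<Rightarrow> real"
  assumes S: "connected S" and cont: "continuous_on S f" "continuous_on S g" and c: "c > 0"
    and eq: "\<And>t. t \<in> S \<Longrightarrow> exp (\<i> * of_real (c * f t)) = exp (\<i> * of_real (c * g t))"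
  obtains C where "\<And>t. t \<in> S \<Longrightarrow> f t = g t + C"
proof -
  have int: "\<exists>n::int. c * (f t - g t) = 2 * pi * of_int n" if t: "t \<in> S" for t
  proof -
    obtain n :: int where "\<i> * of_real (c * f t) = \<i> * of_real (c * g t) + (of_int (2 * n) * pi) * \<i>"
      using eq[OF t] exp_eq by blast
    then have "c * f t = c * g t + 2 * of_int n * pi"
      by (simp add: complex_eq_iff)
    then show ?thesis by (intro exI[of _ n]) (simp add: algebra_simps)
  qed
  have "(\<lambda>t. f t - g t) constant_on S"
  proof (rule continuous_discrete_range_constant[OF S])
    show "continuous_on S (\<lambda>t. f t - g t)" using cont by (intro continuous_intros)
    fix x assume x: "x \<in> S"
    show "\<exists>e>0. \<forall>y. y \<in> S \<and> f y - g y \<noteq> f x - g x \<longrightarrow> e \<le> norm (f y - g y - (f x - g x))"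
    proof (intro exI[of _ "2 * pi / c"] conjI allI impI)
      fix y assume y: "y \<in> S \<and> f y - g y \<noteq> f x - g x"
      obtain m n :: int where m: "c * (f x - g x) = 2 * pi * of_int m" and n: "c * (f y - g y) = 2 * pi * of_int n"
        using int x y by meson
      have d: "f y - g y - (f x - g x) = (2 * pi / c) * of_int (n - m)"
        using m n c by (simp add: field_simps)
      have "n \<noteq> m" using y d by auto
      then have "1 \<le> \<bar>real_of_int (n - m)\<bar>" by linarith
      then have "(2 * pi / c) * 1 \<le> (2 * pi / c) * \<bar>real_of_int (n - m)\<bar>" using c by (intro mult_left_mono) auto
      then show "2 * pi / c \<le> norm (f y - g y - (f x - g x))" unfolding d using c by (simp add: abs_mult)
    qed (use c in simp)
  qed
  then obtain C where "\<And>t. t \<in> S \<Longrightarrow> f t - g t = C" by (auto simp: constant_on_def)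
  then show ?thesis by (intro that[of C]) (simp add: algebra_simps)
qed

lemma real_analytic_if_holomorphic:
  assumes "\<And>x. \<exists>r>0. \<exists>h. h holomorphic_on ball (of_real x) r \<and> (\<forall>y. \<bar>y - x\<bar> < r \<longrightarrow> f y = Re (h (of_real y)))"
  shows "real_analytic f"
  unfolding real_analytic_def
proof
  fix x
  obtain r h where r: "r > 0" and h: "h holomorphic_on ball (of_real x) r"
    and f: "\<And>y. \<bar>y - x\<bar> < r \<Longrightarrow> f y = Re (h (of_real y))" using assms by blast
  define a where "a = (\<lambda>k. (deriv ^^ k) h (of_real x) / fact k)"
  have "(\<lambda>k. Re (a k) * (y - x) ^ k) sums f y" if y: "\<bar>y - x\<bar> < r" for y
  proof -
    have "of_real y \<in> ball (of_real x :: complex) r"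
      using y by (simp add: dist_norm norm_minus_commute flip: of_real_diff)
    from holomorphic_power_series[OF h this]
    have "(\<lambda>k. a k * of_real ((y - x) ^ k)) sums h (of_real y)" by (simp add: a_def)
    then have "(\<lambda>k. Re (a k * of_real ((y - x) ^ k))) sums Re (h (of_real y))" by (rule sums_Re)
    then show ?thesis unfolding f[OF y] by (simp del: of_real_power)
  qed
  then show "\<exists>r>0. \<exists>a. \<forall>y. \<bar>y - x\<bar> < r \<longrightarrow> (\<lambda>k. a k * (y - x) ^ k) sums f y"
    using r by (intro exI[of _ r] conjI exI[of _ "\<lambda>k. Re (a k)"]) auto
qed

lemma real_analytic_imp_continuous:
  assumes "real_analytic f"
  shows "continuous_on A f"
proof (intro continuous_at_imp_continuous_on ballI)
  fix x
  obtain r a where r: "r > 0" and a: "\<And>y. \<bar>y - x\<bar> < r \<Longrightarrow> (\<lambda>k. a k * (y - x) ^ k) sums f y"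
    using assms unfolding real_analytic_def by metis
  have "summable (\<lambda>k. a k * (r / 2) ^ k)" using a[of "x + r / 2"] r by (auto simp: sums_iff)
  then have "isCont (\<lambda>z. \<Sum>k. a k * z ^ k) 0" by (rule isCont_powser) (use r in simp)
  then have c: "isCont (\<lambda>y. \<Sum>k. a k * (y - x) ^ k) x"
    by (intro isCont_o2[where g = "\<lambda>z. \<Sum>k. a k * z ^ k" and f = "\<lambda>y. y - x"]) (auto intro!: continuous_intros)
  have "eventually (\<lambda>y. (\<Sum>k. a k * (y - x) ^ k) = f y) (nhds x)"
    unfolding eventually_nhds_metric using a r by (intro exI[of _ r]) (auto simp: dist_real_def sums_iff)
  with c show "isCont f x" by (subst (asm) isCont_cong) auto
qed

lemma holomorphic_along_crit:
  assumes "\<And>s. Re s > 0 \<Longrightarrow> (g has_field_derivative g' s) (at s)"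
  shows "(\<lambda>z. g (1/2 + \<i> * z)) holomorphic_on {z. \<bar>Im z\<bar> < 1/2}"
proof -
  have "g holomorphic_on {s. Re s > 0}"
    using assms by (auto simp: holomorphic_on_open open_halfspace_Re_gt)
  then have "(g \<circ> (\<lambda>z. 1/2 + \<i> * z)) holomorphic_on {z. \<bar>Im z\<bar> < 1/2}"
    by (intro holomorphic_on_compose_gen[where t = "{s. Re s > 0}"]) (auto intro!: holomorphic_intros)
  then show ?thesis by (simp add: o_def)
qed

lemma ball_subset_strip: "r \<le> 1/2 \<Longrightarrow> ball (of_real x) r \<subseteq> {z. \<bar>Im z\<bar> < 1/2}"
proof
  fix z :: complex assume r: "r \<le> 1/2" and z: "z \<in> ball (of_real x) r"
  have "\<bar>Im z\<bar> = \<bar>Im (z - of_real x)\<bar>" by simp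
  also have "\<dots> \<le> norm (z - of_real x)" by (rule abs_Im_le_cmod)
  also have "\<dots> < 1/2" using z r by (simp add: dist_norm norm_minus_commute)
  finally show "z \<in> {z. \<bar>Im z\<bar> < 1/2}" by simp
qed

text \<open>\<open>ln_Gamma\<close> is an analytic logarithm along the line and real at 1/4, so its
  imaginary part minus \<open>t / 2 * ln pi\<close> is the lift that vanishes at 0.\<close>

lemma rs_theta_eq: "rs_theta = (\<lambda>t. Im (log_gamma_factor (crit t)))"
proof -
  let ?f = "\<lambda>t. Im (log_gamma_factor (crit t))"
  define P where "P = (\<lambda>f. real_analytic f \<and> f 0 = 0 \<and>
     (\<forall>t. Gamma (1/4 + \<i> * of_real t / 2) = of_real (norm (Gamma (1/4 + \<i> * of_real t / 2))) *
        exp (\<i> * of_real (f t + t / 2 * ln pi))))"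
  have z: "1/4 + \<i> * of_real t / 2 = crit t / 2" for t by simp
  have G: "Gamma (crit t / 2) = of_real (norm (Gamma (crit t / 2))) * exp (\<i> * of_real (?f t + t / 2 * ln pi))" for t
  proof -
    have "crit t / 2 \<notin> \<int>\<^sub>\<le>\<^sub>0" using half_notin_nonpos_Reals[of "crit t"] nonpos_Ints_subset_nonpos_Reals by auto
    then have g: "Gamma (crit t / 2) = exp (ln_Gamma (crit t / 2))" by (simp add: Gamma_complex_altdef)
    have "?f t + t / 2 * ln pi = Im (ln_Gamma (crit t / 2))" by (simp add: log_gamma_factor_def)
    then show ?thesis unfolding g norm_exp_eq_Re
      by (simp only: exp_of_real[symmetric] exp_add[symmetric]) (simp add: complex_eq_iff flip: complex_eq)
  qed
  have "P ?f"
    unfolding P_def z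
  proof (intro conjI allI G)
    show "real_analytic ?f"
    proof (rule real_analytic_if_holomorphic)
      fix x :: real
      have "(\<lambda>z. - \<i> * log_gamma_factor (1/2 + \<i> * z)) holomorphic_on ball (of_real x) (1/2)"
        using holomorphic_on_subset[OF holomorphic_along_crit[OF log_gamma_factor_has_derivative] ball_subset_strip[of "1/2" x]]
        by (intro holomorphic_intros) auto
      then show "\<exists>r>0. \<exists>h. h holomorphic_on ball (of_real x) r \<and> (\<forall>y. \<bar>y - x\<bar> < r \<longrightarrow> ?f y = Re (h (of_real y)))"
        by (intro exI[of _ "1/2"] conjI exI[of _ "\<lambda>z. - \<i> * log_gamma_factor (1/2 + \<i> * z)"]) auto
    qed
    have "ln_Gamma (1 / 4 :: complex) = of_real (ln_Gamma (1/4))" using ln_Gamma_complex_of_real[of "1/4"] by simp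
    then show "?f 0 = 0" by (simp add: log_gamma_factor_def)
  qed
  moreover have "f = ?f" if f: "P f" for f
  proof -
    have e: "exp (\<i> * of_real (1 * f t)) = exp (\<i> * of_real (1 * ?f t))" for t
    proof -
      have "crit t / 2 \<notin> \<int>\<^sub>\<le>\<^sub>0" using half_notin_nonpos_Reals[of "crit t"] nonpos_Ints_subset_nonpos_Reals by auto
      then have "complex_of_real (norm (Gamma (crit t / 2))) \<noteq> 0" by (simp add: Gamma_eq_zero_iff)
      moreover have "of_real (norm (Gamma (crit t / 2))) * exp (\<i> * of_real (f t + t / 2 * ln pi)) =
         of_real (norm (Gamma (crit t / 2))) * exp (\<i> * of_real (?f t + t / 2 * ln pi))"
        using f G[of t] unfolding P_def z by metis
      ultimately have "exp (\<i> * of_real (f t + t / 2 * ln pi)) = exp (\<i> * of_real (?f t + t / 2 * ln pi))"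
        by simp
      then show ?thesis by (simp only: of_real_add ring_distribs exp_add mult_1) simp
    qed
    obtain C where C: "\<And>t. t \<in> UNIV \<Longrightarrow> f t = ?f t + C"
      by (rule continuous_lift_unique[where S = UNIV and f = f and g = ?f and c = 1])
         (use e f \<open>P ?f\<close> in \<open>auto simp: P_def intro: real_analytic_imp_continuous\<close>)
    have "C = 0" using C[of 0] f \<open>P ?f\<close> unfolding P_def by simp
    then show ?thesis using C by auto
  qed
  ultimately have "(THE f. P f) = ?f" by (rule the_equality)
  then show ?thesis unfolding rs_theta_def P_def .
qed

lemma deriv_rs_theta: "deriv rs_theta t = theta' t"
proof -
  have "((\<lambda>t. Im (log_gamma_factor (crit t))) has_real_derivative Im (\<i> * log_gamma_factor' (crit t))) (at t)"
    by (intro has_real_derivative_along_crit log_gamma_factor_has_derivative) simp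
  then show ?thesis unfolding rs_theta_eq log_gamma_factor'_crit by (intro DERIV_imp_deriv) simp
qed

text \<open>At a zero of order \<open>n\<close>, zeta is \<open>(w - s)^n * g\<close> and its
  derivative is \<open>(w - s)^(n - 1) * k\<close> with \<open>k s = n * g s\<close> nonzero. The
  quotient is thus \<open>(w - s) * g / k\<close>, with value 0 at \<open>s\<close> as division by
  zero also gives.\<close>

lemma holomorphic_zeta_quotient:
  obtains r where "r > 0" "(\<lambda>w. zeta w / deriv zeta w) holomorphic_on ball (crit x) r"
proof -
  let ?s = "crit x"
  have s1: "?s \<in> - {1}" by (simp add: complex_eq_iff)
  have hd: "deriv zeta holomorphic_on - {1}" by (intro holomorphic_deriv holomorphic_zeta) auto
  obtain r0 where r0: "r0 > 0" "ball ?s r0 \<subseteq> - {1}"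
    using openE[of "- {1}" ?s] s1 by auto
  show ?thesis
  proof (cases "deriv zeta ?s = 0")
    case False
    have "continuous_on (ball ?s r0) (deriv zeta)"
      using holomorphic_on_subset[OF hd r0(2)] by (rule holomorphic_on_imp_continuous_on)
    then have "isCont (deriv zeta) ?s" using r0(1) by (simp add: continuous_on_eq_continuous_at)
    then obtain e where e: "e > 0" "\<And>w. dist ?s w < e \<Longrightarrow> deriv zeta w \<noteq> 0"
      using continuous_at_avoid[of ?s "deriv zeta" 0] False by (auto simp: dist_commute)
    have sub: "ball ?s (min r0 e) \<subseteq> - {1}" using r0(2) by auto
    have "(\<lambda>w. zeta w / deriv zeta w) holomorphic_on ball ?s (min r0 e)"
      using e(2) by (intro holomorphic_on_divide holomorphic_on_subset[OF holomorphic_zeta sub] holomorphic_on_subset[OF hd sub]) auto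
    then show ?thesis using r0(1) e(1) by (intro that[of "min r0 e"]) auto
  next
    case True
    then have z0: "zeta ?s = 0" by (rule deriv_zeta_crit_eq_0_imp)
    have nc: "\<not> zeta constant_on - {1}"
    proof
      assume "zeta constant_on - {1}"
      then obtain c where c: "\<And>w. w \<in> - {1} \<Longrightarrow> zeta w = c" by (auto simp: constant_on_def)
      have "zeta (crit 0) = zeta ?s" using c[of "crit 0"] c[OF s1] by (simp add: complex_eq_iff)
      then have "xi_line 0 = 0" using z0 zeta_crit_eq_0_iff[of 0] by simp
      then show False using xi_line_neg[of 0] by simp
    qed
    have op: "open (- {1::complex})" by auto
    have conn: "connected (- {1::complex})" by (rule connected_punctured_universe) simp
    obtain g r n where n: "0 < n" and r: "0 < r" "ball ?s r \<subseteq> - {1}" and g: "g holomorphic_on ball ?s r"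
      and fac: "\<And>w. w \<in> ball ?s r \<Longrightarrow> zeta w = (w - ?s) ^ n * g w" and gn: "\<And>w. w \<in> ball ?s r \<Longrightarrow> g w \<noteq> 0"
      by (rule holomorphic_factor_zero_nonconstant[OF holomorphic_zeta op conn s1 z0 nc]) (rule that)
    define k where "k = (\<lambda>w. of_nat n * g w + (w - ?s) * deriv g w)"
    have gd: "deriv g holomorphic_on ball ?s r" by (intro holomorphic_deriv g) auto
    have kh: "k holomorphic_on ball ?s r" unfolding k_def by (intro holomorphic_intros g gd)
    have "isCont k ?s"
      using holomorphic_on_imp_continuous_on[OF kh] r(1) by (simp add: continuous_on_eq_continuous_at)
    moreover have "k ?s \<noteq> 0" using n gn[of ?s] r(1) by (simp add: k_def)
    ultimately obtain e where e: "e > 0" "\<And>w. dist ?s w < e \<Longrightarrow> k w \<noteq> 0"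
      using continuous_at_avoid[of ?s k 0] by (auto simp: dist_commute)
    define R where "R = min r e"
    have sub: "ball ?s R \<subseteq> ball ?s r" by (auto simp: R_def)
    have dz: "deriv zeta w = (w - ?s) ^ (n - 1) * k w" if w: "w \<in> ball ?s r" for w
    proof -
      have gw: "(g has_field_derivative deriv g w) (at w)"
        using g w by (intro holomorphic_derivI) auto
      have "((\<lambda>w. (w - ?s) ^ n * g w) has_field_derivative (of_nat n * (w - ?s) ^ (n - 1) * g w + (w - ?s) ^ n * deriv g w)) (at w)"
        by (rule derivative_eq_intros gw refl)+ simp
      then have "(zeta has_field_derivative (of_nat n * (w - ?s) ^ (n - 1) * g w + (w - ?s) ^ n * deriv g w)) (at w)"
        by (rule has_field_derivative_transform_within_open[where S = "ball ?s r"]) (use w fac in auto)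
      then have "deriv zeta w = of_nat n * (w - ?s) ^ (n - 1) * g w + (w - ?s) ^ n * deriv g w"
        by (rule DERIV_imp_deriv)
      also have "(w - ?s) ^ n = (w - ?s) ^ (n - 1) * (w - ?s)" using n by (cases n) auto
      finally show ?thesis by (simp add: k_def algebra_simps)
    qed
    have "(\<lambda>w. (w - ?s) * g w / k w) holomorphic_on ball ?s R"
      using e(2) by (intro holomorphic_intros holomorphic_on_subset[OF g sub] holomorphic_on_subset[OF kh sub]) (auto simp: R_def)
    moreover have "(w - ?s) * g w / k w = zeta w / deriv zeta w" if "w \<in> ball ?s R" for w
    proof (cases "w = ?s")
      case False
      have "w \<in> ball ?s r" using that sub by auto
      then have "zeta w / deriv zeta w = ((w - ?s) ^ (n - 1) * ((w - ?s) * g w)) / ((w - ?s) ^ (n - 1) * k w)"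
        using n fac dz by (cases n) (auto simp: mult_ac)
      then show ?thesis using False by simp
    qed (use z0 in simp)
    ultimately have "(\<lambda>w. zeta w / deriv zeta w) holomorphic_on ball ?s R"
      by (rule holomorphic_transform)
    then show ?thesis using r(1) e(1) by (intro that[of R]) (auto simp: R_def)
  qed
qed

text \<open>On the real axis \<open>theta'\<close> is only the real part of the holomorphic
  \<open>f\<close>. Averaging \<open>f\<close> with its reflection
  \<open>cnj \<circ> f \<circ> cnj\<close> extends it holomorphically to the strip.\<close>

lemma kappa_phase_locally_holomorphic:
  obtains r h where "r > 0" "h holomorphic_on ball (of_real x) r"
    "\<And>y. \<bar>y - x\<bar> < r \<Longrightarrow> kappa_phase y = h (of_real y)"
proof -
  let ?S = "{z. \<bar>Im z\<bar> < 1/2}"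
  define f where "f = (\<lambda>z. log_gamma_factor' (1/2 + \<i> * z))"
  have "log_gamma_factor' holomorphic_on {s. Re s > 0}"
    unfolding log_gamma_factor'_def
    by (intro holomorphic_intros holomorphic_on_compose_gen[where g = Digamma and f = "\<lambda>s. s/2" and t = "{s. Re s > 0}", unfolded o_def])
       (auto elim!: nonpos_Ints_cases)
  then have "(log_gamma_factor' has_field_derivative deriv log_gamma_factor' s) (at s)" if "Re s > 0" for s
    using that by (intro holomorphic_derivI) (auto simp: open_halfspace_Re_gt)
  then have f: "f holomorphic_on ?S"
    unfolding f_def by (rule holomorphic_along_crit)
  have Sopen: "open ?S"
  proof -
    have eq: "?S = {z. Im z < 1/2} \<inter> {z. Im z > - 1/2}" by auto
    show ?thesis unfolding eq by (intro open_Int open_halfspace_Im_lt open_halfspace_Im_gt)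
  qed
  have "cnj ` ?S = ?S" by (auto simp: image_cnj_conv_vimage_cnj)
  then have fc: "(cnj \<circ> f \<circ> cnj) holomorphic_on ?S"
    using holomorphic_on_compose_cnj_cnj[of f ?S] f Sopen by simp
  obtain r where r: "r > 0" and q: "(\<lambda>w. zeta w / deriv zeta w) holomorphic_on ball (crit x) r"
    by (rule holomorphic_zeta_quotient)
  define R where "R = min r (1/2)"
  have sub: "ball (of_real x) R \<subseteq> ?S" by (rule ball_subset_strip) (simp add: R_def)
  have qc: "(\<lambda>z. zeta (1/2 + \<i> * z) / deriv zeta (1/2 + \<i> * z)) holomorphic_on ball (of_real x) R"
  proof -
    have "(\<lambda>z. 1/2 + \<i> * z) ` ball (of_real x) R \<subseteq> ball (crit x) r"
      by (auto simp: R_def dist_norm norm_mult simp flip: right_diff_distrib)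
    then have "((\<lambda>w. zeta w / deriv zeta w) \<circ> (\<lambda>z. 1/2 + \<i> * z)) holomorphic_on ball (of_real x) R"
      by (intro holomorphic_on_compose_gen[OF _ q]) (auto intro!: holomorphic_intros)
    then show ?thesis by (simp add: o_def)
  qed
  define h where "h = (\<lambda>z. 1 + 2 * ((f z + (cnj \<circ> f \<circ> cnj) z) / 2) * (zeta (1/2 + \<i> * z) / deriv zeta (1/2 + \<i> * z)))"
  show ?thesis
  proof (rule that[of R h])
    show "h holomorphic_on ball (of_real x) R"
      unfolding h_def by (intro holomorphic_intros holomorphic_on_subset[OF f sub] holomorphic_on_subset[OF fc sub] qc) auto
    show "kappa_phase y = h (of_real y)" if "\<bar>y - x\<bar> < R" for y
    proof -
      have "(f (of_real y) + (cnj \<circ> f \<circ> cnj) (of_real y)) / 2 = of_real (theta' y)"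
        by (simp add: f_def log_gamma_factor'_crit complex_eq_iff)
      then show ?thesis unfolding h_def kappa_phase_def by simp
    qed
  qed (use r in \<open>auto simp: R_def\<close>)
qed

lemma isCont_kappa_phase: "isCont kappa_phase x"
proof -
  obtain r h where r: "r > 0" and h: "h holomorphic_on ball (of_real x) r"
    and k: "\<And>y. \<bar>y - x\<bar> < r \<Longrightarrow> kappa_phase y = h (of_real y)"
    by (rule kappa_phase_locally_holomorphic[of x]) (rule that)
  have "isCont h (of_real x)"
    using holomorphic_on_imp_continuous_on[OF h] r by (simp add: continuous_on_eq_continuous_at)
  then have "isCont (\<lambda>y. h (of_real y)) x"
    by (intro isCont_o2[where g = h and f = of_real]) (auto intro!: continuous_intros)
  moreover have "eventually (\<lambda>y. h (of_real y) = kappa_phase y) (nhds x)"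
    unfolding eventually_nhds_metric using r k by (intro exI[of _ r]) (auto simp: dist_real_def)
  ultimately show ?thesis by (subst (asm) isCont_cong) auto
qed

lemma kappa_phase_0: "kappa_phase 0 = -1"
proof -
  have "theta' 0 \<noteq> 0" "xi_line 0 \<noteq> 0"
    using theta'_sign_change xi_line_neg[of 0] by (metis order_less_irrefl order_refl, simp)
  moreover define w where "w = Complex (theta' 0 * xi_line 0) 0"
  ultimately have "cnj w = w" "w \<noteq> 0" by (auto simp: complex_eq_iff)
  then show ?thesis unfolding kappa_phase_eq hardy'_0 w_def[symmetric] by simp
qed

text \<open>A nowhere vanishing continuous phase on the line has a continuous logarithm, purely
  imaginary as the norm is 1. Analyticity is local: near each point the holomorphic extension of the
  phase has a holomorphic logarithm, from which the continuous lift differs by a constant.\<close>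

theorem kappa_properties:
  shows continuous_kappa: "continuous_on UNIV kappa" and kappa_0: "kappa 0 = - 1/2"
    and exp_kappa: "exp (2 * of_real pi * \<i> * of_real (kappa t)) = kappa_phase t"
proof -
  define P where "P = (\<lambda>f. real_analytic f \<and> f 0 = - 1/2 \<and>
     (\<forall>t. exp (2 * of_real pi * \<i> * of_real (f t)) = kappa_phase t))"
  have e2: "exp (\<i> * of_real (2 * pi * v)) = exp (2 * of_real pi * \<i> * of_real v)" for v
    by (simp add: mult_ac)
  have nz: "kappa_phase t \<noteq> 0" for t using norm_kappa_phase[of t] by auto
  obtain g where g: "continuous_on UNIV g" "\<And>t. kappa_phase t = exp (g t)"
    using continuous_logarithm_on_contractible[of UNIV kappa_phase]
    by (metis UNIV_I continuous_at_imp_continuous_on isCont_kappa_phase nz contractible_UNIV)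
  have Reg: "Re (g t) = 0" for t
    using norm_kappa_phase[of t] unfolding g(2) norm_exp_eq_Re by simp
  \<comment> \<open>The shift by 1/2 reflects that the phase is -1 at 0.\<close>
  define f where "f = (\<lambda>t. (Im (g t) - Im (g 0)) / (2 * pi) - 1/2)"
  have fcont: "continuous_on A f" for A
    unfolding f_def using continuous_on_subset[OF g(1)] by (intro continuous_intros) auto
  have fexp: "exp (2 * of_real pi * \<i> * of_real (f t)) = kappa_phase t" for t
  proof -
    have gI: "\<i> * of_real (Im (g t)) = g t" for t using Reg[of t] by (simp add: complex_eq_iff)
    have "2 * pi * f t = Im (g t) - Im (g 0) - pi" by (simp add: f_def field_simps)
    then have "2 * of_real pi * \<i> * of_real (f t) = \<i> * of_real (Im (g t) - Im (g 0) - pi)"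
      by (metis (no_types, lifting) mult.assoc mult.commute of_real_mult of_real_numeral)
    also have "\<dots> = g t - g 0 - \<i> * of_real pi"
      by (simp only: of_real_diff right_diff_distrib gI)
    finally have "exp (2 * of_real pi * \<i> * of_real (f t)) = kappa_phase t / kappa_phase 0 / exp (\<i> * of_real pi)"
      by (simp only: exp_diff g(2))
    then show ?thesis by (simp add: kappa_phase_0)
  qed
  have "real_analytic f"
  proof (rule real_analytic_if_holomorphic)
    fix x
    obtain r h where r: "r > 0" and h: "h holomorphic_on ball (of_real x) r"
      and k: "\<And>y. \<bar>y - x\<bar> < r \<Longrightarrow> kappa_phase y = h (of_real y)"
      by (rule kappa_phase_locally_holomorphic[of x]) (rule that)
    have "isCont h (of_real x)"
      using holomorphic_on_imp_continuous_on[OF h] r by (simp add: continuous_on_eq_continuous_at)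
    moreover have "h (of_real x) \<noteq> 0" using k[of x] r nz[of x] by simp
    ultimately obtain e where e: "e > 0" "\<And>w. dist (of_real x) w < e \<Longrightarrow> h w \<noteq> 0"
      using continuous_at_avoid[of "of_real x" h 0] by (auto simp: dist_commute)
    define R where "R = min r e"
    have sub: "ball (of_real x :: complex) R \<subseteq> ball (of_real x) r" by (auto simp: R_def)
    obtain l where l: "l holomorphic_on ball (of_real x) R" "\<And>w. w \<in> ball (of_real x) R \<Longrightarrow> h w = exp (l w)"
      using contractible_imp_holomorphic_log[OF holomorphic_on_subset[OF h sub] convex_imp_contractible[OF convex_ball]] e(2)
      by (auto simp: R_def)
    let ?J = "{x - R<..<x + R}"
    have inb: "of_real y \<in> ball (of_real x :: complex) R" if "y \<in> ?J" for y
      using that by (auto simp: dist_norm simp flip: of_real_diff)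
    have ql: "kappa_phase y = exp (l (of_real y))" if "y \<in> ?J" for y
      using k[of y] l(2)[OF inb[OF that]] that by (auto simp: R_def)
    have lcont: "continuous_on ?J (\<lambda>y. Im (l (of_real y)) / (2 * pi))"
      using inb by (intro continuous_intros continuous_on_compose2[OF holomorphic_on_imp_continuous_on[OF l(1)]]) auto
    have eqe: "exp (\<i> * of_real (2 * pi * f y)) = exp (\<i> * of_real (2 * pi * (Im (l (of_real y)) / (2 * pi))))" if y: "y \<in> ?J" for y
    proof -
      have "Re (l (of_real y)) = 0" using norm_kappa_phase[of y] unfolding ql[OF y] norm_exp_eq_Re by simp
      then have "\<i> * of_real (2 * pi * (Im (l (of_real y)) / (2 * pi))) = l (of_real y)" by (simp add: complex_eq_iff)
      moreover have "exp (\<i> * of_real (2 * pi * f y)) = exp (l (of_real y))"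
        unfolding e2 fexp by (rule ql[OF y])
      ultimately show ?thesis by simp
    qed
    obtain C where C: "\<And>y. y \<in> ?J \<Longrightarrow> f y = Im (l (of_real y)) / (2 * pi) + C"
      by (rule continuous_lift_unique[OF connected_Ioo fcont lcont _ eqe]) auto
    have "(\<lambda>w. - \<i> * l w / (2 * of_real pi) + of_real C) holomorphic_on ball (of_real x) R"
      by (intro holomorphic_intros l(1)) auto
    moreover have "f y = Re (- \<i> * l (of_real y) / (2 * of_real pi) + of_real C)" if "\<bar>y - x\<bar> < R" for y
    proof -
      have "Re (- \<i> * l (of_real y) / of_real (2 * pi)) = Im (l (of_real y)) / (2 * pi)"
        by (subst Re_divide_of_real) simp
      moreover have "y \<in> ?J" using that by (auto simp: abs_less_iff)
      ultimately show ?thesis using C[of y] by simp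
    qed
    ultimately show "\<exists>r>0. \<exists>h. h holomorphic_on ball (of_real x) r \<and> (\<forall>y. \<bar>y - x\<bar> < r \<longrightarrow> f y = Re (h (of_real y)))"
      using r e(1) by (intro exI[of _ R] conjI exI[of _ "\<lambda>w. - \<i> * l w / (2 * of_real pi) + of_real C"]) (auto simp: R_def)
  qed
  then have "P f" using fexp by (auto simp: P_def f_def)
  moreover have "f' = f" if f': "P f'" for f'
  proof -
    have e: "exp (\<i> * of_real (2 * pi * f' t)) = exp (\<i> * of_real (2 * pi * f t))" for t
      unfolding e2 fexp using f' by (simp add: P_def)
    obtain C where C: "\<And>t. t \<in> UNIV \<Longrightarrow> f' t = f t + C"
      by (rule continuous_lift_unique[OF connected_UNIV real_analytic_imp_continuous fcont _ e]) (use f' in \<open>auto simp: P_def\<close>)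
    have "C = 0" using C[of 0] f' \<open>P f\<close> unfolding P_def by simp
    then show ?thesis using C by auto
  qed
  ultimately have "(THE f. P f) = f" by (rule the_equality)
  then have "kappa = f" unfolding kappa_def P_def deriv_rs_theta kappa_phase_def .
  then show "continuous_on UNIV kappa" "kappa 0 = - 1/2" "exp (2 * of_real pi * \<i> * of_real (kappa t)) = kappa_phase t"
    using fcont fexp \<open>P f\<close> by (auto simp: P_def)
qed

section \<open>Crossings of integers by kappa\<close>

lemma cis_kappa: "kappa_phase t = cis (2 * pi * kappa t)"
  using exp_kappa[of t] by (simp add: cis_conv_exp mult_ac)

lemma kappa_integer_iff: "kappa t \<in> \<int> \<longleftrightarrow> theta' t = 0 \<or> xi_line t = 0"
proof -
  have "kappa_phase t = 1 \<longleftrightarrow> (\<exists>n::int. 2 * pi * kappa t = of_int (2 * n) * pi)"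
    unfolding cis_kappa cis_conv_exp exp_eq_1 by simp
  also have "\<dots> \<longleftrightarrow> kappa t \<in> \<int>" by (auto simp: Ints_def image_iff)
  finally show ?thesis using kappa_phase_eq_1_iff by simp
qed

lemma sgn_sin_kappa: "sgn (sin (2 * pi * kappa t)) = sgn (theta' t * (xi_line t * hardy' t))"
  using Im_kappa_phase_sign[of t] unfolding cis_kappa by (simp add: mult.assoc)

lemma continuous_avoiding_integers:
  fixes f :: "real \<Rightarrow> real" and k :: int
  assumes J: "connected J" and cont: "continuous_on J f" and avoid: "\<And>t. t \<in> J \<Longrightarrow> f t \<notin> \<int>"
    and s: "s \<in> J" "of_int k < f s" "f s < of_int (k + 1)" and t: "t \<in> J"
  shows "of_int k < f t" "f t < of_int (k + 1)"
proof -
  have img: "connected (f ` J)" using cont J by (rule connected_continuous_image)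
  show "of_int k < f t"
  proof (rule ccontr)
    assume "\<not> of_int k < f t"
    then have "of_int k \<in> f ` J"
      using connectedD_interval[OF img, of "f t" "f s" "of_int k"] s t by auto
    then show False by (metis Ints_of_int avoid imageE)
  qed
  show "f t < of_int (k + 1)"
  proof (rule ccontr)
    assume "\<not> f t < of_int (k + 1)"
    then have "of_int (k + 1) \<in> f ` J"
      using connectedD_interval[OF img, of "f s" "f t" "of_int (k + 1)"] s t by auto
    then show False by (metis Ints_of_int avoid imageE)
  qed
qed

lemma sin_2pi_shift: "sin (2 * pi * (v - of_int k)) = sin (2 * pi * v)"
proof -
  have "2 * pi * (v - of_int k) = 2 * pi * v - 2 * pi * of_int k" by (simp add: algebra_simps)
  then show ?thesis using sin_diff[of "2 * pi * v" "2 * pi * of_int k"] by (simp add: cos_int_2pin sin_int_2pin)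
qed

lemma sin_2pi_sign:
  assumes "\<bar>v - of_int k\<bar> < 1 / 2"
  shows "sin (2 * pi * v) > 0 \<Longrightarrow> of_int k < v" "sin (2 * pi * v) < 0 \<Longrightarrow> v < of_int k"
proof -
  define w where "w = v - of_int k"
  have w: "\<bar>w\<bar> < 1/2" and s: "sin (2 * pi * w) = sin (2 * pi * v)"
    using assms sin_2pi_shift by (auto simp: w_def)
  have nn: "0 \<le> sin (2 * pi * x)" if "0 \<le> x" "x \<le> 1/2" for x :: real
  proof -
    have "2 * pi * x \<le> 2 * pi * (1/2)" using that by (intro mult_left_mono) auto
    then show ?thesis using that by (intro sin_ge_zero) auto
  qed
  have "sin (2 * pi * w) \<le> 0" if "w \<le> 0"
    using nn[of "- w"] w that by simp
  then show "sin (2 * pi * v) > 0 \<Longrightarrow> of_int k < v" unfolding s by (force simp: w_def)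
  have "sin (2 * pi * w) \<ge> 0" if "w \<ge> 0"
    using nn[of w] w that by simp
  then show "sin (2 * pi * v) < 0 \<Longrightarrow> v < of_int k" unfolding s by (force simp: w_def)
qed

text \<open>Within distance 1/2 of an integer the sign of the sine tells the side. One sample point
  near \<open>a\<close> settles the whole interval, because \<open>kappa\<close> cannot leave the
  gap between consecutive integers; so \<open>pos\<close> asks only for points arbitrarily close to
  \<open>a\<close>.\<close>

lemma kappa_right_of_integer:
  assumes ab: "a < b" and k: "kappa a = of_int k"
    and avoid: "\<And>t. a < t \<Longrightarrow> t < b \<Longrightarrow> kappa t \<notin> \<int>"
    and pos: "\<And>e. e > a \<Longrightarrow> \<exists>t>a. t < e \<and> sin (2 * pi * kappa t) > 0"
    and t: "a < t" "t < b"
  shows "of_int k < kappa t" "kappa t < of_int (k + 1)"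
proof -
  have "isCont kappa a" using continuous_kappa by (simp add: continuous_on_eq_continuous_at)
  then obtain d where d: "d > 0" "\<And>t. \<bar>t - a\<bar> < d \<Longrightarrow> \<bar>kappa t - kappa a\<bar> < 1/2"
    unfolding continuous_at_eps_delta by (metis dist_real_def half_gt_zero_iff zero_less_one)
  obtain s where s: "a < s" "s < min b (a + d)" "sin (2 * pi * kappa s) > 0"
    using pos[of "min b (a + d)"] ab d(1) by auto
  have near: "\<bar>kappa s - of_int k\<bar> < 1/2" using d(2)[of s] s k by simp
  have "of_int k < kappa s" "kappa s < of_int (k + 1)" using sin_2pi_sign(1)[OF near s(3)] near by auto
  then show "of_int k < kappa t" "kappa t < of_int (k + 1)"
    using continuous_avoiding_integers[OF connected_Ioo continuous_on_subset[OF continuous_kappa subset_UNIV], of a b s k t]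
      avoid s t by auto
qed

lemma kappa_left_of_integer:
  assumes ab: "a < b" and k: "kappa b = of_int k"
    and avoid: "\<And>t. a < t \<Longrightarrow> t < b \<Longrightarrow> kappa t \<notin> \<int>"
    and neg: "\<And>e. e < b \<Longrightarrow> \<exists>t>e. t < b \<and> sin (2 * pi * kappa t) < 0"
    and t: "a < t" "t < b"
  shows "of_int (k - 1) < kappa t" "kappa t < of_int k"
proof -
  have "isCont kappa b" using continuous_kappa by (simp add: continuous_on_eq_continuous_at)
  then obtain d where d: "d > 0" "\<And>t. \<bar>t - b\<bar> < d \<Longrightarrow> \<bar>kappa t - kappa b\<bar> < 1/2"
    unfolding continuous_at_eps_delta by (metis dist_real_def half_gt_zero_iff zero_less_one)
  obtain s where s: "max a (b - d) < s" "s < b" "sin (2 * pi * kappa s) < 0"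
    using neg[of "max a (b - d)"] ab d(1) by auto
  have near: "\<bar>kappa s - of_int k\<bar> < 1/2" using d(2)[of s] s k by simp
  have "of_int (k - 1) < kappa s" "kappa s < of_int (k - 1 + 1)" using sin_2pi_sign(2)[OF near s(3)] near by auto
  then show "of_int (k - 1) < kappa t" "kappa t < of_int k"
    using continuous_avoiding_integers[OF connected_Ioo continuous_on_subset[OF continuous_kappa subset_UNIV], of a b s "k - 1" t]
      avoid s t by auto
qed

text \<open>This equals Z(t)^2, the squared absolute value of zeta on the line. Its derivative has
  the sign of \<open>xi_line * hardy'\<close>, and it exceeds its value at a zero whatever the
  multiplicity.\<close>

definition hardy_square :: "real \<Rightarrow> real" where
  "hardy_square t = (xi_line t)\<^sup>2 * exp (- 2 * Re (log_gamma_factor (crit t)))"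

lemma hardy_square_has_derivative:
  "(hardy_square has_real_derivative 2 * exp (- 2 * Re (log_gamma_factor (crit t))) * (xi_line t * hardy' t)) (at t)"
proof -
  have "((\<lambda>t. Re (log_gamma_factor (crit t))) has_real_derivative Re (\<i> * log_gamma_factor' (crit t))) (at t)"
    by (intro has_real_derivative_along_crit log_gamma_factor_has_derivative) simp
  then have d: "((\<lambda>t. Re (log_gamma_factor (crit t))) has_real_derivative - gamma_decay t) (at t)"
    unfolding log_gamma_factor'_crit by simp
  show ?thesis unfolding hardy_square_def
    by (rule derivative_eq_intros d xi_line_has_derivative refl)+ (simp add: hardy'_def power2_eq_square algebra_simps)
qed

lemma hardy_square_mvt:
  assumes "a < b"
  obtains t where "a < t" "t < b" "sgn (xi_line t * hardy' t) = sgn (hardy_square b - hardy_square a)"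
proof -
  obtain t where t: "a < t" "t < b"
    and e: "hardy_square b - hardy_square a = (b - a) * (2 * exp (- 2 * Re (log_gamma_factor (crit t))) * (xi_line t * hardy' t))"
    using MVT2[OF assms hardy_square_has_derivative] by blast
  have "sgn (hardy_square b - hardy_square a) = sgn (xi_line t * hardy' t)"
    unfolding e using assms by (simp add: sgn_mult)
  then show ?thesis using t that by metis
qed

text \<open>Seen from \<open>a\<close>, the midpoint value lies in the unit interval above
  \<open>k\<close>; seen from \<open>b\<close>, it lies in the one below \<open>kappa b\<close>.
  These must be the same interval. The point \<open>a\<close> may be a zero or \<open>t0\<close>,
  which is why \<open>right\<close> is a hypothesis.\<close>

lemma kappa_next_zero:
  assumes t0: "theta' t0 = 0" "\<And>t. t0 < t \<Longrightarrow> theta' t > 0"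
    and a: "t0 \<le> a" "a < b" "kappa a = of_int k" "xi_line b = 0"
    and nz: "\<And>t. a < t \<Longrightarrow> t < b \<Longrightarrow> xi_line t \<noteq> 0"
    and right: "\<And>e. e > a \<Longrightarrow> \<exists>t>a. t < e \<and> xi_line t * hardy' t > 0"
  shows "kappa b = of_int (k + 1)"
proof -
  have avoid: "kappa t \<notin> \<int>" if "a < t" "t < b" for t
    using kappa_integer_iff[of t] nz[OF that] t0(2)[of t] that a by auto
  obtain k' where k': "kappa b = of_int k'"
    using kappa_integer_iff[of b] a(4) by (auto elim: Ints_cases)
  define m where "m = (a + b) / 2"
  have m: "a < m" "m < b" using a by (auto simp: m_def)
  have pos: "\<exists>t>a. t < e \<and> sin (2 * pi * kappa t) > 0" if e: "e > a" for e
  proof -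
    obtain t where t: "a < t" "t < e" "xi_line t * hardy' t > 0" using right[OF e] by blast
    then have "theta' t * (xi_line t * hardy' t) > 0"
      using mult_pos_pos[OF _ t(3), of "theta' t"] t0(2)[of t] t(1) a(1) by simp
    then have "sgn (sin (2 * pi * kappa t)) = 1"
      unfolding sgn_sin_kappa by (rule sgn_pos)
    then show ?thesis using t by (auto simp: sgn_1_pos)
  qed
  have neg: "\<exists>t>e. t < b \<and> sin (2 * pi * kappa t) < 0" if e: "e < b" for e
  proof -
    have M: "a < max e m" "max e m < b" using m e by auto
    obtain t where t: "max e m < t" "t < b" "sgn (xi_line t * hardy' t) = sgn (hardy_square b - hardy_square (max e m))"
      using hardy_square_mvt[OF M(2)] by blast
    have "hardy_square b = 0" "hardy_square (max e m) > 0" using a nz[OF M] by (auto simp: hardy_square_def)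
    then have "sgn (xi_line t * hardy' t) = -1" using t by simp
    then have "sgn (sin (2 * pi * kappa t)) = -1"
      unfolding sgn_sin_kappa using t0(2)[of t] a t m by (simp add: sgn_mult)
    then show ?thesis using t by (auto simp: sgn_1_neg)
  qed
  have "of_int k < kappa m" "kappa m < of_int (k + 1)"
    using kappa_right_of_integer[OF a(2,3) avoid pos m] by auto
  moreover have "of_int (k' - 1) < kappa m" "kappa m < of_int k'"
    using kappa_left_of_integer[OF a(2) k' avoid neg m] by auto
  ultimately have "real_of_int k < of_int k'" "real_of_int (k' - 1) < of_int (k + 1)" by linarith+
  then have "k' = k + 1" by linarith
  then show ?thesis using k' by simp
qed

theorem proposition17:
  fixes \<xi> :: "nat \<Rightarrow> real"
  assumes "strict_mono_on {1..} \<xi>"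
    and "\<xi> ` {1..} = {t. t > 0 \<and> zeta (1/2 + \<i> * of_real t) = 0}"
  shows "\<forall>n\<ge>1. kappa (\<xi> n) = real n"
proof -
  have zeros: "\<xi> ` {1..} = {t. t > 0 \<and> xi_line t = 0}"
    using assms(2) unfolding zeta_crit_eq_0_iff .
  obtain t0 where t0: "0 < t0" "theta' t0 = 0" "\<And>t. 0 \<le> t \<Longrightarrow> t < t0 \<Longrightarrow> theta' t < 0"
    "\<And>t. t0 < t \<Longrightarrow> theta' t > 0" and xi: "\<And>t. 0 \<le> t \<Longrightarrow> t \<le> t0 \<Longrightarrow> xi_line t < 0" and h0: "hardy' t0 < 0"
    by (rule theta'_sign_change) (rule that)
  have zero: "xi_line (\<xi> n) = 0" "\<xi> n > t0" if "n \<ge> 1" for n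
  proof -
    have "\<xi> n > 0" "xi_line (\<xi> n) = 0" using zeros that by auto
    then show "xi_line (\<xi> n) = 0" "\<xi> n > t0" using xi[of "\<xi> n"] by force+
  qed
  have less: "\<xi> m < \<xi> n" if "1 \<le> m" "m < n" for m n
    using assms(1) that by (auto simp: strict_mono_on_def)
  have idx: "\<exists>m\<ge>1. t = \<xi> m" if "xi_line t = 0" "t > 0" for t
  proof -
    have "t \<in> \<xi> ` {1..}" using that zeros by simp
    then show ?thesis by auto
  qed

  have Dpos: "2 * exp (- 2 * Re (log_gamma_factor (crit t0))) * (xi_line t0 * hardy' t0) > 0"
    using xi[of t0] h0 t0(1) by (simp add: mult_neg_neg)
  have right0: "\<exists>t>t0. t < e \<and> xi_line t * hardy' t > 0" if e: "e > t0" for e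
  proof -
    obtain d where d: "d > 0" "\<And>h. 0 < h \<Longrightarrow> h < d \<Longrightarrow> hardy_square t0 < hardy_square (t0 + h)"
      using DERIV_pos_inc_right[OF hardy_square_has_derivative Dpos] by blast
    define h where "h = min (d / 2) ((e - t0) / 2)"
    have h: "0 < h" "h < d" "t0 + h < e" using d(1) e by (auto simp: h_def min_def field_simps)
    obtain t where "t0 < t" "t < t0 + h" "sgn (xi_line t * hardy' t) = sgn (hardy_square (t0 + h) - hardy_square t0)"
      using hardy_square_mvt[of t0 "t0 + h"] h(1) by auto
    then show ?thesis using d(2)[OF h(1,2)] h(3) by (intro exI[of _ t]) (auto simp: sgn_1_pos)
  qed
  \<comment> \<open>Z^2 increases through \<open>t0\<close>, so the product
    \<open>xi_line * hardy'\<close> is positive on this side too; the negative \<open>theta'\<close>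
    flips the sign of the sine. The \<open>max e 0\<close> keeps the sample where
    \<open>theta'\<close> is known to be negative.\<close>
  have left0: "\<exists>t>e. t < t0 \<and> sin (2 * pi * kappa t) < 0" if e: "e < t0" for e
  proof -
    obtain d where d: "d > 0" "\<And>h. 0 < h \<Longrightarrow> h < d \<Longrightarrow> hardy_square (t0 - h) < hardy_square t0"
      using DERIV_pos_inc_left[OF hardy_square_has_derivative Dpos] by blast
    define h where "h = min (d / 2) ((t0 - max e 0) / 2)"
    have h: "0 < h" "h < d" "t0 - h > max e 0" using d(1) e t0(1) by (auto simp: h_def min_def field_simps)
    obtain t where t: "t0 - h < t" "t < t0" "sgn (xi_line t * hardy' t) = sgn (hardy_square t0 - hardy_square (t0 - h))"
      using hardy_square_mvt[of "t0 - h" t0] h(1) by auto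
    then have "sgn (xi_line t * hardy' t) = 1" using d(2)[OF h(1,2)] by simp
    then have "sgn (sin (2 * pi * kappa t)) = -1"
      unfolding sgn_sin_kappa using t0(3)[of t] t h(3) by (simp add: sgn_mult)
    then show ?thesis using t h(3) by (intro exI[of _ t]) (auto simp: sgn_1_neg)
  qed

  \<comment> \<open>Starting from -1/2, \<open>kappa\<close> stays in (-1, 0) before
    \<open>t0\<close>, while \<open>left0\<close> places it in the unit interval just below its
    value at \<open>t0\<close>.\<close>
  have kt0: "kappa t0 = of_int 0"
  proof -
    obtain k where k: "kappa t0 = of_int k" using kappa_integer_iff[of t0] t0(2) by (auto elim: Ints_cases)
    have avoid: "kappa t \<notin> \<int>" if "0 \<le> t" "t < t0" for t
      using kappa_integer_iff[of t] xi[of t] t0(3)[of t] that by auto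
    have m: "0 < t0 / 2" "t0 / 2 < t0" using t0(1) by auto
    have "of_int (- 1) < kappa (t0 / 2)" "kappa (t0 / 2) < of_int (- 1 + 1)"
      using continuous_avoiding_integers[of "{0..<t0}" kappa 0 "- 1" "t0 / 2"] avoid kappa_0 t0(1) m
        continuous_on_subset[OF continuous_kappa] by auto
    moreover have "of_int (k - 1) < kappa (t0 / 2)" "kappa (t0 / 2) < of_int k"
      using kappa_left_of_integer[OF t0(1) k avoid left0 m] by auto
    ultimately have "real_of_int (- 1) < of_int k" "real_of_int (k - 1) < of_int (- 1 + 1)" by linarith+
    then have "k = 0" by linarith
    then show ?thesis using k by simp
  qed

  have "kappa (\<xi> n) = of_int (int n)" if "n \<ge> 1" for n
    using that
  proof (induction n rule: nat_induct_at_least)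
    case base
    have nz: "xi_line t \<noteq> 0" if t: "t0 < t" "t < \<xi> 1" for t
    proof
      assume "xi_line t = 0"
      then obtain m where "m \<ge> 1" "t = \<xi> m" using idx[of t] t t0(1) by auto
      then show False using less[of 1 m] t by (cases "m = 1") auto
    qed
    have "kappa (\<xi> 1) = of_int (0 + 1)"
      using kappa_next_zero[OF t0(2,4) order_refl zero(2) kt0 zero(1) nz right0] by simp
    then show ?case by simp
  next
    case (Suc n)
    have ab: "\<xi> n < \<xi> (Suc n)" using less[of n "Suc n"] Suc by simp
    have nz: "xi_line t \<noteq> 0" if t: "\<xi> n < t" "t < \<xi> (Suc n)" for t
    proof
      assume "xi_line t = 0"
      then obtain m where m: "m \<ge> 1" "t = \<xi> m" using idx[of t] t zero(2)[of n] t0(1) Suc by auto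
      have "n < m" using less[of m n] m t Suc by (cases m n rule: linorder_cases) auto
      moreover have "m < Suc n" using less[of "Suc n" m] m t by (cases m "Suc n" rule: linorder_cases) auto
      ultimately show False by simp
    qed
    have right: "\<exists>t>\<xi> n. t < e \<and> xi_line t * hardy' t > 0" if e: "e > \<xi> n" for e
    proof -
      \<comment> \<open>Capping at the next zero keeps \<open>xi_line m\<close> nonzero, so
        \<open>hardy_square\<close> must rise from 0 somewhere between \<xi> n and
        \<open>m\<close>.\<close>
      define c where "c = min e (\<xi> (Suc n))"
      define m where "m = (\<xi> n + c) / 2"
      have m: "\<xi> n < m" "m < e" "m < \<xi> (Suc n)" using e ab by (auto simp: m_def c_def min_def)
      obtain t where t: "\<xi> n < t" "t < m" "sgn (xi_line t * hardy' t) = sgn (hardy_square m - hardy_square (\<xi> n))"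
        using hardy_square_mvt[OF m(1)] by blast
      have "hardy_square (\<xi> n) = 0" "hardy_square m > 0"
        using zero(1)[of n] Suc nz[OF m(1,3)] by (auto simp: hardy_square_def)
      then show ?thesis using t m by (intro exI[of _ t]) (auto simp: sgn_1_pos)
    qed
    have "kappa (\<xi> (Suc n)) = of_int (int n + 1)"
      by (rule kappa_next_zero[OF t0(2,4) _ ab _ zero(1) nz right])
         (use zero(2)[of n] Suc in auto)
    then show ?case by simp
  qed
  then show ?thesis by simp
qed

end
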